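(* The CNG SAT leads to a consistent, conservative, and energy stable discretization, and has the coefficients $$T^{(1)}_{\gamma k}=T^{(1)}_{\gamma v}=\tfrac1{16}B_\gamma\Big[\tfrac1{\alpha_{\gamma k}}\Upsilon_{\gamma\gamma k}+\tfrac1{\alpha_{\gamma v}}\Upsilon_{\gamma\gamma v}\Big]B_\gamma,\quad T^{(3)}_{\gamma k}=T^{(3)}_{\gamma v}=\tfrac12B_\gamma,\quad T^{(D)}_\gamma=\tfrac1{\alpha_{\gamma k}}B_\gamma\Upsilon_{\gamma\gamma k}B_\gamma,$$ $$T^{(5)}_{\gamma\epsilon k}=T^{(6)}_{\gamma\epsilon k}=T^{(5)}_{\gamma\delta v}=T^{(6)}_{\gamma\delta v}=0,\quad T^{(2)}_{\gamma k}=T^{(2)}_{\gamma v}=0,\quad T^{(4)}_{\gamma k}=T^{(4)}_{\gamma v}=0.$$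
   Context: **Problem.** $\Omega\subset\mathbb R^2$ is compact with piecewise smooth boundary $\Gamma^D\cup\Gamma^N$ ($\Gamma^D\ne\emptyset$), $\lambda$ a symmetric positive definite (SPD) $2\times2$ tensor field. $\partial_t\mathcal U-\nabla\cdot(\lambda\nabla\mathcal U)=\mathcal F$ in $\Omega$, $\mathcal U=\mathcal U_D$ on $\Gamma^D$, $(\lambda\nabla\mathcal U)\cdot n=\mathcal U_N$ on $\Gamma^N$. **Mesh.** Non-overlapping (possibly curved) triangles $\Omega_k$ of diameter $h$, images of the reference triangle under bijective polynomial maps of degree at most $p+1$ with exact metric terms. $\Gamma_k$: facets of $\Omega_k$; $\Gamma_k^I$: the interior ones. For an interior facet $\gamma$ of $\Omega_k$, $\Omega_v$ is the neighbour across $\gamma$. ($\epsilon$ and $\delta$ denote the other interior facets of $\Omega_k$ and $\Omega_v$; $T^{(5)},T^{(6)}$ are coefficients of terms coupling through those facets and are absent here.) **Operators.** On $\Omega_k$ ($n_p$ volume nodes, $n_f$ nodes per facet, Legendre–Gauss facet quadrature of degree $2p+1$): $H_k$ diagonal SPD norm (quadrature) matrix; $B_\gamma$ diagonal matrix of positive facet quadrature weights (common to both sides); $N_{x\gamma k},N_{y\gamma k}$ diagonal matrices of outward unit normal components at facet nodes; $R_{\gamma k}\in\mathbb R^{n_f\times n_p}$ extrapolation to facet nodes, exact for degree $\le p$ polynomials on the reference element; $D_{xk},D_{yk}$ degree-$p$ SBP first-derivative matrices (order $p$ accurate at nodes, $D_{xk}\mathbf 1=D_{yk}\mathbf 1=0$)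 with $H_kD_{xk}+(H_kD_{xk})^T=\sum_{\gamma\subset\Gamma_k}R_{\gamma k}^TB_\gamma N_{x\gamma k}R_{\gamma k}$, similarly $y$. $\Lambda_k$: $2\times2$ block matrix with diagonal blocks holding $\lambda$ at the volume nodes. $N_{\gamma k}=\begin{bmatrix}N_{x\gamma k}\\ N_{y\gamma k}\end{bmatrix}$, $\bar R_{\gamma k}=\mathrm{diag}(R_{\gamma k},R_{\gamma k})$, $\bar H_k=\mathrm{diag}(H_k,H_k)$, $D^{(2)}_k=[D_{xk}\; D_{yk}]\Lambda_k\begin{bmatrix}D_{xk}\\ D_{yk}\end{bmatrix}$, $D_{\gamma k}=N_{\gamma k}^T\bar R_{\gamma k}\Lambda_k\begin{bmatrix}D_{xk}\\ D_{yk}\end{bmatrix}$, $\Upsilon_{\gamma\gamma k}=N_{\gamma k}^T\bar R_{\gamma k}\bar H_k^{-1}\Lambda_k\bar R_{\gamma k}^TN_{\gamma k}$. Facet weights $\alpha_{\gamma k}>0$ with $\sum_{\gamma\subset\Gamma_k}\alpha_{\gamma k}=1$. **Discretization** (with $T^{(5)}=T^{(6)}=0$). $\frac{du_{h,k}}{dt}=D^{(2)}_ku_{h,k}+f_k-H_k^{-1}s_k^I-H_k^{-1}s_k^B$, with $$s_k^I=\sum_{\gamma\subset\Gamma_k^I}[R_{\gamma k}^T\; D_{\gamma k}^T]\begin{bmatrix}T^{(1)}_{\gamma k}&T^{(3)}_{\gamma k}\\ T^{(2)}_{\gamma k}&T^{(4)}_{\gamma k}\end{bmatrix}\begin{bmatrix}R_{\gamma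 k}u_k-R_{\gamma v}u_v\\ D_{\gamma k}u_k+D_{\gamma v}u_v\end{bmatrix},$$ $$s_k^B=\sum_{\gamma\subset\Gamma^D\cap\Gamma_k}[R_{\gamma k}^T\; D_{\gamma k}^T]\begin{bmatrix}T_\gamma^{(D)}\\ -B_\gamma\end{bmatrix}(R_{\gamma k}u_k-u_{\gamma k})+\sum_{\gamma\subset\Gamma^N\cap\Gamma_k}R_{\gamma k}^TB_\gamma(D_{\gamma k}u_k-w_{\gamma k}),$$ $f_k$, $u_{\gamma k}$, $w_{\gamma k}$ the nodal values of $\mathcal F$, $\mathcal U$, $n\cdot(\lambda\nabla\mathcal U)$; set $L_{h,k}(u)=-D^{(2)}_ku_k+H_k^{-1}s^I_k+H_k^{-1}s^B_k$. **Definitions.** *Energy stable*: for $\mathcal F=\mathcal U_D=\mathcal U_N=0$, $\frac{d}{dt}\sum_ku_{h,k}^TH_ku_{h,k}\le0$. *Consistent*: $\lim_{h\to0}\sum_k\|L_{h,k}(u)-f_k\|_{H_k}=0$ for the exact steady solution in $\mathcal C^{p+1}$. *Conservative*: for $f_k=0$, $\sum_k\mathbf 1^TH_k\frac{du_{h,k}}{dt}$ reduces to boundary-facet terms only. **CNG SAT** is the name (Carpenter–Nordström–Gottlieb) for the interface coupling defined by the coefficients in the claim (diffusive part, for multidimensional SBP operators).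
   Formalization: Consistency, false as defined for p=1,2, is shown for p≥3 (for p=2 in the global H-norm, root of the sum of squares), assuming λ in C^p near Ω, uniformly order-p accurate D, shape-regular meshes with h-scaled element maps and operators, and α bounded below. *)

theory Defs
  imports "HOL-Analysis.Analysis"
begin

section \<open>Block matrices\<close>

definition diag_mat :: "real^'n \<Rightarrow> real^'n^'n" where
  "diag_mat d = (\<chi> i j. if i = j then d $ i else 0)"

definition hcat :: "real^'a^'m \<Rightarrow> real^'b^'m \<Rightarrow> real^('a + 'b)^'m" where
  "hcat A B = (\<chi> i j. case j of Inl a \<Rightarrow> A $ i $ a | Inr b \<Rightarrow> B $ i $ b)"

definition vcat :: "real^'n^'a \<Rightarrow> real^'n^'b \<Rightarrow> real^'n^('a + 'b)" where
  "vcat A B = (\<chi> i. case i of Inl a \<Rightarrow> A $ a | Inr b \<Rightarrow> B $ b)"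

definition block_diag :: "real^'a^'m \<Rightarrow> real^'b^'n \<Rightarrow> real^('a + 'b)^('m + 'n)" where
  "block_diag A B = vcat (hcat A 0) (hcat 0 B)"


section \<open>Differential calculus in the plane\<close>

definition partial :: "2 \<Rightarrow> (real^2 \<Rightarrow> real) \<Rightarrow> real^2 \<Rightarrow> real" where
  "partial i f x = frechet_derivative f (at x) (axis i 1)"

definition grad :: "(real^2 \<Rightarrow> real) \<Rightarrow> real^2 \<Rightarrow> real^2" where
  "grad f x = (\<chi> i. partial i f x)"

definition divergence :: "(real^2 \<Rightarrow> real^2) \<Rightarrow> real^2 \<Rightarrow> real" where
  "divergence V x = (\<Sum>i\<in>UNIV. partial i (\<lambda>y. V y $ i) x)"

fun Ck_on_open :: "nat \<Rightarrow> (real^2) set \<Rightarrow> (real^2 \<Rightarrow> real) \<Rightarrow> bool" where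
  "Ck_on_open 0 S f \<longleftrightarrow> continuous_on S f"
| "Ck_on_open (Suc m) S f \<longleftrightarrow>
     (\<forall>x\<in>S. f differentiable (at x)) \<and> (\<forall>i. Ck_on_open m S (partial i f))"

text \<open>Smoothness up to the boundary of a closed set means smoothness on a neighbourhood of it.\<close>

definition Ck_on :: "nat \<Rightarrow> (real^2) set \<Rightarrow> (real^2 \<Rightarrow> real) \<Rightarrow> bool" where
  "Ck_on m S f \<longleftrightarrow> (\<exists>U. open U \<and> S \<subseteq> U \<and> Ck_on_open m U f)"

text \<open>All partial derivatives of order at most \<open>m\<close> are bounded by \<open>b\<close> on \<open>S\<close>.\<close>

fun Ck_bounded :: "nat \<Rightarrow> (real^2) set \<Rightarrow> real \<Rightarrow> (real^2 \<Rightarrow> real) \<Rightarrow> bool" where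
  "Ck_bounded 0 S b f \<longleftrightarrow> (\<forall>x\<in>S. \<bar>f x\<bar> \<le> b)"
| "Ck_bounded (Suc m) S b f \<longleftrightarrow>
     (\<forall>x\<in>S. \<bar>f x\<bar> \<le> b) \<and> (\<forall>i. Ck_bounded m S b (partial i f))"

text \<open>The polynomial of total degree at most \<open>d\<close> with coefficients \<open>c\<close>.\<close>

definition poly2 :: "nat \<Rightarrow> (nat \<Rightarrow> nat \<Rightarrow> real) \<Rightarrow> real^2 \<Rightarrow> real" where
  "poly2 d c x = (\<Sum>i\<le>d. \<Sum>j\<le>d - i. c i j * (x $ 1) ^ i * (x $ 2) ^ j)"


section \<open>The diffusion problem\<close>

definition diffusion_domain :: "(real^2) set \<Rightarrow> (real^2) set \<Rightarrow> (real^2) set \<Rightarrow> bool" where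
  "diffusion_domain \<Omega> \<Gamma>D \<Gamma>N \<longleftrightarrow>
     compact \<Omega> \<and> frontier \<Omega> = \<Gamma>D \<union> \<Gamma>N \<and> \<Gamma>D \<noteq> {} \<and>
     (\<exists>P. finite P \<and> (\<forall>g\<in>P. valid_path g) \<and> frontier \<Omega> = (\<Union>g\<in>P. path_image g))"

definition spd :: "real^'n^'n \<Rightarrow> bool" where
  "spd A \<longleftrightarrow> transpose A = A \<and> (\<forall>v. v \<noteq> 0 \<longrightarrow> 0 < v \<bullet> (A *v v))"

definition flux :: "(real^2 \<Rightarrow> real^2^2) \<Rightarrow> (real^2 \<Rightarrow> real) \<Rightarrow> real^2 \<Rightarrow> real^2" where
  "flux lam U x = lam x *v grad U x"

definition steady_source ::
  "(real^2) set \<Rightarrow> (real^2 \<Rightarrow> real^2^2) \<Rightarrow> (real^2 \<Rightarrow> real) \<Rightarrow> (real^2 \<Rightarrow> real) \<Rightarrow> bool" where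
  "steady_source \<Omega> lam F U \<longleftrightarrow> (\<forall>x\<in>\<Omega>. - divergence (flux lam U) x = F x)"


section \<open>Reference element, mesh and operators\<close>

record ('np::finite, 'nf::finite) ref_elem =
  deg :: nat
  rnode :: "'np \<Rightarrow> real^2"
  gnode :: "'nf \<Rightarrow> real"
  gwt :: "'nf \<Rightarrow> real"

definition ref_tri :: "(real^2) set" where
  "ref_tri = convex hull {vector [0, 0], vector [1, 0], vector [0, 1]}"

definition ref_edges :: "(real^2) set set" where
  "ref_edges = {{vector [0, 0], vector [1, 0]}, {vector [1, 0], vector [0, 1]},
                {vector [0, 1], vector [0, 0]}}"

text \<open>Gauss quadrature on \<open>[-1, 1]\<close> with weight function 1: \<open>p + 1\<close> nodes and degree \<open>2p + 1\<close>.\<close>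

definition legendre_gauss :: "nat \<Rightarrow> ('nf::finite \<Rightarrow> real) \<Rightarrow> ('nf \<Rightarrow> real) \<Rightarrow> bool" where
  "legendre_gauss p s w \<longleftrightarrow>
     CARD('nf) = p + 1 \<and> inj s \<and> (\<forall>i. -1 < s i \<and> s i < 1 \<and> 0 < w i) \<and>
     (\<forall>q :: real poly. degree q \<le> 2 * p + 1 \<longrightarrow>
        (\<Sum>i\<in>UNIV. w i * poly q (s i)) = integral {-1..1} (poly q))"

definition valid_ref_elem :: "('np::finite, 'nf::finite) ref_elem \<Rightarrow> bool" where
  "valid_ref_elem r \<longleftrightarrow>
     1 \<le> deg r \<and> inj (rnode r) \<and> range (rnode r) \<subseteq> ref_tri \<and>
     legendre_gauss (deg r) (gnode r) (gwt r)"

text \<open>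
  Elements and facets are numbered. \<open>facets M k\<close> is the set of facets of element \<open>k\<close>; a facet that
  is in neither \<open>dir_facets\<close> nor \<open>neu_facets\<close> is interior. \<open>ecoef\<close> holds the coefficients of the
  polynomial element maps. A facet carries a parametrization \<open>fcurve\<close> over \<open>[-1, 1]\<close> common to both
  sides, so that the facet nodes and weights and their ordering do not depend on the side; for
  each adjacent element, \<open>fends\<close> gives the reference vertices that correspond to the parameter
  values \<open>-1\<close> and \<open>1\<close>. \<open>Hw\<close> is the diagonal of the norm matrix and \<open>fwt\<close> holds the
  facet weights \<open>\<alpha>\<close>.
\<close>

record ('np::finite, 'nf::finite) sbp_mesh =
  elems :: "nat set"
  facets :: "nat \<Rightarrow> nat set"
  dir_facets :: "nat set"
  neu_facets :: "nat set"
  ecoef :: "nat \<Rightarrow> nat \<Rightarrow> nat \<Rightarrow> real^2"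
  fcurve :: "nat \<Rightarrow> real \<Rightarrow> real^2"
  fends :: "nat \<Rightarrow> nat \<Rightarrow> (real^2) \<times> (real^2)"
  fnormal :: "nat \<Rightarrow> nat \<Rightarrow> 'nf \<Rightarrow> real^2"
  Hw :: "nat \<Rightarrow> real^'np"
  Dx :: "nat \<Rightarrow> real^'np^'np"
  Dy :: "nat \<Rightarrow> real^'np^'np"
  Rm :: "nat \<Rightarrow> nat \<Rightarrow> real^'np^'nf"
  fwt :: "nat \<Rightarrow> nat \<Rightarrow> real"

definition emap ::
  "('np::finite, 'nf::finite) ref_elem \<Rightarrow> ('np, 'nf) sbp_mesh \<Rightarrow> nat \<Rightarrow> real^2 \<Rightarrow> real^2" where
  "emap r M k \<xi> = (\<chi> c. poly2 (deg r + 1) (\<lambda>i j. ecoef M k i j $ c) \<xi>)"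

definition cell ::
  "('np::finite, 'nf::finite) ref_elem \<Rightarrow> ('np, 'nf) sbp_mesh \<Rightarrow> nat \<Rightarrow> (real^2) set" where
  "cell r M k = emap r M k ` ref_tri"

definition vnode ::
  "('np::finite, 'nf::finite) ref_elem \<Rightarrow> ('np, 'nf) sbp_mesh \<Rightarrow> nat \<Rightarrow> 'np \<Rightarrow> real^2" where
  "vnode r M k j = emap r M k (rnode r j)"

definition fnode ::
  "('np::finite, 'nf::finite) ref_elem \<Rightarrow> ('np, 'nf) sbp_mesh \<Rightarrow> nat \<Rightarrow> 'nf \<Rightarrow> real^2" where
  "fnode r M \<gamma> i = fcurve M \<gamma> (gnode r i)"

definition ftangent ::
  "('np::finite, 'nf::finite) ref_elem \<Rightarrow> ('np, 'nf) sbp_mesh \<Rightarrow> nat \<Rightarrow> 'nf \<Rightarrow> real^2" where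
  "ftangent r M \<gamma> i = vector_derivative (fcurve M \<gamma>) (at (gnode r i))"

definition ref_edge_pt ::
  "('np::finite, 'nf::finite) sbp_mesh \<Rightarrow> nat \<Rightarrow> nat \<Rightarrow> real \<Rightarrow> real^2" where
  "ref_edge_pt M k \<gamma> t =
     ((1 - t) / 2) *\<^sub>R fst (fends M k \<gamma>) + ((1 + t) / 2) *\<^sub>R snd (fends M k \<gamma>)"

definition int_facets :: "('np::finite, 'nf::finite) sbp_mesh \<Rightarrow> nat \<Rightarrow> nat set" where
  "int_facets M k = facets M k - (dir_facets M \<union> neu_facets M)"

definition nbr :: "('np::finite, 'nf::finite) sbp_mesh \<Rightarrow> nat \<Rightarrow> nat \<Rightarrow> nat" where
  "nbr M k \<gamma> = (THE v. v \<in> elems M \<and> v \<noteq> k \<and> \<gamma> \<in> facets M v)"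

definition mesh_size :: "('np::finite, 'nf::finite) ref_elem \<Rightarrow> ('np, 'nf) sbp_mesh \<Rightarrow> real" where
  "mesh_size r M = Max ((\<lambda>k. diameter (cell r M k)) ` elems M)"

definition Hm :: "('np::finite, 'nf::finite) sbp_mesh \<Rightarrow> nat \<Rightarrow> real^'np^'np" where
  "Hm M k = diag_mat (Hw M k)"

definition Bm ::
  "('np::finite, 'nf::finite) ref_elem \<Rightarrow> ('np, 'nf) sbp_mesh \<Rightarrow> nat \<Rightarrow> real^'nf^'nf" where
  "Bm r M \<gamma> = diag_mat (\<chi> i. gwt r i * norm (ftangent r M \<gamma> i))"

definition Nm :: "('np::finite, 'nf::finite) sbp_mesh \<Rightarrow> 2 \<Rightarrow> nat \<Rightarrow> nat \<Rightarrow> real^'nf^'nf" where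
  "Nm M c k \<gamma> = diag_mat (\<chi> i. fnormal M k \<gamma> i $ c)"

definition geometric_mesh ::
  "(real^2) set \<Rightarrow> (real^2) set \<Rightarrow> (real^2) set \<Rightarrow>
   ('np::finite, 'nf::finite) ref_elem \<Rightarrow> ('np, 'nf) sbp_mesh \<Rightarrow> bool" where
  "geometric_mesh \<Omega> \<Gamma>D \<Gamma>N r M \<longleftrightarrow>
     finite (elems M) \<and>
     (\<forall>k\<in>elems M. inj_on (emap r M k) ref_tri) \<and>
     (\<Union>k\<in>elems M. cell r M k) = \<Omega> \<and>
     (\<forall>k\<in>elems M. \<forall>v\<in>elems M. k \<noteq> v \<longrightarrow> interior (cell r M k) \<inter> interior (cell r M v) = {}) \<and>
     (\<forall>k\<in>elems M. bij_betw (\<lambda>\<gamma>. {fst (fends M k \<gamma>), snd (fends M k \<gamma>)}) (facets M k) ref_edges) \<and>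
     (\<forall>k\<in>elems M. \<forall>\<gamma>\<in>facets M k. \<forall>t\<in>{-1..1}. fcurve M \<gamma> t = emap r M k (ref_edge_pt M k \<gamma> t)) \<and>
     dir_facets M \<inter> neu_facets M = {} \<and>
     (\<forall>\<gamma>\<in>\<Union>(facets M ` elems M).
        (if \<gamma> \<in> dir_facets M then fcurve M \<gamma> ` {-1..1} \<subseteq> \<Gamma>D \<and> card {k \<in> elems M. \<gamma> \<in> facets M k} = 1
         else if \<gamma> \<in> neu_facets M then fcurve M \<gamma> ` {-1..1} \<subseteq> \<Gamma>N \<and> card {k \<in> elems M. \<gamma> \<in> facets M k} = 1
         else card {k \<in> elems M. \<gamma> \<in> facets M k} = 2)) \<and>
     (\<forall>k\<in>elems M. \<forall>\<gamma>\<in>facets M k. \<forall>i.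
        ftangent r M \<gamma> i \<noteq> 0 \<and> norm (fnormal M k \<gamma> i) = 1 \<and> fnormal M k \<gamma> i \<bullet> ftangent r M \<gamma> i = 0 \<and>
        (\<forall>\<^sub>F \<epsilon> in at_right 0. fnode r M \<gamma> i + \<epsilon> *\<^sub>R fnormal M k \<gamma> i \<notin> cell r M k)) \<and>
     (\<forall>k\<in>elems M. \<forall>\<gamma>\<in>int_facets M k. \<forall>i. fnormal M (nbr M k \<gamma>) \<gamma> i = - fnormal M k \<gamma> i)"

text \<open>
  In \<open>sbp_operators\<close>, the order of accuracy of \<open>Dx\<close> and \<open>Dy\<close> is left out: on curved elements it is
  an asymptotic property of a mesh family, see \<open>order_accurate\<close> below.
\<close>

definition sbp_operators ::
  "('np::finite, 'nf::finite) ref_elem \<Rightarrow> ('np, 'nf) sbp_mesh \<Rightarrow> bool" where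
  "sbp_operators r M \<longleftrightarrow>
     (\<forall>k\<in>elems M.
        (\<forall>j. 0 < Hw M k $ j) \<and>
        Dx M k *v 1 = 0 \<and> Dy M k *v 1 = 0 \<and>
        Hm M k ** Dx M k + transpose (Hm M k ** Dx M k) =
          (\<Sum>\<gamma>\<in>facets M k. transpose (Rm M k \<gamma>) ** Bm r M \<gamma> ** Nm M 1 k \<gamma> ** Rm M k \<gamma>) \<and>
        Hm M k ** Dy M k + transpose (Hm M k ** Dy M k) =
          (\<Sum>\<gamma>\<in>facets M k. transpose (Rm M k \<gamma>) ** Bm r M \<gamma> ** Nm M 2 k \<gamma> ** Rm M k \<gamma>) \<and>
        (\<forall>\<gamma>\<in>facets M k. \<forall>c.
           Rm M k \<gamma> *v (\<chi> j. poly2 (deg r) c (rnode r j)) =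
             (\<chi> i. poly2 (deg r) c (ref_edge_pt M k \<gamma> (gnode r i)))) \<and>
        (\<forall>\<gamma>\<in>facets M k. 0 < fwt M k \<gamma>) \<and> (\<Sum>\<gamma>\<in>facets M k. fwt M k \<gamma>) = 1)"

definition discretized_mesh ::
  "(real^2) set \<Rightarrow> (real^2) set \<Rightarrow> (real^2) set \<Rightarrow>
   ('np::finite, 'nf::finite) ref_elem \<Rightarrow> ('np, 'nf) sbp_mesh \<Rightarrow> bool" where
  "discretized_mesh \<Omega> \<Gamma>D \<Gamma>N r M \<longleftrightarrow> geometric_mesh \<Omega> \<Gamma>D \<Gamma>N r M \<and> sbp_operators r M"


section \<open>Discretization\<close>

definition Lam ::
  "(real^2 \<Rightarrow> real^2^2) \<Rightarrow> ('np::finite, 'nf::finite) ref_elem \<Rightarrow> ('np, 'nf) sbp_mesh \<Rightarrow>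
   nat \<Rightarrow> real^('np + 'np)^('np + 'np)" where
  "Lam lam r M k =
     (let L = (\<lambda>a b. diag_mat (\<chi> j. lam (vnode r M k j) $ a $ b))
      in vcat (hcat (L 1 1) (L 1 2)) (hcat (L 2 1) (L 2 2)))"

definition Nbar :: "('np::finite, 'nf::finite) sbp_mesh \<Rightarrow> nat \<Rightarrow> nat \<Rightarrow> real^'nf^('nf + 'nf)" where
  "Nbar M k \<gamma> = vcat (Nm M 1 k \<gamma>) (Nm M 2 k \<gamma>)"

definition Rbar ::
  "('np::finite, 'nf::finite) sbp_mesh \<Rightarrow> nat \<Rightarrow> nat \<Rightarrow> real^('np + 'np)^('nf + 'nf)" where
  "Rbar M k \<gamma> = block_diag (Rm M k \<gamma>) (Rm M k \<gamma>)"

definition Hbar :: "('np::finite, 'nf::finite) sbp_mesh \<Rightarrow> nat \<Rightarrow> real^('np + 'np)^('np + 'np)" where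
  "Hbar M k = block_diag (Hm M k) (Hm M k)"

definition D2 ::
  "(real^2 \<Rightarrow> real^2^2) \<Rightarrow> ('np::finite, 'nf::finite) ref_elem \<Rightarrow> ('np, 'nf) sbp_mesh \<Rightarrow>
   nat \<Rightarrow> real^'np^'np" where
  "D2 lam r M k = hcat (Dx M k) (Dy M k) ** Lam lam r M k ** vcat (Dx M k) (Dy M k)"

definition Dg ::
  "(real^2 \<Rightarrow> real^2^2) \<Rightarrow> ('np::finite, 'nf::finite) ref_elem \<Rightarrow> ('np, 'nf) sbp_mesh \<Rightarrow>
   nat \<Rightarrow> nat \<Rightarrow> real^'np^'nf" where
  "Dg lam r M k \<gamma> =
     transpose (Nbar M k \<gamma>) ** Rbar M k \<gamma> ** Lam lam r M k ** vcat (Dx M k) (Dy M k)"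

definition Ups ::
  "(real^2 \<Rightarrow> real^2^2) \<Rightarrow> ('np::finite, 'nf::finite) ref_elem \<Rightarrow> ('np, 'nf) sbp_mesh \<Rightarrow>
   nat \<Rightarrow> nat \<Rightarrow> real^'nf^'nf" where
  "Ups lam r M k \<gamma> =
     transpose (Nbar M k \<gamma>) ** Rbar M k \<gamma> ** matrix_inv (Hbar M k) ** Lam lam r M k
       ** transpose (Rbar M k \<gamma>) ** Nbar M k \<gamma>"

text \<open>SAT coefficients; the arguments are the element and the facet.\<close>

record 'nf sat =
  T1 :: "nat \<Rightarrow> nat \<Rightarrow> real^'nf^'nf"
  T2 :: "nat \<Rightarrow> nat \<Rightarrow> real^'nf^'nf"
  T3 :: "nat \<Rightarrow> nat \<Rightarrow> real^'nf^'nf"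
  T4 :: "nat \<Rightarrow> nat \<Rightarrow> real^'nf^'nf"
  TD :: "nat \<Rightarrow> nat \<Rightarrow> real^'nf^'nf"

definition cng_sat ::
  "(real^2 \<Rightarrow> real^2^2) \<Rightarrow> ('np::finite, 'nf::finite) ref_elem \<Rightarrow> ('np, 'nf) sbp_mesh \<Rightarrow> 'nf sat" where
  "cng_sat lam r M =
     \<lparr>T1 = (\<lambda>k \<gamma>. (1 / 16) *\<^sub>R
        (Bm r M \<gamma> **
         ((1 / fwt M k \<gamma>) *\<^sub>R Ups lam r M k \<gamma> +
          (1 / fwt M (nbr M k \<gamma>) \<gamma>) *\<^sub>R Ups lam r M (nbr M k \<gamma>) \<gamma>) ** Bm r M \<gamma>)),
      T2 = (\<lambda>k \<gamma>. 0),
      T3 = (\<lambda>k \<gamma>. (1 / 2) *\<^sub>R Bm r M \<gamma>),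
      T4 = (\<lambda>k \<gamma>. 0),
      TD = (\<lambda>k \<gamma>. (1 / fwt M k \<gamma>) *\<^sub>R (Bm r M \<gamma> ** Ups lam r M k \<gamma> ** Bm r M \<gamma>))\<rparr>"

definition sI ::
  "(real^2 \<Rightarrow> real^2^2) \<Rightarrow> ('np::finite, 'nf::finite) ref_elem \<Rightarrow> ('np, 'nf) sbp_mesh \<Rightarrow> 'nf sat \<Rightarrow>
   (nat \<Rightarrow> real^'np) \<Rightarrow> nat \<Rightarrow> real^'np" where
  "sI lam r M T u k =
     (\<Sum>\<gamma>\<in>int_facets M k.
        let v = nbr M k \<gamma>;
            jump = Rm M k \<gamma> *v u k - Rm M v \<gamma> *v u v;
            dsum = Dg lam r M k \<gamma> *v u k + Dg lam r M v \<gamma> *v u v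
        in transpose (Rm M k \<gamma>) *v (T1 T k \<gamma> *v jump + T3 T k \<gamma> *v dsum) +
           transpose (Dg lam r M k \<gamma>) *v (T2 T k \<gamma> *v jump + T4 T k \<gamma> *v dsum))"

text \<open>\<open>gD\<close> and \<open>gN\<close> are the nodal Dirichlet and Neumann data at the facet nodes.\<close>

definition sB ::
  "(real^2 \<Rightarrow> real^2^2) \<Rightarrow> ('np::finite, 'nf::finite) ref_elem \<Rightarrow> ('np, 'nf) sbp_mesh \<Rightarrow> 'nf sat \<Rightarrow>
   (nat \<Rightarrow> nat \<Rightarrow> real^'nf) \<Rightarrow> (nat \<Rightarrow> nat \<Rightarrow> real^'nf) \<Rightarrow> (nat \<Rightarrow> real^'np) \<Rightarrow> nat \<Rightarrow> real^'np" where
  "sB lam r M T gD gN u k =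
     (\<Sum>\<gamma>\<in>facets M k \<inter> dir_facets M.
        transpose (Rm M k \<gamma>) *v (TD T k \<gamma> *v (Rm M k \<gamma> *v u k - gD k \<gamma>)) -
        transpose (Dg lam r M k \<gamma>) *v (Bm r M \<gamma> *v (Rm M k \<gamma> *v u k - gD k \<gamma>))) +
     (\<Sum>\<gamma>\<in>facets M k \<inter> neu_facets M.
        transpose (Rm M k \<gamma>) *v (Bm r M \<gamma> *v (Dg lam r M k \<gamma> *v u k - gN k \<gamma>)))"

definition Lh ::
  "(real^2 \<Rightarrow> real^2^2) \<Rightarrow> ('np::finite, 'nf::finite) ref_elem \<Rightarrow> ('np, 'nf) sbp_mesh \<Rightarrow> 'nf sat \<Rightarrow>
   (nat \<Rightarrow> nat \<Rightarrow> real^'nf) \<Rightarrow> (nat \<Rightarrow> nat \<Rightarrow> real^'nf) \<Rightarrow> (nat \<Rightarrow> real^'np) \<Rightarrow> nat \<Rightarrow> real^'np" where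
  "Lh lam r M T gD gN u k =
     - (D2 lam r M k *v u k) + matrix_inv (Hm M k) *v sI lam r M T u k
       + matrix_inv (Hm M k) *v sB lam r M T gD gN u k"

text \<open>\<open>u\<close> solves the semi-discrete system for \<open>t \<ge> 0\<close>, and \<open>u'\<close> is its time derivative.\<close>

definition semidiscrete_solution ::
  "(real^2 \<Rightarrow> real^2^2) \<Rightarrow> ('np::finite, 'nf::finite) ref_elem \<Rightarrow> ('np, 'nf) sbp_mesh \<Rightarrow> 'nf sat \<Rightarrow>
   (real \<Rightarrow> nat \<Rightarrow> real^'np) \<Rightarrow> (real \<Rightarrow> nat \<Rightarrow> nat \<Rightarrow> real^'nf) \<Rightarrow> (real \<Rightarrow> nat \<Rightarrow> nat \<Rightarrow> real^'nf) \<Rightarrow>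
   (real \<Rightarrow> nat \<Rightarrow> real^'np) \<Rightarrow> (real \<Rightarrow> nat \<Rightarrow> real^'np) \<Rightarrow> bool" where
  "semidiscrete_solution lam r M T f gD gN u u' \<longleftrightarrow>
     (\<forall>t\<ge>0. \<forall>k\<in>elems M.
        ((\<lambda>\<tau>. u \<tau> k) has_vector_derivative u' t k) (at t within {0..}) \<and>
        u' t k = D2 lam r M k *v u t k + f t k
          - matrix_inv (Hm M k) *v sI lam r M T (u t) k
          - matrix_inv (Hm M k) *v sB lam r M T (gD t) (gN t) (u t) k)"


section \<open>Energy stability, conservation, consistency\<close>

definition energy_stable ::
  "(real^2 \<Rightarrow> real^2^2) \<Rightarrow> ('np::finite, 'nf::finite) ref_elem \<Rightarrow> ('np, 'nf) sbp_mesh \<Rightarrow> 'nf sat \<Rightarrow> bool" where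
  "energy_stable lam r M T \<longleftrightarrow>
     (\<forall>u u'. semidiscrete_solution lam r M T (\<lambda>_ _. 0) (\<lambda>_ _ _. 0) (\<lambda>_ _ _. 0) u u' \<longrightarrow>
        (\<forall>t\<ge>0. \<exists>e. ((\<lambda>\<tau>. \<Sum>k\<in>elems M. u \<tau> k \<bullet> (Hm M k *v u \<tau> k)) has_real_derivative e)
                     (at t within {0..}) \<and> e \<le> 0))"

text \<open>
  The boundary facet terms may depend on the traces of the solution and of its numerical normal
  flux on the facet and on the boundary data there, but on nothing else of the solution.
\<close>

definition conservative ::
  "(real^2 \<Rightarrow> real^2^2) \<Rightarrow> ('np::finite, 'nf::finite) ref_elem \<Rightarrow> ('np, 'nf) sbp_mesh \<Rightarrow> 'nf sat \<Rightarrow> bool" where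
  "conservative lam r M T \<longleftrightarrow>
     (\<exists>\<Phi> :: nat \<Rightarrow> nat \<Rightarrow> real^'nf \<Rightarrow> real^'nf \<Rightarrow> real^'nf \<Rightarrow> real^'nf \<Rightarrow> real.
        \<forall>gD gN u u'. semidiscrete_solution lam r M T (\<lambda>_ _. 0) gD gN u u' \<longrightarrow>
          (\<forall>t\<ge>0. (\<Sum>k\<in>elems M. 1 \<bullet> (Hm M k *v u' t k)) =
             (\<Sum>k\<in>elems M. \<Sum>\<gamma>\<in>facets M k \<inter> (dir_facets M \<union> neu_facets M).
                \<Phi> k \<gamma> (Rm M k \<gamma> *v u t k) (Dg lam r M k \<gamma> *v u t k) (gD t k \<gamma>) (gN t k \<gamma>))))"

definition Hnorm :: "('np::finite, 'nf::finite) sbp_mesh \<Rightarrow> nat \<Rightarrow> real^'np \<Rightarrow> real" where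
  "Hnorm M k v = sqrt (v \<bullet> (Hm M k *v v))"

text \<open>\<open>L\<^sub>h\<^sub>,\<^sub>k(u) - f\<^sub>k\<close> on the nodal values of \<open>U\<close>, \<open>F\<close> and of the boundary data of \<open>U\<close>.\<close>

definition trunc_error ::
  "(real^2 \<Rightarrow> real^2^2) \<Rightarrow> ('np::finite, 'nf::finite) ref_elem \<Rightarrow> ('np, 'nf) sbp_mesh \<Rightarrow> 'nf sat \<Rightarrow>
   (real^2 \<Rightarrow> real) \<Rightarrow> (real^2 \<Rightarrow> real) \<Rightarrow> nat \<Rightarrow> real^'np" where
  "trunc_error lam r M T F U k =
     Lh lam r M T
       (\<lambda>k \<gamma>. \<chi> i. U (fnode r M \<gamma> i))
       (\<lambda>k \<gamma>. \<chi> i. fnormal M k \<gamma> i \<bullet> flux lam U (fnode r M \<gamma> i))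
       (\<lambda>k. \<chi> j. U (vnode r M k j)) k
     - (\<chi> j. F (vnode r M k j))"

definition consistent ::
  "(real^2) set \<Rightarrow> (real^2 \<Rightarrow> real^2^2) \<Rightarrow> ('np::finite, 'nf::finite) ref_elem \<Rightarrow>
   (nat \<Rightarrow> ('np, 'nf) sbp_mesh) \<Rightarrow> (nat \<Rightarrow> 'nf sat) \<Rightarrow> bool" where
  "consistent \<Omega> lam r M T \<longleftrightarrow>
     (\<forall>F U. Ck_on (deg r + 1) \<Omega> U \<and> steady_source \<Omega> lam F U \<longrightarrow>
        (\<lambda>n. \<Sum>k\<in>elems (M n). Hnorm (M n) k (trunc_error lam r (M n) (T n) F U k)) \<longlonglongrightarrow> 0)"

text \<open>
  The same with the element contributions combined into the norm of the global vector. The nodal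
  truncation error is of size \<open>h\<^sup>p\<^sup>-\<^sup>1\<close> and there are about \<open>h\<^sup>-\<^sup>2\<close> elements of norm weight
  \<open>h\<close>, so the sum of norms in \<open>consistent\<close> is of size \<open>h\<^sup>p\<^sup>-\<^sup>2\<close>, the global norm of size \<open>h\<^sup>p\<^sup>-\<^sup>1\<close>.
\<close>

definition consistent_global ::
  "(real^2) set \<Rightarrow> (real^2 \<Rightarrow> real^2^2) \<Rightarrow> ('np::finite, 'nf::finite) ref_elem \<Rightarrow>
   (nat \<Rightarrow> ('np, 'nf) sbp_mesh) \<Rightarrow> (nat \<Rightarrow> 'nf sat) \<Rightarrow> bool" where
  "consistent_global \<Omega> lam r M T \<longleftrightarrow>
     (\<forall>F U. Ck_on (deg r + 1) \<Omega> U \<and> steady_source \<Omega> lam F U \<longrightarrow>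
        (\<lambda>n. sqrt (\<Sum>k\<in>elems (M n). (Hnorm (M n) k (trunc_error lam r (M n) (T n) F U k))\<^sup>2))
          \<longlonglongrightarrow> 0)"


section \<open>Mesh families\<close>

text \<open>\<open>Dx\<close> and \<open>Dy\<close> are order \<open>p\<close> accurate at the nodes, uniformly over the family.\<close>

definition order_accurate ::
  "(real^2) set \<Rightarrow> ('np::finite, 'nf::finite) ref_elem \<Rightarrow> (nat \<Rightarrow> ('np, 'nf) sbp_mesh) \<Rightarrow> bool" where
  "order_accurate \<Omega> r M \<longleftrightarrow>
     (\<exists>C. \<forall>n. \<forall>\<phi> b. Ck_on (deg r + 1) \<Omega> \<phi> \<and> Ck_bounded (deg r + 1) \<Omega> b \<phi> \<longrightarrow>
        (\<forall>k\<in>elems (M n). \<forall>j.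
           \<bar>(Dx (M n) k *v (\<chi> l. \<phi> (vnode r (M n) k l))) $ j - partial 1 \<phi> (vnode r (M n) k j)\<bar>
             \<le> C * b * mesh_size r (M n) ^ deg r \<and>
           \<bar>(Dy (M n) k *v (\<chi> l. \<phi> (vnode r (M n) k l))) $ j - partial 2 \<phi> (vnode r (M n) k j)\<bar>
             \<le> C * b * mesh_size r (M n) ^ deg r))"

text \<open>
  Shape regularity, quasi-uniformity and the natural scaling of the operators in \<open>h\<close>. For affine
  elements the bound on \<open>ecoef\<close> follows from the diameter; for curved ones it says that the
  derivatives of order \<open>s\<close> of the element map are of size \<open>h\<^sup>s\<close>.
\<close>

definition regular_family ::
  "('np::finite, 'nf::finite) ref_elem \<Rightarrow> (nat \<Rightarrow> ('np, 'nf) sbp_mesh) \<Rightarrow> bool" where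
  "regular_family r M \<longleftrightarrow>
     (\<exists>c>0. \<exists>C. \<forall>n. \<forall>k\<in>elems (M n).
        let h = mesh_size r (M n) in
        (\<exists>x. ball x (c * h) \<subseteq> cell r (M n) k) \<and>
        (\<forall>i j. 1 \<le> i + j \<and> i + j \<le> deg r + 1 \<longrightarrow> norm (ecoef (M n) k i j) \<le> C * h ^ (i + j)) \<and>
        (\<forall>j. c * h\<^sup>2 \<le> Hw (M n) k $ j \<and> Hw (M n) k $ j \<le> C * h\<^sup>2) \<and>
        (\<forall>i j. \<bar>Dx (M n) k $ i $ j\<bar> \<le> C / h \<and> \<bar>Dy (M n) k $ i $ j\<bar> \<le> C / h) \<and>
        (\<forall>\<gamma>\<in>facets (M n) k. c \<le> fwt (M n) k \<gamma> \<and> (\<forall>i j. \<bar>Rm (M n) k \<gamma> $ i $ j\<bar> \<le> C)))"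

end

theory Submission
  imports Defs
begin

text \<open>
  Testing the scheme with \<open>v\<close> and using the SBP property turns the volume term into a dissipation
  \<open>(\<nabla>\<^sub>h v)\<^sup>T H \<Lambda> \<nabla>\<^sub>h u\<close> plus facet terms. For \<open>v = 1\<close> the dissipation vanishes and the contributions of the
  two sides of an interior facet cancel. For \<open>v = u\<close> the two sides leave
  \<open>1/2 [u]\<^sup>T B (D\<^sub>k u - D\<^sub>v u) - [u]\<^sup>T T1 [u]\<close>; since \<open>\<Upsilon>\<close> is the Gram matrix of the extrapolated normal flux,
  Young's inequality bounds the first term by \<open>[u]\<^sup>T T1 [u]\<close> and the shares \<open>\<alpha>\<close> of the dissipation.

  For consistency, with \<open>p\<close> the degree of the scheme, write a smooth function on an element in
  reference coordinates. Up to \<open>O(h\<^sup>q)\<close> it is a polynomial of degree less than \<open>q\<close>, although the element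
  map is curved, because the coefficients of order \<open>s\<close> of the map are \<open>O(h\<^sup>s)\<close>. So extrapolation gives
  jumps \<open>O(h\<^sup>p\<^sup>+\<^sup>1)\<close> and flux defects \<open>O(h\<^sup>p)\<close>, and with \<open>B = O(h)\<close>, \<open>\<Upsilon> = O(h\<^sup>-\<^sup>2)\<close> and \<open>H\<^sup>-\<^sup>1 = O(h\<^sup>-\<^sup>2)\<close> the nodal
  truncation error is \<open>O(h\<^sup>p\<^sup>-\<^sup>1)\<close>. There are only \<open>O(h\<^sup>-\<^sup>2)\<close> elements.
\<close>

section \<open>Block matrices, energy stability and conservation\<close>

text \<open>Every constant has to be uniform over meshes, elements and facets, so the estimates are
  phrased with predicates that hide a constant fixed before these are chosen. The count of
  derivatives is tight: \<open>U\<close> has p + 1 of them, its flux only p, while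
  \<open>order_accurate\<close> speaks of functions with p + 1. Differentiating the flux at the
  nodes therefore loses one more power of h. The SAT terms are no better: the penalties are O(1),
  the facet terms O(h^(p+1)), and dividing by the norm matrix costs h^2. The weights in the norm
  give back one power of h, so one element contributes O(h^p); adding O(h^-2) of these needs p >= 3,
  adding their squares under a root only p >= 2. A second obstacle is geometric: a segment joining
  two points of a curved element may leave the domain. Since \<open>Ck_on\<close> provides
  smoothness on a neighbourhood, Taylor remainders are bounded on a compact \<delta>-neighbourhood,
  and the estimates hold for h <= \<delta>.\<close>

declare transpose_matrix_vector [simp del]

text \<open>Block operators are evaluated by applying them to stacked vectors, so that no product of
  two block matrices has to be expanded.\<close>

definition vjoin :: "real^'a \<Rightarrow> real^'b \<Rightarrow> real^('a + 'b)" where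
  "vjoin a b = (\<chi> i. case i of Inl j \<Rightarrow> a $ j | Inr j \<Rightarrow> b $ j)"

lemma sum_UNIV_sum_type:
  fixes f :: "'a::finite + 'b::finite \<Rightarrow> 'c::comm_monoid_add"
  shows "(\<Sum>i\<in>UNIV. f i) = (\<Sum>i\<in>UNIV. f (Inl i)) + (\<Sum>i\<in>UNIV. f (Inr i))"
  by (simp add: UNIV_Plus_UNIV[symmetric] sum.Plus del: UNIV_Plus_UNIV)

lemma hcat_mult_vjoin: "hcat A B *v vjoin a b = A *v a + B *v b"
  by (simp add: vec_eq_iff matrix_vector_mult_def hcat_def vjoin_def sum_UNIV_sum_type)

lemma vcat_mult: "vcat A B *v x = vjoin (A *v x) (B *v x)"
  by (simp add: vec_eq_iff matrix_vector_mult_def vcat_def vjoin_def split: sum.split)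

lemma vjoin_add: "vjoin a b + vjoin c d = vjoin (a + c) (b + d)"
  by (simp add: vec_eq_iff vjoin_def split: sum.split)

lemma transpose_hcat: "transpose (hcat A B) = vcat (transpose A) (transpose B)"
  by (simp add: vec_eq_iff transpose_def hcat_def vcat_def split: sum.split)

lemma transpose_vcat: "transpose (vcat A B) = hcat (transpose A) (transpose B)"
  by (simp add: vec_eq_iff transpose_def hcat_def vcat_def split: sum.split)

lemma transpose_zero: "transpose 0 = (0 :: real^'a^'b)"
  by (simp add: vec_eq_iff transpose_def)

lemma diag_mat_mult: "(diag_mat d *v x) $ i = d $ i * x $ i"
  by (simp add: matrix_vector_mult_def diag_mat_def if_distrib[of "\<lambda>a. a * _"] cong: if_cong)

lemma transpose_diag_mat: "transpose (diag_mat d) = diag_mat d"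
  by (simp add: vec_eq_iff transpose_def diag_mat_def)

text \<open>A right inverse of a square matrix is also a left inverse, so the choice hidden in
  \<open>matrix_inv\<close> has a witness, and cancelling \<open>A\<close> identifies the chosen
  inverse with \<open>B\<close>.\<close>

lemma matrix_inv_eqI:
  fixes A B :: "real^'n^'n"
  assumes "\<And>x. A *v (B *v x) = x"
  shows "matrix_inv A = B"
proof -
  have AB: "A ** B = mat 1"
    using assms by (simp add: matrix_eq matrix_vector_mul_assoc[symmetric])
  then have BA: "B ** A = mat 1"
    by (simp add: matrix_left_right_inverse)
  have inv: "matrix_inv A ** A = mat 1"
    unfolding matrix_inv_def by (rule someI2[of _ B]) (use AB BA in auto)
  have "matrix_inv A = matrix_inv A ** (A ** B)"
    by (simp add: AB)
  also have "\<dots> = B"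
    by (simp add: inv matrix_mul_assoc)
  finally show ?thesis .
qed

lemma matrix_inv_diag_mat:
  assumes "\<And>j. d $ j \<noteq> 0"
  shows "matrix_inv (diag_mat d) = diag_mat (\<chi> j. inverse (d $ j))"
  using assms by (intro matrix_inv_eqI) (simp add: vec_eq_iff diag_mat_mult)

lemma dot_matrix_vector: "x \<bullet> (A *v y) = (transpose A *v x) \<bullet> (y :: real^'n)"
  by (simp add: dot_lmul_matrix[symmetric] transpose_matrix_vector[symmetric])

section \<open>Element operators in coordinates, without blocks\<close>

definition Dm :: "('np::finite, 'nf::finite) sbp_mesh \<Rightarrow> 2 \<Rightarrow> nat \<Rightarrow> real^'np^'np" where
  "Dm M c k = (if c = 1 then Dx M k else Dy M k)"

text \<open>\<open>Lam\<close> has diagonal blocks and so acts node by node. Indexing components by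
  the type \<open>2\<close> turns the block structure into sums over coordinates.\<close>

definition lam_nodal ::
  "(real^2 \<Rightarrow> real^2^2) \<Rightarrow> ('np::finite, 'nf::finite) ref_elem \<Rightarrow> ('np, 'nf) sbp_mesh \<Rightarrow> nat \<Rightarrow>
   (2 \<Rightarrow> real^'np) \<Rightarrow> 2 \<Rightarrow> real^'np" where
  "lam_nodal lam r M k g c = (\<chi> j. \<Sum>d\<in>UNIV. lam (vnode r M k j) $ c $ d * g d $ j)"

lemma Lam_mult_vjoin:
  "Lam lam r M k *v vjoin (g 1) (g 2) = vjoin (lam_nodal lam r M k g 1) (lam_nodal lam r M k g 2)"
proof -
  have *: "diag_mat (\<chi> j. lam (vnode r M k j) $ c $ 1) *v g 1 +
      diag_mat (\<chi> j. lam (vnode r M k j) $ c $ 2) *v g 2 = lam_nodal lam r M k g c" for c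
    by (simp add: vec_eq_iff diag_mat_mult lam_nodal_def sum_2)
  show ?thesis
    unfolding Lam_def Let_def vcat_mult hcat_mult_vjoin * ..
qed

lemma Rbar_mult_vjoin: "Rbar M k \<gamma> *v vjoin a b = vjoin (Rm M k \<gamma> *v a) (Rm M k \<gamma> *v b)"
  by (simp add: Rbar_def block_diag_def vcat_mult hcat_mult_vjoin)

lemma transpose_Rbar_mult_vjoin:
  "transpose (Rbar M k \<gamma>) *v vjoin a b =
     vjoin (transpose (Rm M k \<gamma>) *v a) (transpose (Rm M k \<gamma>) *v b)"
  by (simp add: Rbar_def block_diag_def transpose_vcat transpose_hcat transpose_zero
      vcat_mult hcat_mult_vjoin vjoin_add)

lemma transpose_Nbar_mult_vjoin:
  "transpose (Nbar M k \<gamma>) *v vjoin (a 1) (a 2) = (\<Sum>c\<in>UNIV. Nm M c k \<gamma> *v a c)"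
  by (simp add: Nbar_def transpose_vcat hcat_mult_vjoin sum_2 Nm_def transpose_diag_mat)

lemma D2_mult:
  "D2 lam r M k *v u = (\<Sum>c\<in>UNIV. Dm M c k *v lam_nodal lam r M k (\<lambda>d. Dm M d k *v u) c)"
proof -
  have "D2 lam r M k *v u =
    hcat (Dx M k) (Dy M k) *v (Lam lam r M k *v vjoin (Dm M 1 k *v u) (Dm M 2 k *v u))"
    by (simp add: D2_def matrix_vector_mul_assoc[symmetric] vcat_mult Dm_def)
  then show ?thesis
    by (simp add: Lam_mult_vjoin[where g="\<lambda>d. Dm M d k *v u"] hcat_mult_vjoin sum_2)
      (simp add: Dm_def)
qed

lemma Dg_mult:
  "Dg lam r M k \<gamma> *v u =
     (\<Sum>c\<in>UNIV. Nm M c k \<gamma> *v (Rm M k \<gamma> *v lam_nodal lam r M k (\<lambda>d. Dm M d k *v u) c))"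
proof -
  have "Dg lam r M k \<gamma> *v u = transpose (Nbar M k \<gamma>) *v (Rbar M k \<gamma> *v
      (Lam lam r M k *v vjoin (Dm M 1 k *v u) (Dm M 2 k *v u)))"
    by (simp add: Dg_def matrix_vector_mul_assoc[symmetric] vcat_mult Dm_def)
  then show ?thesis
    by (simp add: Lam_mult_vjoin[where g="\<lambda>d. Dm M d k *v u"] Rbar_mult_vjoin
        transpose_Nbar_mult_vjoin[where a="\<lambda>c. Rm M k \<gamma> *v lam_nodal lam r M k (\<lambda>d. Dm M d k *v u) c"])
qed

lemma Hm_mult: "(Hm M k *v x) $ j = Hw M k $ j * x $ j"
  by (simp add: Hm_def diag_mat_mult)

lemma matrix_inv_Hm:
  assumes "\<And>j. 0 < Hw M k $ j"
  shows "matrix_inv (Hm M k) = diag_mat (\<chi> j. inverse (Hw M k $ j))"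
  unfolding Hm_def by (rule matrix_inv_diag_mat) (use assms in \<open>metis less_irrefl\<close>)

lemma matrix_inv_Hbar_mult_vjoin:
  assumes "\<And>j. 0 < Hw M k $ j"
  shows "matrix_inv (Hbar M k) *v vjoin a b =
           vjoin (matrix_inv (Hm M k) *v a) (matrix_inv (Hm M k) *v b)"
proof -
  define K where "K = matrix_inv (Hm M k)"
  have K: "Hm M k *v (K *v x) = x" for x
    by (simp add: K_def matrix_inv_Hm[OF assms] vec_eq_iff diag_mat_mult Hm_mult
        less_imp_neq[OF assms, symmetric])
  have split: "\<exists>a b. x = vjoin a b" for x :: "real^('a + 'a)"
    by (rule exI[of _ "\<chi> i. x $ Inl i"], rule exI[of _ "\<chi> i. x $ Inr i"])
      (simp add: vec_eq_iff vjoin_def split: sum.split)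
  have "matrix_inv (Hbar M k) = block_diag K K"
  proof (rule matrix_inv_eqI)
    fix x :: "real^('a + 'a)"
    obtain a b where "x = vjoin a b"
      using split by blast
    then show "Hbar M k *v (block_diag K K *v x) = x"
      by (simp add: Hbar_def block_diag_def vcat_mult hcat_mult_vjoin K)
  qed
  then show ?thesis
    by (simp add: block_diag_def vcat_mult hcat_mult_vjoin K_def)
qed

lemma Ups_mult:
  assumes "\<And>j. 0 < Hw M k $ j"
  shows "Ups lam r M k \<gamma> *v x = (\<Sum>c\<in>UNIV. Nm M c k \<gamma> *v (Rm M k \<gamma> *v (matrix_inv (Hm M k) *v
     lam_nodal lam r M k (\<lambda>d. transpose (Rm M k \<gamma>) *v (Nm M d k \<gamma> *v x)) c)))"
proof -
  have "Ups lam r M k \<gamma> *v x = transpose (Nbar M k \<gamma>) *v (Rbar M k \<gamma> *v (matrix_inv (Hbar M k) *v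
      (Lam lam r M k *v vjoin (transpose (Rm M k \<gamma>) *v (Nm M 1 k \<gamma> *v x))
        (transpose (Rm M k \<gamma>) *v (Nm M 2 k \<gamma> *v x)))))"
    by (simp add: Ups_def matrix_vector_mul_assoc[symmetric] Nbar_def vcat_mult
        transpose_Rbar_mult_vjoin)
  then show ?thesis
    by (simp add: Lam_mult_vjoin[where g="\<lambda>d. transpose (Rm M k \<gamma>) *v (Nm M d k \<gamma> *v x)"]
        matrix_inv_Hbar_mult_vjoin[OF assms] Rbar_mult_vjoin
        transpose_Nbar_mult_vjoin[where a="\<lambda>c. Rm M k \<gamma> *v (matrix_inv (Hm M k) *v
           lam_nodal lam r M k (\<lambda>d. transpose (Rm M k \<gamma>) *v (Nm M d k \<gamma> *v x)) c)"])
qed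

lemma dot_Hm: "x \<bullet> (Hm M k *v y) = (\<Sum>j\<in>UNIV. Hw M k $ j * (x $ j * y $ j))"
  by (simp add: inner_vec_def Hm_mult algebra_simps)

lemma dot_Bm_commute: "x \<bullet> (Bm r M \<gamma> *v y) = (Bm r M \<gamma> *v x) \<bullet> y"
  by (simp add: dot_matrix_vector Bm_def transpose_diag_mat)

lemma matrix_vector_mult_sum_left:
  "finite S \<Longrightarrow> (\<Sum>s\<in>S. A s) *v x = (\<Sum>s\<in>S. A s *v (x :: real^'n))"
  by (induction S rule: finite_induct) (simp_all add: matrix_vector_mult_add_rdistrib)

lemma matrix_vector_mult_sum_right:
  "finite S \<Longrightarrow> A *v (\<Sum>s\<in>S. x s) = (\<Sum>s\<in>S. A *v (x s :: real^'n))"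
  by (induction S rule: finite_induct) (simp_all add: matrix_vector_right_distrib)

section \<open>Summation by parts and the discrete dissipation\<close>

lemma sbp_Hw_pos: "sbp_operators r M \<Longrightarrow> k \<in> elems M \<Longrightarrow> 0 < Hw M k $ j"
  by (simp add: sbp_operators_def)

lemma sbp_fwt_sum: "sbp_operators r M \<Longrightarrow> k \<in> elems M \<Longrightarrow> (\<Sum>\<gamma>\<in>facets M k. fwt M k \<gamma>) = 1"
  by (simp add: sbp_operators_def)

lemma sbp_Dm_one: "sbp_operators r M \<Longrightarrow> k \<in> elems M \<Longrightarrow> Dm M c k *v 1 = 0"
  by (simp add: sbp_operators_def Dm_def)

text \<open>Discrete integration by parts: the transposed half of the SBP identity moves the
  derivative onto \<open>v\<close>, because \<open>Hm\<close> is diagonal and hence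
  symmetric.\<close>

lemma sbp_by_parts:
  fixes M :: "('np::finite, 'nf::finite) sbp_mesh"
  assumes "sbp_operators r M" "k \<in> elems M" "finite (facets M k)"
  shows "v \<bullet> (Hm M k *v (Dm M c k *v w)) =
    (\<Sum>\<gamma>\<in>facets M k. (Rm M k \<gamma> *v v) \<bullet> (Bm r M \<gamma> *v (Nm M c k \<gamma> *v (Rm M k \<gamma> *v w)))) -
    (Dm M c k *v v) \<bullet> (Hm M k *v w)"
proof -
  have "c = 1 \<or> c = 2"
    by (rule exhaust_2)
  with assms(1,2) have "Hm M k ** Dm M c k + transpose (Hm M k ** Dm M c k) =
      (\<Sum>\<gamma>\<in>facets M k. transpose (Rm M k \<gamma>) ** Bm r M \<gamma> ** Nm M c k \<gamma> ** Rm M k \<gamma>)"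
    by (auto simp: sbp_operators_def Dm_def)
  then have "v \<bullet> ((Hm M k ** Dm M c k + transpose (Hm M k ** Dm M c k)) *v w) =
      v \<bullet> ((\<Sum>\<gamma>\<in>facets M k. transpose (Rm M k \<gamma>) ** Bm r M \<gamma> ** Nm M c k \<gamma> ** Rm M k \<gamma>) *v w)"
    by simp
  moreover have "v \<bullet> (transpose (Hm M k ** Dm M c k) *v w) = (Dm M c k *v v) \<bullet> (Hm M k *v w)"
    by (simp add: dot_matrix_vector[of v] matrix_vector_mul_assoc[symmetric])
      (simp add: dot_Hm inner_commute[of _ w] algebra_simps)
  ultimately show ?thesis
    using assms(3)
    by (simp add: matrix_vector_mult_add_rdistrib inner_add_right matrix_vector_mult_sum_left
        inner_sum_right matrix_vector_mul_assoc[symmetric] dot_matrix_vector[of v])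
qed

text \<open>Discrete counterpart of the integral of grad v . (\<lambda> grad u) over one element;
  \<open>Hm\<close> plays the role of the quadrature, so this is a total over the element.\<close>

definition energy_density ::
  "(real^2 \<Rightarrow> real^2^2) \<Rightarrow> ('np::finite, 'nf::finite) ref_elem \<Rightarrow> ('np, 'nf) sbp_mesh \<Rightarrow> nat \<Rightarrow>
   real^'np \<Rightarrow> real^'np \<Rightarrow> real" where
  "energy_density lam r M k v u =
     (\<Sum>c\<in>UNIV. (Dm M c k *v v) \<bullet> (Hm M k *v lam_nodal lam r M k (\<lambda>d. Dm M d k *v u) c))"

text \<open>Discrete Green formula: summation by parts is applied to each component of the numerical
  flux, and the facet terms of both components assemble to the normal flux
  \<open>Dg\<close>.\<close>

lemma dot_Hm_D2:
  assumes "sbp_operators r M" "k \<in> elems M" "finite (facets M k)"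
  shows "v \<bullet> (Hm M k *v (D2 lam r M k *v u)) =
    (\<Sum>\<gamma>\<in>facets M k. (Rm M k \<gamma> *v v) \<bullet> (Bm r M \<gamma> *v (Dg lam r M k \<gamma> *v u))) -
    energy_density lam r M k v u"
  using assms
  by (simp add: D2_mult Dg_mult matrix_vector_mult_sum_right inner_sum_right sbp_by_parts
      energy_density_def sum_subtractf sum.swap[of _ "UNIV::2 set"])

text \<open>Expand \<open>|s z - 2 a g|\<^sup>2 \<ge> 0\<close> in the inner product given by \<open>L\<close>.\<close>

lemma spd_young:
  fixes L :: "real^'n^'n"
  assumes "spd L" "0 < a"
  shows "s * (z \<bullet> (L *v g)) \<le> s\<^sup>2 / (4 * a) * (z \<bullet> (L *v z)) + a * (g \<bullet> (L *v g))"
proof -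
  define y where "y = s *\<^sub>R z - (2 * a) *\<^sub>R g"
  have "0 \<le> y \<bullet> (L *v y)"
    using assms(1) by (cases "y = 0") (auto simp: spd_def less_imp_le)
  moreover have "g \<bullet> (L *v z) = z \<bullet> (L *v g)"
    using assms(1) by (simp add: spd_def dot_matrix_vector[of g] inner_commute)
  ultimately have "0 \<le> s\<^sup>2 * (z \<bullet> (L *v z)) - 4 * a * s * (z \<bullet> (L *v g)) + 4 * a\<^sup>2 * (g \<bullet> (L *v g))"
    by (simp add: y_def matrix_vector_mult_diff_distrib inner_diff_left inner_diff_right
        matrix_vector_mult_scaleR power2_eq_square algebra_simps)
  then show ?thesis
    using assms(2) by (simp add: field_simps power2_eq_square)
qed

text \<open>Positivity of \<lambda> is only known pointwise, so pairings through \<open>Lam\<close>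
  are regrouped from components to nodes.\<close>

lemma dot_lam_nodal:
  "(\<Sum>c\<in>UNIV. z c \<bullet> lam_nodal lam r M k g c) =
     (\<Sum>j\<in>UNIV. (\<chi> c. z c $ j) \<bullet> (lam (vnode r M k j) *v (\<chi> c. g c $ j)))"
  by (simp add: inner_vec_def lam_nodal_def matrix_vector_mult_def sum.swap[of _ "UNIV::2 set"])

lemma energy_density_nodes:
  "energy_density lam r M k u u = (\<Sum>j\<in>UNIV. Hw M k $ j *
     ((\<chi> c. (Dm M c k *v u) $ j) \<bullet> (lam (vnode r M k j) *v (\<chi> c. (Dm M c k *v u) $ j))))"
proof -
  have "energy_density lam r M k u u =
      (\<Sum>c\<in>UNIV. (Hm M k *v (Dm M c k *v u)) \<bullet> lam_nodal lam r M k (\<lambda>d. Dm M d k *v u) c)"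
    by (simp add: energy_density_def dot_matrix_vector Hm_def transpose_diag_mat)
  also have "\<dots> = (\<Sum>j\<in>UNIV. (Hw M k $ j *\<^sub>R (\<chi> c. (Dm M c k *v u) $ j)) \<bullet>
      (lam (vnode r M k j) *v (\<chi> c. (Dm M c k *v u) $ j)))"
    unfolding dot_lam_nodal by (intro sum.cong) (simp_all add: inner_vec_def Hm_mult)
  finally show ?thesis
    by simp
qed

lemma energy_density_nonneg:
  assumes "sbp_operators r M" "k \<in> elems M" and spd: "\<And>j. spd (lam (vnode r M k j))"
  shows "0 \<le> energy_density lam r M k u u"
  unfolding energy_density_nodes
proof (intro sum_nonneg mult_nonneg_nonneg)
  fix j
  show "0 \<le> Hw M k $ j"
    using sbp_Hw_pos[OF assms(1,2)] less_imp_le by blast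
  show "0 \<le> x \<bullet> (lam (vnode r M k j) *v x)" for x
    using spd[of j] by (cases "x = 0") (auto simp: spd_def less_imp_le)
qed

text \<open>With \<open>a = \<alpha>\<close>, the facet uses its share of the volume dissipation. The choices \<open>s = 2\<close> (Dirichlet) and
  \<open>s = 1/2\<close> (interior) produce the factors \<open>1\<close> and \<open>1/16\<close> of the SAT coefficients.\<close>

lemma facet_flux_young:
  assumes sbp: "sbp_operators r M" "k \<in> elems M" and spd: "\<And>j. spd (lam (vnode r M k j))"
    and a: "0 < a"
  shows "s * (x \<bullet> (Bm r M \<gamma> *v (Dg lam r M k \<gamma> *v u))) \<le>
    s\<^sup>2 / (4 * a) * (x \<bullet> (Bm r M \<gamma> *v (Ups lam r M k \<gamma> *v (Bm r M \<gamma> *v x)))) +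
    a * energy_density lam r M k u u"
proof -
  let ?L = "\<lambda>j. lam (vnode r M k j)"
  \<comment> \<open>Transposing the facet functional gives a nodal field. The flux term becomes its
    \<lambda>-pairing with the discrete gradient, and the term with \<open>Ups\<close> its
    \<lambda>-pairing with itself, weighted by the inverse norm.\<close>
  define z where "z c = transpose (Rm M k \<gamma>) *v (Nm M c k \<gamma> *v (Bm r M \<gamma> *v x))" for c
  define Z where "Z j = (\<chi> c. z c $ j)" for j
  define G where "G j = (\<chi> c. (Dm M c k *v u) $ j)" for j
  have H: "0 < Hw M k $ j" for j
    by (rule sbp_Hw_pos[OF sbp])
  have flip: "x \<bullet> (Bm r M \<gamma> *v (\<Sum>c\<in>UNIV. Nm M c k \<gamma> *v (Rm M k \<gamma> *v y c))) = (\<Sum>c\<in>UNIV. z c \<bullet> y c)"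
    for y :: "2 \<Rightarrow> real^'a"
    by (simp add: dot_Bm_commute inner_sum_right z_def)
      (simp add: dot_matrix_vector Nm_def transpose_diag_mat)
  have flux: "x \<bullet> (Bm r M \<gamma> *v (Dg lam r M k \<gamma> *v u)) = (\<Sum>j\<in>UNIV. Z j \<bullet> (?L j *v G j))"
    unfolding Dg_mult flip dot_lam_nodal Z_def G_def ..
  have "x \<bullet> (Bm r M \<gamma> *v (Ups lam r M k \<gamma> *v (Bm r M \<gamma> *v x))) =
      (\<Sum>c\<in>UNIV. (matrix_inv (Hm M k) *v z c) \<bullet> lam_nodal lam r M k z c)"
    unfolding Ups_mult[OF H] flip
    by (simp add: dot_matrix_vector matrix_inv_Hm[OF H] transpose_diag_mat z_def[abs_def])
  also have "\<dots> = (\<Sum>j\<in>UNIV. (inverse (Hw M k $ j) *\<^sub>R Z j) \<bullet> (?L j *v Z j))"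
    unfolding dot_lam_nodal Z_def
    by (intro sum.cong) (simp_all add: inner_vec_def matrix_inv_Hm[OF H] diag_mat_mult)
  finally have ups: "x \<bullet> (Bm r M \<gamma> *v (Ups lam r M k \<gamma> *v (Bm r M \<gamma> *v x))) =
      (\<Sum>j\<in>UNIV. inverse (Hw M k $ j) * (Z j \<bullet> (?L j *v Z j)))"
    by simp
  \<comment> \<open>The Young parameter at node j is \<open>a * Hw M k $ j\<close>: this puts the
    inverse weight on the first square, as in \<open>Ups\<close>, and the weight itself on the
    second, as in the dissipation.\<close>
  have "s * (Z j \<bullet> (?L j *v G j)) \<le> s\<^sup>2 / (4 * a) * (inverse (Hw M k $ j) * (Z j \<bullet> (?L j *v Z j))) +
      a * (Hw M k $ j * (G j \<bullet> (?L j *v G j)))" for j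
    using spd_young[OF spd[of j], of "a * Hw M k $ j" s "Z j" "G j"] a H[of j]
    by (simp add: field_simps)
  then show ?thesis
    unfolding flux ups energy_density_nodes G_def[symmetric]
    by (simp add: sum_distrib_left sum.distrib[symmetric] sum_mono)
qed

section \<open>Facets, neighbours and the weak form\<close>

lemma mesh_finite_facets:
  assumes "geometric_mesh \<Omega> \<Gamma>D \<Gamma>N r M" "k \<in> elems M"
  shows "finite (facets M k)"
proof -
  have "bij_betw (\<lambda>\<gamma>. {fst (fends M k \<gamma>), snd (fends M k \<gamma>)}) (facets M k) ref_edges"
    using assms by (simp add: geometric_mesh_def)
  moreover have "finite ref_edges"
    by (simp add: ref_edges_def)
  ultimately show ?thesis
    using bij_betw_finite by blast
qed

lemma mesh_cover: "geometric_mesh \<Omega> \<Gamma>D \<Gamma>N r M \<Longrightarrow> (\<Union>k\<in>elems M. cell r M k) = \<Omega>"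
  by (simp only: geometric_mesh_def)

lemma vnode_in_domain:
  assumes "geometric_mesh \<Omega> \<Gamma>D \<Gamma>N r M" "valid_ref_elem r" "k \<in> elems M"
  shows "vnode r M k j \<in> \<Omega>"
proof -
  have "vnode r M k j \<in> cell r M k"
    using assms(2) by (auto simp: vnode_def cell_def valid_ref_elem_def)
  then show ?thesis
    using mesh_cover[OF assms(1)] assms(3) by blast
qed

text \<open>An interior facet belongs to exactly two elements, so the definite description in
  \<open>nbr\<close> is well defined and crossing the facet twice leads back to
  \<open>k\<close>.\<close>

lemma mesh_nbr:
  assumes mesh: "geometric_mesh \<Omega> \<Gamma>D \<Gamma>N r M" and k: "k \<in> elems M" and \<gamma>: "\<gamma> \<in> int_facets M k"
  shows "nbr M k \<gamma> \<in> elems M" "nbr M k \<gamma> \<noteq> k" "\<gamma> \<in> int_facets M (nbr M k \<gamma>)"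
    "nbr M (nbr M k \<gamma>) \<gamma> = k"
proof -
  let ?S = "{k \<in> elems M. \<gamma> \<in> facets M k}"
  have "\<gamma> \<in> \<Union> (facets M ` elems M)" "\<gamma> \<notin> dir_facets M" "\<gamma> \<notin> neu_facets M" "k \<in> ?S"
    using k \<gamma> by (auto simp: int_facets_def)
  with mesh have "card ?S = 2"
    unfolding geometric_mesh_def by (elim conjE) (metis (no_types, lifting))
  then obtain x y where "?S = {x, y}" "x \<noteq> y"
    by (auto simp: card_2_iff)
  then obtain v where v: "?S = {k, v}" "v \<noteq> k"
    using \<open>k \<in> ?S\<close> by (cases "x = k") auto
  then have mem: "w \<in> elems M \<and> \<gamma> \<in> facets M w \<longleftrightarrow> w = k \<or> w = v" for w
    by blast
  have 1: "nbr M k \<gamma> = v"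
    unfolding nbr_def by (rule the_equality) (use mem v(2) in auto)
  have 2: "nbr M v \<gamma> = k"
    unfolding nbr_def by (rule the_equality) (use mem v(2) in auto)
  show "nbr M k \<gamma> \<in> elems M" "nbr M k \<gamma> \<noteq> k" "\<gamma> \<in> int_facets M (nbr M k \<gamma>)"
    "nbr M (nbr M k \<gamma>) \<gamma> = k"
    using 1 2 v(2) mem[of v] \<gamma> by (auto simp: int_facets_def)
qed

text \<open>Passing to the neighbour across the facet is an involution on interior element-facet
  pairs, so each sum equals its reindexed copy. Adding the copies compares both sides of a facet at
  once, without choosing an orientation.\<close>

lemma interior_facet_sum_mono:
  fixes \<phi> \<psi> :: "nat \<Rightarrow> nat \<Rightarrow> real"
  assumes mesh: "geometric_mesh \<Omega> \<Gamma>D \<Gamma>N r M"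
    and le: "\<And>k \<gamma>. k \<in> elems M \<Longrightarrow> \<gamma> \<in> int_facets M k \<Longrightarrow>
      \<phi> k \<gamma> + \<phi> (nbr M k \<gamma>) \<gamma> \<le> \<psi> k \<gamma> + \<psi> (nbr M k \<gamma>) \<gamma>"
  shows "(\<Sum>k\<in>elems M. \<Sum>\<gamma>\<in>int_facets M k. \<phi> k \<gamma>) \<le> (\<Sum>k\<in>elems M. \<Sum>\<gamma>\<in>int_facets M k. \<psi> k \<gamma>)"
proof -
  let ?S = "Sigma (elems M) (int_facets M)"
  have fin: "finite (elems M)" "\<And>k. k \<in> elems M \<Longrightarrow> finite (int_facets M k)"
    using mesh mesh_finite_facets[OF mesh] by (simp_all add: geometric_mesh_def int_facets_def)
  have sigma: "(\<Sum>k\<in>elems M. \<Sum>\<gamma>\<in>int_facets M k. f k \<gamma>) = (\<Sum>x\<in>?S. f (fst x) (snd x))"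
    for f :: "nat \<Rightarrow> nat \<Rightarrow> real"
    using fin by (simp add: sum.Sigma split_def)
  have swap: "(\<Sum>x\<in>?S. f (fst x) (snd x)) = (\<Sum>x\<in>?S. f (nbr M (fst x) (snd x)) (snd x))"
    for f :: "nat \<Rightarrow> nat \<Rightarrow> real"
    by (rule sum.reindex_bij_witness[where i = "\<lambda>x. (nbr M (fst x) (snd x), snd x)"
          and j = "\<lambda>x. (nbr M (fst x) (snd x), snd x)"])
      (auto simp: mesh_nbr[OF mesh])
  have "(\<Sum>x\<in>?S. \<phi> (fst x) (snd x)) + (\<Sum>x\<in>?S. \<phi> (nbr M (fst x) (snd x)) (snd x)) \<le>
      (\<Sum>x\<in>?S. \<psi> (fst x) (snd x)) + (\<Sum>x\<in>?S. \<psi> (nbr M (fst x) (snd x)) (snd x))"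
    unfolding sum.distrib[symmetric] by (rule sum_mono) (use le in auto)
  then show ?thesis
    unfolding sigma swap[symmetric] by simp
qed

text \<open>What an interior facet contributes as seen from \<open>k\<close>: the boundary term of
  the Green formula minus the SAT. Since \<open>T2\<close> and \<open>T4\<close> vanish, the test
  function enters only through its trace.\<close>

definition interior_term ::
  "(real^2 \<Rightarrow> real^2^2) \<Rightarrow> ('np::finite, 'nf::finite) ref_elem \<Rightarrow> ('np, 'nf) sbp_mesh \<Rightarrow>
   (nat \<Rightarrow> real^'np) \<Rightarrow> (nat \<Rightarrow> real^'np) \<Rightarrow> nat \<Rightarrow> nat \<Rightarrow> real" where
  "interior_term lam r M v u k \<gamma> =
     (Rm M k \<gamma> *v v k) \<bullet> (Bm r M \<gamma> *v (Dg lam r M k \<gamma> *v u k)) -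
     (Rm M k \<gamma> *v v k) \<bullet> (T1 (cng_sat lam r M) k \<gamma> *v
        (Rm M k \<gamma> *v u k - Rm M (nbr M k \<gamma>) \<gamma> *v u (nbr M k \<gamma>))) -
     (1 / 2) * ((Rm M k \<gamma> *v v k) \<bullet> (Bm r M \<gamma> *v
        (Dg lam r M k \<gamma> *v u k + Dg lam r M (nbr M k \<gamma>) \<gamma> *v u (nbr M k \<gamma>))))"

lemma facets_sum_split:
  fixes f :: "nat \<Rightarrow> real"
  assumes "geometric_mesh \<Omega> \<Gamma>D \<Gamma>N r M" "k \<in> elems M"
  shows "(\<Sum>\<gamma>\<in>facets M k. f \<gamma>) = (\<Sum>\<gamma>\<in>int_facets M k. f \<gamma>) +
    (\<Sum>\<gamma>\<in>facets M k \<inter> dir_facets M. f \<gamma>) + (\<Sum>\<gamma>\<in>facets M k \<inter> neu_facets M. f \<gamma>)"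
proof -
  have fin: "finite (facets M k)"
    by (rule mesh_finite_facets[OF assms])
  have disj: "dir_facets M \<inter> neu_facets M = {}"
    using assms(1) by (simp add: geometric_mesh_def)
  have "facets M k = int_facets M k \<union> ((facets M k \<inter> dir_facets M) \<union> (facets M k \<inter> neu_facets M))"
    by (auto simp: int_facets_def)
  then have "(\<Sum>\<gamma>\<in>facets M k. f \<gamma>) =
      (\<Sum>\<gamma>\<in>int_facets M k \<union> ((facets M k \<inter> dir_facets M) \<union> (facets M k \<inter> neu_facets M)). f \<gamma>)"
    by simp
  also have "\<dots> = (\<Sum>\<gamma>\<in>int_facets M k. f \<gamma>) +
      ((\<Sum>\<gamma>\<in>facets M k \<inter> dir_facets M. f \<gamma>) + (\<Sum>\<gamma>\<in>facets M k \<inter> neu_facets M. f \<gamma>))"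
    using fin disj by (subst sum.union_disjoint; (subst sum.union_disjoint)?)
      (auto simp: int_facets_def)
  finally show ?thesis
    by simp
qed

text \<open>Testing with \<open>Hm\<close> cancels the inverse norm in front of the SATs. The
  Neumann SAT removes the Green boundary term, so that only the data remain there. The test function
  is kept free because both 1 and the solution are inserted later.\<close>

lemma weak_form:
  assumes mesh: "geometric_mesh \<Omega> \<Gamma>D \<Gamma>N r M" and sbp: "sbp_operators r M" and k: "k \<in> elems M"
    and u': "u' = D2 lam r M k *v u k - matrix_inv (Hm M k) *v sI lam r M (cng_sat lam r M) u k
      - matrix_inv (Hm M k) *v sB lam r M (cng_sat lam r M) gD gN u k"
  shows "v k \<bullet> (Hm M k *v u') =
    - energy_density lam r M k (v k) (u k) + (\<Sum>\<gamma>\<in>int_facets M k. interior_term lam r M v u k \<gamma>) +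
    (\<Sum>\<gamma>\<in>facets M k \<inter> dir_facets M.
       (Rm M k \<gamma> *v v k) \<bullet> (Bm r M \<gamma> *v (Dg lam r M k \<gamma> *v u k)) -
       (Rm M k \<gamma> *v v k) \<bullet> (TD (cng_sat lam r M) k \<gamma> *v (Rm M k \<gamma> *v u k - gD k \<gamma>)) +
       (Dg lam r M k \<gamma> *v v k) \<bullet> (Bm r M \<gamma> *v (Rm M k \<gamma> *v u k - gD k \<gamma>))) +
    (\<Sum>\<gamma>\<in>facets M k \<inter> neu_facets M. (Rm M k \<gamma> *v v k) \<bullet> (Bm r M \<gamma> *v gN k \<gamma>))"
proof -
  let ?T = "cng_sat lam r M"
  have fin: "finite (facets M k)"
    by (rule mesh_finite_facets[OF mesh k])
  have inv: "Hm M k *v (matrix_inv (Hm M k) *v x) = x" for x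
    using less_imp_neq[OF sbp_Hw_pos[OF sbp k], symmetric]
    by (simp add: matrix_inv_Hm[OF sbp_Hw_pos[OF sbp k]] vec_eq_iff diag_mat_mult Hm_mult)
  have tr: "x \<bullet> (transpose A *v y) = (A *v x) \<bullet> y" for x :: "real^'a" and A :: "real^'a^'b" and y
    by (simp add: dot_matrix_vector)
  have "v k \<bullet> (Hm M k *v u') = v k \<bullet> (Hm M k *v (D2 lam r M k *v u k)) - v k \<bullet> sI lam r M ?T u k -
      v k \<bullet> sB lam r M ?T gD gN u k"
    unfolding u' by (simp add: matrix_vector_mult_diff_distrib inner_diff_right inv)
  moreover have "v k \<bullet> sI lam r M ?T u k = (\<Sum>\<gamma>\<in>int_facets M k.
      (Rm M k \<gamma> *v v k) \<bullet> (Bm r M \<gamma> *v (Dg lam r M k \<gamma> *v u k)) - interior_term lam r M v u k \<gamma>)"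
    unfolding sI_def inner_sum_right
    by (intro sum.cong refl)
      (simp add: Let_def interior_term_def inner_add_right tr cng_sat_def scaleR_matrix_vector_assoc[symmetric])
  moreover have "v k \<bullet> sB lam r M ?T gD gN u k =
      (\<Sum>\<gamma>\<in>facets M k \<inter> dir_facets M.
         (Rm M k \<gamma> *v v k) \<bullet> (TD ?T k \<gamma> *v (Rm M k \<gamma> *v u k - gD k \<gamma>)) -
         (Dg lam r M k \<gamma> *v v k) \<bullet> (Bm r M \<gamma> *v (Rm M k \<gamma> *v u k - gD k \<gamma>))) +
      (\<Sum>\<gamma>\<in>facets M k \<inter> neu_facets M.
         (Rm M k \<gamma> *v v k) \<bullet> (Bm r M \<gamma> *v (Dg lam r M k \<gamma> *v u k)) -
         (Rm M k \<gamma> *v v k) \<bullet> (Bm r M \<gamma> *v gN k \<gamma>))"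
    by (simp add: sB_def inner_add_right inner_sum_right inner_diff_right tr
        matrix_vector_mult_diff_distrib)
  ultimately show ?thesis
    unfolding dot_Hm_D2[OF sbp k fin] facets_sum_split[OF mesh k]
    by (simp add: sum_subtractf sum.distrib)
qed

section \<open>Conservation and decay of the energy\<close>

lemma cng_T1_sym:
  assumes "geometric_mesh \<Omega> \<Gamma>D \<Gamma>N r M" "k \<in> elems M" "\<gamma> \<in> int_facets M k"
  shows "T1 (cng_sat lam r M) (nbr M k \<gamma>) \<gamma> = T1 (cng_sat lam r M) k \<gamma>"
  by (simp add: cng_sat_def mesh_nbr(4)[OF assms] add.commute)

lemma cng_conservative:
  fixes M :: "('np::finite, 'nf::finite) sbp_mesh"
  assumes mesh: "geometric_mesh \<Omega> \<Gamma>D \<Gamma>N r M" and sbp: "sbp_operators r M"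
  shows "conservative lam r M (cng_sat lam r M)"
proof -
  let ?T = "cng_sat lam r M"
  \<comment> \<open>Read off from \<open>weak_form\<close> with v = 1: the normal flux of v is zero,
    which removes the last Dirichlet term, and its trace is 1.\<close>
  define \<Phi> :: "nat \<Rightarrow> nat \<Rightarrow> real^'nf \<Rightarrow> real^'nf \<Rightarrow> real^'nf \<Rightarrow> real^'nf \<Rightarrow> real" where
    "\<Phi> k \<gamma> ru du gD gN = (if \<gamma> \<in> dir_facets M
       then 1 \<bullet> (Bm r M \<gamma> *v du) - 1 \<bullet> (TD ?T k \<gamma> *v (ru - gD)) else 1 \<bullet> (Bm r M \<gamma> *v gN))"
    for k \<gamma> ru du gD gN
  \<comment> \<open>The constant 1 is a polynomial of degree 0, so exactness of the extrapolation
    applies to it.\<close>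
  have R1: "Rm M k \<gamma> *v 1 = 1" if "k \<in> elems M" "\<gamma> \<in> facets M k" for k \<gamma>
  proof -
    define c :: "nat \<Rightarrow> nat \<Rightarrow> real" where "c i j = (if i = 0 then if j = 0 then 1 else 0 else 0)" for i j
    have "poly2 d c x = 1" for d x
    proof -
      have "(\<Sum>j\<le>d - i. c i j * (x $ 1) ^ i * (x $ 2) ^ j) = (\<Sum>j\<le>d - i. if j = 0 then if i = 0 then 1 else 0 else 0)" for i
        by (intro sum.cong) (auto simp: c_def)
      then have "poly2 d c x = (\<Sum>i\<le>d. if i = 0 then 1 else 0)"
        by (simp add: poly2_def)
      then show ?thesis
        by simp
    qed
    moreover have "Rm M k \<gamma> *v (\<chi> j. poly2 (deg r) c (rnode r j)) =
        (\<chi> i. poly2 (deg r) c (ref_edge_pt M k \<gamma> (gnode r i)))"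
      using sbp that unfolding sbp_operators_def by blast
    ultimately show ?thesis
      by (simp add: one_vec_def)
  qed
  have lam0: "lam_nodal lam r M k (\<lambda>d. 0) c = 0" for k c
    by (simp add: lam_nodal_def vec_eq_iff)
  have Dg1: "Dg lam r M k \<gamma> *v 1 = 0" if "k \<in> elems M" for k \<gamma>
    by (simp add: Dg_mult sbp_Dm_one[OF sbp that] lam0)
  have E1: "energy_density lam r M k 1 w = 0" if "k \<in> elems M" for k w
    by (simp add: energy_density_def sbp_Dm_one[OF sbp that])
  have "(\<Sum>k\<in>elems M. 1 \<bullet> (Hm M k *v u' t k)) =
      (\<Sum>k\<in>elems M. \<Sum>\<gamma>\<in>facets M k \<inter> (dir_facets M \<union> neu_facets M).
         \<Phi> k \<gamma> (Rm M k \<gamma> *v u t k) (Dg lam r M k \<gamma> *v u t k) (gD t k \<gamma>) (gN t k \<gamma>))"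
    if sol: "semidiscrete_solution lam r M ?T (\<lambda>_ _. 0) gD gN u u'" and t: "0 \<le> t" for gD gN u u' t
  proof -
    have disj: "dir_facets M \<inter> neu_facets M = {}"
      using mesh by (simp add: geometric_mesh_def)
    then have neu: "\<gamma> \<notin> dir_facets M" if "\<gamma> \<in> neu_facets M" for \<gamma>
      using that by blast
    let ?I = "\<lambda>k \<gamma>. interior_term lam r M (\<lambda>_. 1) (u t) k \<gamma>"
    let ?\<Phi> = "\<lambda>k \<gamma>. \<Phi> k \<gamma> (Rm M k \<gamma> *v u t k) (Dg lam r M k \<gamma> *v u t k) (gD t k \<gamma>) (gN t k \<gamma>)"
    have local: "1 \<bullet> (Hm M k *v u' t k) = (\<Sum>\<gamma>\<in>int_facets M k. ?I k \<gamma>) +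
        (\<Sum>\<gamma>\<in>facets M k \<inter> (dir_facets M \<union> neu_facets M). ?\<Phi> k \<gamma>)" if k: "k \<in> elems M" for k
    proof -
      have fin: "finite (facets M k)"
        by (rule mesh_finite_facets[OF mesh k])
      have "1 \<bullet> (Hm M k *v u' t k) = (\<Sum>\<gamma>\<in>int_facets M k. ?I k \<gamma>) +
          ((\<Sum>\<gamma>\<in>facets M k \<inter> dir_facets M. ?\<Phi> k \<gamma>) + (\<Sum>\<gamma>\<in>facets M k \<inter> neu_facets M. ?\<Phi> k \<gamma>))"
        by (subst weak_form[OF mesh sbp k, where v = "\<lambda>_. 1" and u = "u t" and gD = "gD t" and gN = "gN t"])
          (use sol t k in \<open>auto simp: neu semidiscrete_solution_def E1 Dg1 R1 \<Phi>_def intro!: sum.cong\<close>)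
      also have "(\<Sum>\<gamma>\<in>facets M k \<inter> dir_facets M. ?\<Phi> k \<gamma>) + (\<Sum>\<gamma>\<in>facets M k \<inter> neu_facets M. ?\<Phi> k \<gamma>) =
          (\<Sum>\<gamma>\<in>facets M k \<inter> (dir_facets M \<union> neu_facets M). ?\<Phi> k \<gamma>)"
        unfolding Int_Un_distrib using fin disj by (subst sum.union_disjoint) auto
      finally show ?thesis .
    qed
    \<comment> \<open>Both sides carry the same \<open>T1\<close> and the same \<open>Bm\<close>.
      The jump changes sign, so the penalties cancel; the two one-sided fluxes are compensated by
      twice the half sum.\<close>
    have anti: "?I k \<gamma> + ?I (nbr M k \<gamma>) \<gamma> = 0" if "k \<in> elems M" "\<gamma> \<in> int_facets M k" for k \<gamma>
      using that mesh_nbr[OF mesh that]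
      by (simp add: interior_term_def R1 cng_T1_sym[OF mesh that] int_facets_def
          matrix_vector_mult_diff_distrib matrix_vector_right_distrib inner_diff_right inner_add_right add_divide_distrib)
    \<comment> \<open>Comparing with zero in both directions turns the inequality for paired sums
      into an equality.\<close>
    have "(\<Sum>k\<in>elems M. \<Sum>\<gamma>\<in>int_facets M k. ?I k \<gamma>) = (\<Sum>k\<in>elems M. \<Sum>\<gamma>\<in>int_facets M k. 0)"
      by (intro antisym interior_facet_sum_mono[OF mesh]) (simp_all add: anti)
    then show ?thesis
      by (simp add: local sum.distrib)
  qed
  then show ?thesis
    unfolding conservative_def by (intro exI[of _ \<Phi>]) blast
qed

text \<open>The algebraic core of stability at one instant: \<open>u'\<close> is just the right-hand
  side of the scheme, so no time derivative occurs.\<close>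

lemma cng_energy_rate_nonpos:
  fixes M :: "('np::finite, 'nf::finite) sbp_mesh"
  assumes mesh: "geometric_mesh \<Omega> \<Gamma>D \<Gamma>N r M" and sbp: "sbp_operators r M"
    and spd: "\<And>k j. k \<in> elems M \<Longrightarrow> spd (lam (vnode r M k j))"
    and u': "\<And>k. k \<in> elems M \<Longrightarrow> u' k = D2 lam r M k *v u k
      - matrix_inv (Hm M k) *v sI lam r M (cng_sat lam r M) u k
      - matrix_inv (Hm M k) *v sB lam r M (cng_sat lam r M) (\<lambda>_ _. 0) (\<lambda>_ _. 0) u k"
  shows "(\<Sum>k\<in>elems M. u k \<bullet> (Hm M k *v u' k)) \<le> 0"
proof -
  let ?T = "cng_sat lam r M"
  let ?E = "\<lambda>k. energy_density lam r M k (u k) (u k)"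
  let ?I = "\<lambda>k \<gamma>. interior_term lam r M u u k \<gamma>"
  let ?D = "\<lambda>k \<gamma>. (Rm M k \<gamma> *v u k) \<bullet> (Bm r M \<gamma> *v (Dg lam r M k \<gamma> *v u k)) -
       (Rm M k \<gamma> *v u k) \<bullet> (TD ?T k \<gamma> *v (Rm M k \<gamma> *v u k)) +
       (Dg lam r M k \<gamma> *v u k) \<bullet> (Bm r M \<gamma> *v (Rm M k \<gamma> *v u k))"
  have fwt: "0 < fwt M k \<gamma>" if "k \<in> elems M" "\<gamma> \<in> facets M k" for k \<gamma>
    using sbp that unfolding sbp_operators_def by blast
  \<comment> \<open>The Dirichlet flux appears twice, from the Green formula and from the
    coefficient -B of the SAT. The two copies agree by symmetry of \<open>Bm\<close>, hence the
    factor 2 in Young's inequality.\<close>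
  have dir: "?D k \<gamma> \<le> fwt M k \<gamma> * ?E k" if k: "k \<in> elems M" and \<gamma>: "\<gamma> \<in> facets M k" for k \<gamma>
  proof -
    let ?x = "Rm M k \<gamma> *v u k"
    have "2 * (?x \<bullet> (Bm r M \<gamma> *v (Dg lam r M k \<gamma> *v u k))) \<le>
        1 / fwt M k \<gamma> * (?x \<bullet> (Bm r M \<gamma> *v (Ups lam r M k \<gamma> *v (Bm r M \<gamma> *v ?x)))) + fwt M k \<gamma> * ?E k"
      using facet_flux_young[where lam = lam and k = k, OF sbp k spd[OF k] fwt[OF k \<gamma>], of 2 ?x \<gamma> "u k"] by simp
    moreover have "?x \<bullet> (TD ?T k \<gamma> *v ?x) =
        1 / fwt M k \<gamma> * (?x \<bullet> (Bm r M \<gamma> *v (Ups lam r M k \<gamma> *v (Bm r M \<gamma> *v ?x))))"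
      by (simp add: cng_sat_def scaleR_matrix_vector_assoc[symmetric] matrix_vector_mul_assoc[symmetric])
    moreover have "(Dg lam r M k \<gamma> *v u k) \<bullet> (Bm r M \<gamma> *v ?x) = ?x \<bullet> (Bm r M \<gamma> *v (Dg lam r M k \<gamma> *v u k))"
      by (metis dot_Bm_commute inner_commute)
    ultimately show ?thesis
      by linarith
  qed
  have int: "?I k \<gamma> + ?I (nbr M k \<gamma>) \<gamma> \<le> fwt M k \<gamma> * ?E k + fwt M (nbr M k \<gamma>) \<gamma> * ?E (nbr M k \<gamma>)"
    if k: "k \<in> elems M" and \<gamma>: "\<gamma> \<in> int_facets M k" for k \<gamma>
  proof -
    define v where "v = nbr M k \<gamma>"
    define x where "x = Rm M k \<gamma> *v u k - Rm M v \<gamma> *v u v"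
    define q where "q w = x \<bullet> (Bm r M \<gamma> *v (Ups lam r M w \<gamma> *v (Bm r M \<gamma> *v x)))" for w
    note nb = mesh_nbr[OF mesh k \<gamma>, folded v_def]
    have young: "s * (x \<bullet> (Bm r M \<gamma> *v (Dg lam r M w \<gamma> *v u w))) \<le>
        1 / (16 * fwt M w \<gamma>) * q w + fwt M w \<gamma> * ?E w"
      if "w \<in> elems M" "\<gamma> \<in> facets M w" "s\<^sup>2 = 1 / 4" for w s
      using facet_flux_young[where lam = lam and k = w, OF sbp that(1) spd[OF that(1)] fwt[OF that(1,2)], of s x \<gamma> "u w"] that(3)
      by (simp add: q_def)
    have "1 / 2 * (x \<bullet> (Bm r M \<gamma> *v (Dg lam r M k \<gamma> *v u k))) \<le>
        1 / (16 * fwt M k \<gamma>) * q k + fwt M k \<gamma> * ?E k"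
      using k \<gamma> by (intro young) (auto simp: int_facets_def power2_eq_square)
    \<comment> \<open>The jump is oriented from \<open>k\<close> to the neighbour, so the flux of
      the neighbour carries the opposite sign; only the square of this factor enters the
      bound.\<close>
    moreover have "- 1 / 2 * (x \<bullet> (Bm r M \<gamma> *v (Dg lam r M v \<gamma> *v u v))) \<le>
        1 / (16 * fwt M v \<gamma>) * q v + fwt M v \<gamma> * ?E v"
      using nb by (intro young) (auto simp: int_facets_def power2_eq_square)
    moreover have "?I k \<gamma> + ?I v \<gamma> = 1 / 2 * (x \<bullet> (Bm r M \<gamma> *v (Dg lam r M k \<gamma> *v u k))) -
        1 / 2 * (x \<bullet> (Bm r M \<gamma> *v (Dg lam r M v \<gamma> *v u v))) - x \<bullet> (T1 ?T k \<gamma> *v x)"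
      unfolding interior_term_def nb(4) v_def[symmetric] cng_T1_sym[OF mesh k \<gamma>, folded v_def] x_def
      by (simp add: inner_diff_left inner_diff_right inner_add_right matrix_vector_mult_diff_distrib
          matrix_vector_right_distrib algebra_simps)
    moreover have "x \<bullet> (T1 ?T k \<gamma> *v x) = 1 / (16 * fwt M k \<gamma>) * q k + 1 / (16 * fwt M v \<gamma>) * q v"
      by (simp add: cng_sat_def v_def[symmetric] q_def scaleR_matrix_vector_assoc[symmetric]
          matrix_vector_mul_assoc[symmetric] matrix_vector_mult_add_rdistrib
          matrix_vector_right_distrib inner_add_right matrix_vector_mult_scaleR algebra_simps)
    ultimately show ?thesis
      unfolding v_def[symmetric] by linarith
  qed
  have int_le: "(\<Sum>k\<in>elems M. \<Sum>\<gamma>\<in>int_facets M k. ?I k \<gamma>) \<le>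
      (\<Sum>k\<in>elems M. \<Sum>\<gamma>\<in>int_facets M k. fwt M k \<gamma> * ?E k)"
    by (rule interior_facet_sum_mono[OF mesh]) (rule int)
  have dir_le: "(\<Sum>k\<in>elems M. \<Sum>\<gamma>\<in>facets M k \<inter> dir_facets M. ?D k \<gamma>) \<le>
      (\<Sum>k\<in>elems M. \<Sum>\<gamma>\<in>facets M k \<inter> dir_facets M. fwt M k \<gamma> * ?E k)"
    by (intro sum_mono dir) auto
  have "(\<Sum>k\<in>elems M. u k \<bullet> (Hm M k *v u' k)) = (\<Sum>k\<in>elems M. - ?E k +
      (\<Sum>\<gamma>\<in>int_facets M k. ?I k \<gamma>) + (\<Sum>\<gamma>\<in>facets M k \<inter> dir_facets M. ?D k \<gamma>))"
    by (intro sum.cong refl)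
      (simp add: weak_form[OF mesh sbp _ u', where v = u])
  also have "\<dots> = (\<Sum>k\<in>elems M. - ?E k) + (\<Sum>k\<in>elems M. \<Sum>\<gamma>\<in>int_facets M k. ?I k \<gamma>) +
      (\<Sum>k\<in>elems M. \<Sum>\<gamma>\<in>facets M k \<inter> dir_facets M. ?D k \<gamma>)"
    by (simp only: sum.distrib)
  also have "\<dots> \<le> (\<Sum>k\<in>elems M. - ?E k) +
      (\<Sum>k\<in>elems M. \<Sum>\<gamma>\<in>int_facets M k. fwt M k \<gamma> * ?E k) +
      (\<Sum>k\<in>elems M. \<Sum>\<gamma>\<in>facets M k \<inter> dir_facets M. fwt M k \<gamma> * ?E k)"
    by (intro add_mono order_refl int_le dir_le)
  also have "\<dots> = (\<Sum>k\<in>elems M. - ?E k + (\<Sum>\<gamma>\<in>int_facets M k. fwt M k \<gamma> * ?E k) +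
      (\<Sum>\<gamma>\<in>facets M k \<inter> dir_facets M. fwt M k \<gamma> * ?E k))"
    by (simp only: sum.distrib)
  also have "\<dots> \<le> 0"
  proof (rule sum_nonpos)
    fix k
    assume k: "k \<in> elems M"
    \<comment> \<open>The shares sum to 1 over all facets. Interior and Dirichlet facets have spent
      theirs, and the Neumann shares are left over as a nonnegative surplus.\<close>
    have "0 \<le> (\<Sum>\<gamma>\<in>facets M k \<inter> neu_facets M. fwt M k \<gamma> * ?E k)"
      using fwt[OF k] energy_density_nonneg[where lam = lam, OF sbp k spd[OF k]]
      by (intro sum_nonneg mult_nonneg_nonneg) (auto intro: less_imp_le)
    moreover have "(\<Sum>\<gamma>\<in>facets M k. fwt M k \<gamma> * ?E k) = ?E k"
      using sbp_fwt_sum[OF sbp k] by (simp add: sum_distrib_right[symmetric])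
    ultimately show "- ?E k + (\<Sum>\<gamma>\<in>int_facets M k. fwt M k \<gamma> * ?E k) +
        (\<Sum>\<gamma>\<in>facets M k \<inter> dir_facets M. fwt M k \<gamma> * ?E k) \<le> 0"
      unfolding facets_sum_split[OF mesh k] by linarith
  qed
  finally show ?thesis .
qed

lemma cng_energy_stable:
  assumes mesh: "geometric_mesh \<Omega> \<Gamma>D \<Gamma>N r M" and sbp: "sbp_operators r M"
    and spd: "\<And>k j. k \<in> elems M \<Longrightarrow> spd (lam (vnode r M k j))"
  shows "energy_stable lam r M (cng_sat lam r M)"
  unfolding energy_stable_def
proof (intro allI impI)
  fix u u' and t :: real
  assume sol: "semidiscrete_solution lam r M (cng_sat lam r M) (\<lambda>_ _. 0) (\<lambda>_ _ _. 0) (\<lambda>_ _ _. 0) u u'"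
    and t: "0 \<le> t"
  have der: "((\<lambda>\<tau>. u \<tau> k \<bullet> (Hm M k *v u \<tau> k)) has_real_derivative 2 * (u t k \<bullet> (Hm M k *v u' t k)))
      (at t within {0..})" if "k \<in> elems M" for k
  proof -
    have u: "((\<lambda>\<tau>. u \<tau> k) has_vector_derivative u' t k) (at t within {0..})"
      using sol t that unfolding semidiscrete_solution_def by blast
    have Hu: "((\<lambda>\<tau>. Hm M k *v u \<tau> k) has_vector_derivative Hm M k *v u' t k) (at t within {0..})"
      by (rule bounded_linear.has_vector_derivative[OF matrix_vector_mul_bounded_linear u])
    have "u' t k \<bullet> (Hm M k *v u t k) = u t k \<bullet> (Hm M k *v u' t k)"
      by (simp add: dot_Hm algebra_simps)
    then show ?thesis
      using bounded_bilinear.has_vector_derivative[OF bounded_bilinear_inner u Hu]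
      by (simp add: has_real_derivative_iff_has_vector_derivative)
  qed
  have "((\<lambda>\<tau>. \<Sum>k\<in>elems M. u \<tau> k \<bullet> (Hm M k *v u \<tau> k)) has_real_derivative
      (\<Sum>k\<in>elems M. 2 * (u t k \<bullet> (Hm M k *v u' t k)))) (at t within {0..})"
    by (intro DERIV_sum der)
  moreover have "(\<Sum>k\<in>elems M. u t k \<bullet> (Hm M k *v u' t k)) \<le> 0"
  proof (rule cng_energy_rate_nonpos[where lam = lam, OF mesh sbp])
    fix k
    assume k: "k \<in> elems M"
    show "spd (lam (vnode r M k j))" for j
      using k by (rule spd)
    show "u' t k = D2 lam r M k *v u t k
        - matrix_inv (Hm M k) *v sI lam r M (cng_sat lam r M) (u t) k
        - matrix_inv (Hm M k) *v sB lam r M (cng_sat lam r M) (\<lambda>_ _. 0) (\<lambda>_ _. 0) (u t) k"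
      using sol t k unfolding semidiscrete_solution_def by auto
  qed
  ultimately show "\<exists>e. ((\<lambda>\<tau>. \<Sum>k\<in>elems M. u \<tau> k \<bullet> (Hm M k *v u \<tau> k)) has_real_derivative e)
      (at t within {0..}) \<and> e \<le> 0"
    unfolding sum_distrib_left[symmetric] by (intro exI conjI) (assumption, simp)
qed

section \<open>Taylor expansion with bounded derivatives\<close>

lemma partial_eqI: "(f has_derivative f') (at x) \<Longrightarrow> partial i f x = f' (axis i 1)"
  unfolding partial_def by (simp add: frechet_derivative_at[symmetric])

lemma has_derivative_partial:
  assumes "f differentiable (at x)"
  shows "(f has_derivative (\<lambda>h. \<Sum>i\<in>UNIV. h $ i * partial i f x)) (at x)"
proof -
  from assms have f': "(f has_derivative frechet_derivative f (at x)) (at x)"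
    by (simp add: frechet_derivative_works)
  then have lin: "linear (frechet_derivative f (at x))"
    by (rule has_derivative_linear)
  have "frechet_derivative f (at x) h = (\<Sum>i\<in>UNIV. h $ i * partial i f x)" for h
  proof -
    have "h = (\<Sum>i\<in>UNIV. h $ i *\<^sub>R axis i 1)"
      by (simp add: vec_eq_iff axis_def if_distrib[of "\<lambda>a. _ * a"] cong: if_cong)
    then have "frechet_derivative f (at x) h = frechet_derivative f (at x) (\<Sum>i\<in>UNIV. h $ i *\<^sub>R axis i 1)"
      by simp
    also have "\<dots> = (\<Sum>i\<in>UNIV. h $ i * partial i f x)"
      by (simp add: linear_sum[OF lin] linear_cmul[OF lin] partial_def)
    finally show ?thesis .
  qed
  then have "frechet_derivative f (at x) = (\<lambda>h. \<Sum>i\<in>UNIV. h $ i * partial i f x)"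
    by (rule ext)
  with f' show ?thesis
    by simp
qed

text \<open>\<open>frechet_derivative\<close> is chosen from the predicate
  \<open>has_derivative\<close>; functions that agree near \<open>x\<close> satisfy it for the same
  maps, so even the choices coincide.\<close>

lemma partial_cong_open:
  assumes "open V" "x \<in> V" "\<And>y. y \<in> V \<Longrightarrow> f y = g y"
  shows "partial i f x = partial i g x"
proof -
  have "(f has_derivative f') (at x) \<longleftrightarrow> (g has_derivative f') (at x)" for f'
    using has_derivative_transform_within_open[OF _ assms(1,2), of f f' UNIV g]
      has_derivative_transform_within_open[OF _ assms(1,2), of g f' UNIV f] assms(3) by auto
  then show ?thesis
    by (simp add: partial_def frechet_derivative_def)
qed

lemma differentiable_cong_open:
  assumes "open V" "x \<in> V" "\<And>y. y \<in> V \<Longrightarrow> f y = g y" "f differentiable (at x)"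
  shows "g differentiable (at x)"
  using assms has_derivative_transform_within_open[OF _ assms(1,2), of f _ UNIV g]
  unfolding differentiable_def by blast

lemma partial_const [simp]: "partial i (\<lambda>x. c) x = 0"
  by (subst partial_eqI[OF has_derivative_const]) simp

lemma partial_coord: "partial i (\<lambda>x. x $ j - c) x = (if i = j then 1 else 0)"
proof -
  have "((\<lambda>x::real^2. x $ j - c) has_derivative (\<lambda>h. h $ j)) (at x)"
    by (auto intro!: derivative_eq_intros bounded_linear.has_derivative[OF bounded_linear_vec_nth])
  from partial_eqI[OF this] show ?thesis
    by (simp add: axis_def)
qed

lemma partial_add:
  assumes "f differentiable (at x)" "g differentiable (at x)"
  shows "partial i (\<lambda>x. f x + g x) x = partial i f x + partial i g x"
proof -
  from assms obtain f' g' where d: "(f has_derivative f') (at x)" "(g has_derivative g') (at x)"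
    by (auto simp: differentiable_def)
  show ?thesis
    by (simp add: partial_eqI[OF has_derivative_add[OF d]] partial_eqI[OF d(1)] partial_eqI[OF d(2)])
qed

lemma partial_mult:
  assumes "f differentiable (at x)" "g differentiable (at x)"
  shows "partial i (\<lambda>x. f x * g x) x = f x * partial i g x + partial i f x * g x"
proof -
  from assms obtain f' g' where d: "(f has_derivative f') (at x)" "(g has_derivative g') (at x)"
    by (auto simp: differentiable_def)
  show ?thesis
    by (simp add: partial_eqI[OF has_derivative_mult[OF d]] partial_eqI[OF d(1)] partial_eqI[OF d(2)])
qed

lemma partial_sum:
  assumes "finite A" "\<And>a. a \<in> A \<Longrightarrow> f a differentiable (at x)"
  shows "partial i (\<lambda>x. \<Sum>a\<in>A. f a x) x = (\<Sum>a\<in>A. partial i (f a) x)"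
  using assms
proof (induction A rule: finite_induct)
  case (insert a A)
  then have "(\<lambda>x. \<Sum>a\<in>A. f a x) differentiable (at x)"
    by (intro differentiable_sum) auto
  with insert show ?case
    by (simp add: partial_add)
qed simp

text \<open>Sum and product rules for \<open>partial\<close> hold only at points of
  \<open>V\<close>. Closure of the class under these operations therefore needs transfer along
  equality on an open set.\<close>

lemma Ck_on_open_cong:
  assumes "open V" "\<And>x. x \<in> V \<Longrightarrow> f x = g x" "Ck_on_open m V f"
  shows "Ck_on_open m V g"
  using assms(2,3)
proof (induction m arbitrary: f g)
  case 0
  then show ?case
    by (metis Ck_on_open.simps(1) continuous_on_eq)
next
  case (Suc m)
  show ?case
    unfolding Ck_on_open.simps
  proof (intro conjI ballI allI)
    show "g differentiable (at x)" if "x \<in> V" for x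
      using differentiable_cong_open[OF assms(1) that, of f g] Suc.prems that by auto
    show "Ck_on_open m V (partial i g)" for i
      by (rule Suc.IH[of "partial i f"])
        (use Suc.prems partial_cong_open[OF assms(1), of _ f g] in auto)
  qed
qed

lemma Ck_on_open_Suc_imp: "Ck_on_open (Suc m) V f \<Longrightarrow> Ck_on_open m V f"
proof (induction m arbitrary: f)
  case 0
  then show ?case
    by (auto intro!: continuous_at_imp_continuous_on differentiable_imp_continuous_within)
next
  case (Suc m)
  then show ?case
    by (metis Ck_on_open.simps(2))
qed

lemma Ck_on_open_le: "m \<le> n \<Longrightarrow> Ck_on_open n V f \<Longrightarrow> Ck_on_open m V f"
  by (induction n arbitrary: m) (auto simp: le_Suc_eq intro: Ck_on_open_Suc_imp simp del: Ck_on_open.simps)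

lemma Ck_on_open_subset: "W \<subseteq> V \<Longrightarrow> Ck_on_open m V f \<Longrightarrow> Ck_on_open m W f"
  by (induction m arbitrary: f) (auto intro: continuous_on_subset)

lemma Ck_on_open_continuous: "Ck_on_open m V f \<Longrightarrow> continuous_on V f"
  using Ck_on_open_le[of 0 m V f] by simp

lemma Ck_on_continuous: "Ck_on m S f \<Longrightarrow> continuous_on S f"
  by (auto simp: Ck_on_def intro: continuous_on_subset Ck_on_open_continuous)

lemma Ck_on_open_const: "Ck_on_open m V (\<lambda>x. c)"
proof (induction m arbitrary: c)
  case (Suc m)
  then show ?case
    by (simp add: partial_const[abs_def])
qed simp

lemma Ck_on_open_coord: "Ck_on_open m V (\<lambda>x. x $ j - c)"
proof (cases m)
  case 0
  then show ?thesis
    by (auto intro!: continuous_intros)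
next
  case (Suc n)
  have "(\<lambda>x::real^2. x $ j - c) differentiable (at x)" for x
    by (intro differentiable_diff differentiable_const bounded_linear_imp_differentiable
        bounded_linear_vec_nth)
  then show ?thesis
    using Suc by (simp add: partial_coord[abs_def] Ck_on_open_const)
qed

lemma Ck_on_open_add:
  assumes "open V" "Ck_on_open m V f" "Ck_on_open m V g"
  shows "Ck_on_open m V (\<lambda>x. f x + g x)"
  using assms(2,3)
proof (induction m arbitrary: f g)
  case 0
  then show ?case
    by (auto intro: continuous_on_add)
next
  case (Suc m)
  have "Ck_on_open m V (partial i (\<lambda>x. f x + g x))" for i
    by (rule Ck_on_open_cong[OF assms(1) _ Suc.IH[of "partial i f" "partial i g"]])
      (use Suc.prems in \<open>auto simp: partial_add\<close>)
  then show ?case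
    using Suc.prems by (auto intro: differentiable_add)
qed

lemma Ck_on_open_sum:
  assumes "open V" "finite A" "\<And>a. a \<in> A \<Longrightarrow> Ck_on_open m V (f a)"
  shows "Ck_on_open m V (\<lambda>x. \<Sum>a\<in>A. f a x)"
  using assms(2,3)
  by (induction A rule: finite_induct) (auto simp: Ck_on_open_const intro: Ck_on_open_add[OF assms(1)])

lemma Ck_on_open_mult:
  assumes "open V" "Ck_on_open m V f" "Ck_on_open m V g"
  shows "Ck_on_open m V (\<lambda>x. f x * g x)"
  using assms(2,3)
proof (induction m arbitrary: f g)
  case 0
  then show ?case
    by (auto intro: continuous_on_mult)
next
  case (Suc m)
  have "Ck_on_open m V (partial i (\<lambda>x. f x * g x))" for i
  proof (rule Ck_on_open_cong[OF assms(1)])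
    show "Ck_on_open m V (\<lambda>x. f x * partial i g x + partial i f x * g x)"
      using Suc.prems Ck_on_open_Suc_imp[of m V f] Ck_on_open_Suc_imp[of m V g]
      by (intro Ck_on_open_add[OF assms(1)] Suc.IH) auto
  qed (use Suc.prems in \<open>auto simp: partial_mult\<close>)
  then show ?case
    using Suc.prems by (auto intro: differentiable_mult)
qed

lemma Ck_bounded_mono: "Ck_bounded m S a f \<Longrightarrow> a \<le> b \<Longrightarrow> Ck_bounded m S b f"
  by (induction m arbitrary: f) (auto intro: order_trans)

lemma Ck_bounded_subset: "Ck_bounded m S b f \<Longrightarrow> W \<subseteq> S \<Longrightarrow> Ck_bounded m W b f"
  by (induction m arbitrary: f) auto

lemma Ck_bounded_Suc_imp: "Ck_bounded (Suc m) S b f \<Longrightarrow> Ck_bounded m S b f"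
proof (induction m arbitrary: f)
  case (Suc m)
  then show ?case
    by (metis Ck_bounded.simps(2))
qed simp

lemma Ck_bounded_le: "m \<le> n \<Longrightarrow> Ck_bounded n S b f \<Longrightarrow> Ck_bounded m S b f"
  by (induction n arbitrary: m) (auto simp: le_Suc_eq intro: Ck_bounded_Suc_imp simp del: Ck_bounded.simps)

lemma Ck_bounded_compact:
  assumes "compact K" "K \<subseteq> V" "Ck_on_open m V f"
  shows "\<exists>b\<ge>0. Ck_bounded m K b f"
  using assms(3)
proof (induction m arbitrary: f)
  case (0 f)
  have "bounded (f ` K)"
    using 0 assms(1,2) by (intro compact_imp_bounded compact_continuous_image)
      (auto intro: continuous_on_subset)
  then obtain b where "0 < b" "\<And>x. x \<in> K \<Longrightarrow> \<bar>f x\<bar> \<le> b"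
    by (auto simp: bounded_pos)
  then show ?case
    by (intro exI[of _ b]) auto
next
  case (Suc m)
  have "bounded (f ` K)"
    using Ck_on_open_continuous[OF Suc.prems] assms(1,2)
    by (intro compact_imp_bounded compact_continuous_image) (auto intro: continuous_on_subset)
  then obtain a where a: "0 < a" "\<And>x. x \<in> K \<Longrightarrow> \<bar>f x\<bar> \<le> a"
    by (auto simp: bounded_pos)
  have "\<exists>b. \<forall>i. 0 \<le> b i \<and> Ck_bounded m K (b i) (partial i f)"
    using Suc by (intro choice) auto
  then obtain b where b: "\<And>i. 0 \<le> b i" "\<And>i. Ck_bounded m K (b i) (partial i f)"
    by blast
  have "b i \<le> a + (\<Sum>i\<in>UNIV. b i)" for i
    using a(1) b(1) member_le_sum[of i UNIV b] by (auto simp: add_increasing)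
  moreover have "a \<le> a + (\<Sum>i\<in>UNIV. b i)"
    using b(1) by (simp add: sum_nonneg)
  ultimately show ?case
    using a Ck_bounded_mono[OF b(2)]
    by (intro exI[of _ "a + (\<Sum>i\<in>UNIV. b i)"]) (auto intro: order_trans[OF a(2)])
qed

text \<open>Meant for Taylor polynomials, which are smooth on the whole plane but bounded only on
  bounded sets; it supplies both premises of \<open>order_accurate\<close>.\<close>

definition smooth_bounded :: "nat \<Rightarrow> (real^2) set \<Rightarrow> real \<Rightarrow> (real^2 \<Rightarrow> real) \<Rightarrow> bool" where
  "smooth_bounded m S b f \<longleftrightarrow> Ck_on_open m UNIV f \<and> Ck_bounded m S b f"

lemma smooth_bounded_mono: "smooth_bounded m S a f \<Longrightarrow> a \<le> b \<Longrightarrow> smooth_bounded m S b f"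
  by (auto simp: smooth_bounded_def intro: Ck_bounded_mono)

lemma smooth_bounded_Suc_imp: "smooth_bounded (Suc m) S b f \<Longrightarrow> smooth_bounded m S b f"
  by (auto simp: smooth_bounded_def simp del: Ck_on_open.simps Ck_bounded.simps
      intro: Ck_on_open_Suc_imp Ck_bounded_Suc_imp)

lemma smooth_bounded_Suc:
  "smooth_bounded (Suc m) S b f \<longleftrightarrow> (\<forall>x. f differentiable (at x)) \<and> (\<forall>x\<in>S. \<bar>f x\<bar> \<le> b) \<and>
     (\<forall>i. smooth_bounded m S b (partial i f))"
  by (auto simp: smooth_bounded_def)

lemma smooth_bounded_const: "\<bar>c\<bar> \<le> b \<Longrightarrow> smooth_bounded m S b (\<lambda>x. c)"
proof (induction m arbitrary: c)
  case 0
  then show ?case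
    by (simp add: smooth_bounded_def)
next
  case (Suc m)
  then have "0 \<le> b"
    by linarith
  with Suc show ?case
    by (simp add: smooth_bounded_Suc partial_const[abs_def])
qed

lemma smooth_bounded_coord:
  assumes "\<And>x. x \<in> S \<Longrightarrow> \<bar>x $ j - c\<bar> \<le> b" "1 \<le> b"
  shows "smooth_bounded m S b (\<lambda>x. x $ j - c)"
proof (cases m)
  case 0
  then show ?thesis
    using assms Ck_on_open_coord[of 0] by (simp add: smooth_bounded_def)
next
  case (Suc n)
  then show ?thesis
    using assms Ck_on_open_coord[of 1 UNIV j c]
    by (auto simp: smooth_bounded_Suc partial_coord[abs_def] intro!: smooth_bounded_const)
qed

lemma smooth_bounded_add:
  "smooth_bounded m S a f \<Longrightarrow> smooth_bounded m S b g \<Longrightarrow> smooth_bounded m S (a + b) (\<lambda>x. f x + g x)"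
proof (induction m arbitrary: f g)
  case 0
  then show ?case
    by (fastforce simp: smooth_bounded_def intro: continuous_on_add)
next
  case (Suc m)
  then have "partial i (\<lambda>x. f x + g x) = (\<lambda>x. partial i f x + partial i g x)" for i
    by (auto simp: partial_add smooth_bounded_Suc)
  with Suc show ?case
    by (fastforce simp: smooth_bounded_Suc)
qed

lemma smooth_bounded_sum:
  assumes "finite A" "\<And>a. a \<in> A \<Longrightarrow> smooth_bounded m S (b a) (f a)"
  shows "smooth_bounded m S (\<Sum>a\<in>A. b a) (\<lambda>x. \<Sum>a\<in>A. f a x)"
  using assms
  by (induction A rule: finite_induct) (auto intro: smooth_bounded_const smooth_bounded_add)

text \<open>Each differentiation replaces a product by two products, which gives the factor
  \<open>2 ^ m\<close>.\<close>

lemma smooth_bounded_mult: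
  assumes "0 \<le> a" "0 \<le> b"
  shows "smooth_bounded m S a f \<Longrightarrow> smooth_bounded m S b g \<Longrightarrow>
    smooth_bounded m S (2 ^ m * (a * b)) (\<lambda>x. f x * g x)"
proof (induction m arbitrary: f g)
  case 0
  with assms show ?case
    by (auto simp: smooth_bounded_def abs_mult intro: continuous_on_mult mult_mono)
next
  case (Suc m)
  have eq: "partial i (\<lambda>x. f x * g x) = (\<lambda>x. f x * partial i g x + partial i f x * g x)" for i
    using Suc.prems by (auto simp: partial_mult smooth_bounded_Suc)
  have "smooth_bounded m S (2 ^ m * (a * b) + 2 ^ m * (a * b)) (partial i (\<lambda>x. f x * g x))" for i
    unfolding eq using Suc.prems smooth_bounded_Suc_imp[OF Suc.prems(1)] smooth_bounded_Suc_imp[OF Suc.prems(2)]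
    by (intro smooth_bounded_add Suc.IH) (auto simp: smooth_bounded_Suc)
  then have "smooth_bounded m S (2 ^ Suc m * (a * b)) (partial i (\<lambda>x. f x * g x))" for i
    by (rule smooth_bounded_mono) simp
  moreover have "\<bar>f x * g x\<bar> \<le> 2 ^ Suc m * (a * b)" if "x \<in> S" for x
  proof -
    have "\<bar>f x * g x\<bar> \<le> 1 * (a * b)"
      using Suc.prems that assms by (auto simp: smooth_bounded_Suc abs_mult intro!: mult_mono)
    also have "\<dots> \<le> 2 ^ Suc m * (a * b)"
      using assms by (intro mult_right_mono) (auto simp: one_le_power simp del: power_Suc)
    finally show ?thesis .
  qed
  ultimately show ?case
    using Suc.prems by (auto simp: smooth_bounded_Suc[of m] simp del: power_Suc intro: differentiable_mult)
qed

text \<open>\<open>dir_deriv s f x d\<close> is the \<open>s\<close>-th derivative of \<open>t \<mapsto> f (x + t d)\<close> at 0. Summing over all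
  words in the partial derivatives avoids any appeal to their symmetry.\<close>

fun dir_deriv :: "nat \<Rightarrow> (real^2 \<Rightarrow> real) \<Rightarrow> real^2 \<Rightarrow> real^2 \<Rightarrow> real" where
  "dir_deriv 0 f x d = f x"
| "dir_deriv (Suc s) f x d = (\<Sum>i\<in>UNIV. d $ i * dir_deriv s (partial i f) x d)"

text \<open>The sum has q terms and degree below q, so that the remainder has order q and costs
  exactly q derivatives.\<close>

definition taylor :: "nat \<Rightarrow> (real^2 \<Rightarrow> real) \<Rightarrow> real^2 \<Rightarrow> real^2 \<Rightarrow> real" where
  "taylor q f x0 x = (\<Sum>s<q. inverse (fact s) * dir_deriv s f x0 (x - x0))"

lemma has_derivative_dir_deriv:
  assumes "open V" "x + t *\<^sub>R d \<in> V" "Ck_on_open (Suc s) V f"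
  shows "((\<lambda>t. dir_deriv s f (x + t *\<^sub>R d) d) has_real_derivative dir_deriv (Suc s) f (x + t *\<^sub>R d) d) (at t)"
  using assms(3)
proof (induction s arbitrary: f)
  case 0
  then have "f differentiable (at (x + t *\<^sub>R d))"
    using assms(2) by simp
  from has_derivative_partial[OF this]
  have f': "(f has_derivative (\<lambda>h. \<Sum>i\<in>UNIV. h $ i * partial i f (x + t *\<^sub>R d))) (at (x + t *\<^sub>R d))" .
  have "((\<lambda>t. x + t *\<^sub>R d) has_derivative (\<lambda>h. h *\<^sub>R d)) (at t)"
    by (auto intro!: derivative_eq_intros)
  from has_derivative_compose[OF this f']
  have "((\<lambda>t. f (x + t *\<^sub>R d)) has_derivative
      (\<lambda>h. \<Sum>i\<in>UNIV. (h *\<^sub>R d) $ i * partial i f (x + t *\<^sub>R d))) (at t)" .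
  moreover have "(\<lambda>h. \<Sum>i\<in>UNIV. (h *\<^sub>R d) $ i * partial i f (x + t *\<^sub>R d)) =
      (*) (\<Sum>i\<in>UNIV. d $ i * partial i f (x + t *\<^sub>R d))"
    by (rule ext) (simp add: sum_2 algebra_simps)
  ultimately show ?case
    by (simp add: has_field_derivative_def)
next
  case (Suc s)
  then show ?case
    unfolding dir_deriv.simps(2)[of "Suc s"] unfolding dir_deriv.simps(2)[of s f]
    by (intro DERIV_sum DERIV_cmult Suc.IH) auto
qed

text \<open>Each order contributes two coordinate directions, each with a factor of at most
  \<open>norm d\<close>.\<close>

lemma dir_deriv_bound:
  "Ck_bounded s S b f \<Longrightarrow> x \<in> S \<Longrightarrow> \<bar>dir_deriv s f x d\<bar> \<le> (2 * norm d) ^ s * b"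
proof (induction s arbitrary: f)
  case (Suc s)
  have "\<bar>dir_deriv (Suc s) f x d\<bar> \<le> (\<Sum>i\<in>UNIV. \<bar>d $ i * dir_deriv s (partial i f) x d\<bar>)"
    by (simp add: sum_abs)
  also have "\<dots> \<le> (\<Sum>i\<in>(UNIV::2 set). norm d * ((2 * norm d) ^ s * b))"
    using Suc by (intro sum_mono) (auto simp: abs_mult intro!: mult_mono component_le_norm_cart)
  finally show ?case
    by simp
qed simp

text \<open>Along the segment this is the one-variable Maclaurin formula with Lagrange remainder,
  whose factorial is dropped. Containment is asked of the segment alone because the domain may be
  non-convex.\<close>

lemma taylor_error:
  assumes V: "open V" "S \<subseteq> V" and f: "Ck_on_open q V f" "Ck_bounded q S b f"
    and seg: "closed_segment x0 x \<subseteq> S"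
  shows "\<bar>f x - taylor q f x0 x\<bar> \<le> (2 * norm (x - x0)) ^ q * b"
\<comment> \<open>The Maclaurin formula wants at least one derivative. For order 0 the polynomial is
  zero and the claim is the bound on f itself.\<close>
proof (cases "q = 0")
  case True
  then show ?thesis
    using f(2) seg by (auto simp: taylor_def)
next
  case False
  define d where "d = x - x0"
  have S: "x0 + t *\<^sub>R d \<in> S" if "0 \<le> t" "t \<le> 1" for t
  proof -
    have "x0 + t *\<^sub>R d = (1 - t) *\<^sub>R x0 + t *\<^sub>R x"
      by (simp add: d_def algebra_simps)
    with that seg show ?thesis
      by (auto simp: closed_segment_def)
  qed
  have "\<exists>t>0. t < 1 \<and> f (x0 + 1 *\<^sub>R d) =
      (\<Sum>m<q. dir_deriv m f (x0 + 0 *\<^sub>R d) d / fact m * 1 ^ m) +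
      dir_deriv q f (x0 + t *\<^sub>R d) d / fact q * 1 ^ q"
    by (rule Maclaurin[where diff = "\<lambda>m t. dir_deriv m f (x0 + t *\<^sub>R d) d"])
      (use False f(1) V S in \<open>auto intro!: has_derivative_dir_deriv[OF V(1)] Ck_on_open_le[of _ q]
        simp del: dir_deriv.simps(2) Ck_on_open.simps\<close>)
  then obtain t where t: "0 < t" "t < 1"
    and eq: "f x = (\<Sum>m<q. dir_deriv m f x0 d / fact m) + dir_deriv q f (x0 + t *\<^sub>R d) d / fact q"
    by (auto simp: d_def)
  have "f x - taylor q f x0 x = dir_deriv q f (x0 + t *\<^sub>R d) d / fact q"
    unfolding eq taylor_def d_def[symmetric] by (simp add: divide_inverse mult.commute)
  also have "\<bar>\<dots>\<bar> \<le> \<bar>dir_deriv q f (x0 + t *\<^sub>R d) d\<bar>"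
    using mult_left_mono[OF fact_ge_1[of q], of "\<bar>dir_deriv q f (x0 + t *\<^sub>R d) d\<bar>"]
    by (simp add: divide_le_eq)
  also have "\<dots> \<le> (2 * norm d) ^ q * b"
    using t by (intro dir_deriv_bound[OF f(2)] S) auto
  finally show ?thesis
    by (simp add: d_def)
qed

text \<open>Per order: two directions, a coordinate factor bounded by \<open>R\<close>, and
  \<open>2 ^ m\<close> for the product. The derivatives of f at \<open>x0\<close> enter as
  constants, so only their size at that point matters.\<close>

lemma smooth_bounded_dir_deriv:
  assumes "1 \<le> R" "\<And>x. x \<in> S \<Longrightarrow> norm (x - x0) \<le> R" "0 \<le> b"
  shows "Ck_bounded s {x0} b f \<Longrightarrow>
    smooth_bounded m S ((2 * 2 ^ m * R) ^ s * b) (\<lambda>x. dir_deriv s f x0 (x - x0))"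
proof (induction s arbitrary: f)
  case 0
  then show ?case
    by (auto intro: smooth_bounded_const)
next
  case (Suc s)
  have "smooth_bounded m S R (\<lambda>x. x $ i - x0 $ i)" for i
    using assms(1,2) component_le_norm_cart[of _ i]
    by (intro smooth_bounded_coord) (auto simp: vector_minus_component[symmetric] intro: order_trans
        simp del: vector_minus_component)
  moreover have "smooth_bounded m S ((2 * 2 ^ m * R) ^ s * b) (\<lambda>x. dir_deriv s (partial i f) x0 (x - x0))" for i
    using Suc by simp
  ultimately have "smooth_bounded m S (\<Sum>i\<in>(UNIV::2 set). 2 ^ m * (R * ((2 * 2 ^ m * R) ^ s * b)))
      (\<lambda>x. \<Sum>i\<in>UNIV. (x $ i - x0 $ i) * dir_deriv s (partial i f) x0 (x - x0))"
    using assms(1,3) by (intro smooth_bounded_sum smooth_bounded_mult) auto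
  then show ?case
    by (simp add: mult_ac)
qed

text \<open>The constant precedes the function and the base point, because the expansion will be
  made at every node of every mesh.\<close>

lemma smooth_bounded_taylor:
  assumes "1 \<le> R"
  shows "\<exists>K\<ge>0. \<forall>f x0 b. 0 \<le> b \<longrightarrow> Ck_bounded q {x0} b f \<longrightarrow> (\<forall>x\<in>S. norm (x - x0) \<le> R) \<longrightarrow>
    smooth_bounded m S (K * b) (taylor q f x0)"
proof (intro exI[of _ "\<Sum>s<q. 2 ^ m * (1 * (2 * 2 ^ m * R) ^ s)"] conjI allI impI)
  show "0 \<le> (\<Sum>s<q. 2 ^ m * (1 * (2 * 2 ^ m * R) ^ s))"
    using assms by (intro sum_nonneg) auto
  fix f x0 and b :: real
  assume b: "0 \<le> b" and f: "Ck_bounded q {x0} b f" and R: "\<forall>x\<in>S. norm (x - x0) \<le> R"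
  have "smooth_bounded m S (\<Sum>s<q. 2 ^ m * (1 * ((2 * 2 ^ m * R) ^ s * b)))
      (\<lambda>x. \<Sum>s<q. inverse (fact s) * dir_deriv s f x0 (x - x0))"
    using assms b f R
    by (intro smooth_bounded_sum smooth_bounded_mult smooth_bounded_const smooth_bounded_dir_deriv)
      (auto intro: Ck_bounded_le[of _ q] simp: inverse_le_1_iff fact_ge_1)
  then show "smooth_bounded m S ((\<Sum>s<q. 2 ^ m * (1 * (2 * 2 ^ m * R) ^ s)) * b) (taylor q f x0)"
    by (simp add: taylor_def[abs_def] sum_distrib_right sum_distrib_left mult_ac)
qed

lemma dir_deriv_zero: "dir_deriv s f x 0 = (if s = 0 then f x else 0)"
  by (cases s) auto

lemma differentiable_dir_deriv: "(\<lambda>x. dir_deriv s f x0 (x - x0)) differentiable (at x)"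
proof (induction s arbitrary: f)
  case (Suc s)
  have "(\<lambda>x::real^2. x $ i - x0 $ i) differentiable (at x)" for i
    using Ck_on_open_coord[of 1 UNIV i "x0 $ i"] by simp
  with Suc show ?case
    by (auto intro: differentiable_sum differentiable_mult)
qed simp

text \<open>Expanding about the node itself makes the gradient of the Taylor polynomial exact there.\<close>

lemma partial_taylor:
  assumes "2 \<le> q"
  shows "partial c (taylor q f x0) x0 = partial c f x0"
proof -
  have coord: "(\<lambda>x::real^2. x $ i - a) differentiable (at x)" for i a x
    using Ck_on_open_coord[of 1 UNIV i a] by simp
  \<comment> \<open>Terms of order at least 2 vanish to second order at \<open>x0\<close> and the
    term of order 0 is constant, so only the linear term has a gradient there. It belongs to the sum
    once q >= 2.\<close>
  have step: "partial c (\<lambda>x. dir_deriv s f x0 (x - x0)) x0 = (if s = 1 then partial c f x0 else 0)" for s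
  proof (cases s)
    case (Suc s')
    have "partial c (\<lambda>x. \<Sum>i\<in>UNIV. (x $ i - x0 $ i) * dir_deriv s' (partial i f) x0 (x - x0)) x0 =
        (\<Sum>i\<in>UNIV. (if c = i then 1 else 0) * dir_deriv s' (partial i f) x0 0)"
      by (subst partial_sum)
        (auto intro!: differentiable_mult coord differentiable_dir_deriv sum.cong
          simp: partial_mult[OF coord differentiable_dir_deriv] partial_coord)
    also have "\<dots> = dir_deriv s' (partial c f) x0 0"
      by (simp add: if_distrib[of "\<lambda>a. a * _"] cong: if_cong)
    finally show ?thesis
      using Suc by (auto simp: dir_deriv_zero)
  qed simp
  have "partial c (taylor q f x0) x0 =
      (\<Sum>s<q. partial c (\<lambda>x. inverse (fact s) * dir_deriv s f x0 (x - x0)) x0)"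
    unfolding taylor_def[abs_def] by (rule partial_sum) (auto intro!: differentiable_mult differentiable_dir_deriv)
  also have "\<dots> = (\<Sum>s<q. if s = 1 then partial c f x0 else 0)"
    by (intro sum.cong refl) (auto simp: partial_mult[OF differentiable_const differentiable_dir_deriv] step)
  also have "\<dots> = partial c f x0"
    using assms by simp
  finally show ?thesis .
qed

section \<open>Extrapolation on curved elements\<close>

definition is_poly :: "nat \<Rightarrow> (real^2 \<Rightarrow> real) \<Rightarrow> bool" where
  "is_poly d g \<longleftrightarrow> (\<exists>c. g = poly2 d c)"

lemma poly2_single:
  assumes "i + j \<le> d"
  shows "poly2 d (\<lambda>i' j'. if i' = i \<and> j' = j then a else 0) x = a * (x $ 1) ^ i * (x $ 2) ^ j"
proof -
  have "(\<Sum>j'\<le>d - i'. (if i' = i \<and> j' = j then a else 0) * (x $ 1) ^ i' * (x $ 2) ^ j') =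
      (if i' = i then a * (x $ 1) ^ i * (x $ 2) ^ j else 0)" for i'
  proof (cases "i' = i")
    case True
    have "(\<Sum>j'\<le>d - i'. (if i' = i \<and> j' = j then a else 0) * (x $ 1) ^ i' * (x $ 2) ^ j') =
        (\<Sum>j'\<le>d - i'. if j' = j then a * (x $ 1) ^ i * (x $ 2) ^ j else 0)"
      using True by (intro sum.cong) auto
    with True assms show ?thesis
      by simp
  qed simp
  then show ?thesis
    using assms by (simp add: poly2_def)
qed

lemma is_poly_monomial: "i + j \<le> d \<Longrightarrow> is_poly d (\<lambda>x. a * (x $ 1) ^ i * (x $ 2) ^ j)"
  unfolding is_poly_def by (metis (no_types, lifting) ext poly2_single)

lemma is_poly_add: "is_poly d f \<Longrightarrow> is_poly d g \<Longrightarrow> is_poly d (\<lambda>x. f x + g x)"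
proof -
  assume "is_poly d f" "is_poly d g"
  then obtain c c' where "f = poly2 d c" "g = poly2 d c'"
    by (auto simp: is_poly_def)
  then have "(\<lambda>x. f x + g x) = poly2 d (\<lambda>i j. c i j + c' i j)"
    by (simp add: fun_eq_iff poly2_def sum.distrib algebra_simps)
  then show ?thesis
    by (auto simp: is_poly_def)
qed

lemma is_poly_zero: "is_poly d (\<lambda>x. 0)"
  using is_poly_monomial[of 0 0 d 0] by simp

lemma is_poly_sum: "finite A \<Longrightarrow> (\<And>a. a \<in> A \<Longrightarrow> is_poly d (f a)) \<Longrightarrow> is_poly d (\<lambda>x. \<Sum>a\<in>A. f a x)"
  by (induction A rule: finite_induct) (auto intro: is_poly_zero is_poly_add)

lemma is_poly_mono: "is_poly d f \<Longrightarrow> d \<le> e \<Longrightarrow> is_poly e f"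
proof -
  assume "is_poly d f" "d \<le> e"
  then obtain c where "f = (\<lambda>x. \<Sum>i\<le>d. \<Sum>j\<le>d - i. c i j * (x $ 1) ^ i * (x $ 2) ^ j)"
    by (auto simp: is_poly_def poly2_def[abs_def])
  with \<open>d \<le> e\<close> show ?thesis
    by (auto intro!: is_poly_sum is_poly_monomial)
qed

lemma is_poly_mult: "is_poly d f \<Longrightarrow> is_poly e g \<Longrightarrow> is_poly (d + e) (\<lambda>x. f x * g x)"
proof -
  assume "is_poly d f" "is_poly e g"
  then obtain c c' where fg: "f = poly2 d c" "g = poly2 e c'"
    by (auto simp: is_poly_def)
  have "is_poly (d + e) (\<lambda>x. \<Sum>i\<le>d. \<Sum>i'\<le>e. \<Sum>j\<le>d - i. \<Sum>j'\<le>e - i'.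
      (c i j * c' i' j') * (x $ 1) ^ (i + i') * (x $ 2) ^ (j + j'))"
    by (intro is_poly_sum is_poly_monomial) auto
  also have "(\<lambda>x. \<Sum>i\<le>d. \<Sum>i'\<le>e. \<Sum>j\<le>d - i. \<Sum>j'\<le>e - i'.
      (c i j * c' i' j') * (x $ 1) ^ (i + i') * (x $ 2) ^ (j + j')) = (\<lambda>x. f x * g x)"
    by (simp add: fun_eq_iff fg poly2_def sum_distrib_right sum_distrib_left power_add mult_ac)
  finally show ?thesis .
qed

text \<open>Expansion in \<open>h\<close> of a function on the reference element: the term of order \<open>h\<^sup>a\<close> is a polynomial
  of degree at most \<open>a\<close> as long as \<open>a \<le> q\<close>, and everything else is collected in the term \<open>a = q + 1\<close>.
  The extrapolation matrices reproduce all terms but the last one.\<close>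

definition graded :: "nat \<Rightarrow> real \<Rightarrow> real \<Rightarrow> (real^2) set \<Rightarrow> (real^2 \<Rightarrow> real) \<Rightarrow> bool" where
  "graded q C h T f \<longleftrightarrow> (\<exists>F. (\<forall>a\<le>q. is_poly a (F a)) \<and>
     (\<forall>a\<le>q + 1. \<forall>\<xi>\<in>T. \<bar>F a \<xi>\<bar> \<le> C * h ^ a) \<and> (\<forall>\<xi>\<in>T. f \<xi> = (\<Sum>a\<le>q + 1. F a \<xi>)))"

lemma gradedE:
  assumes "graded q C h T f"
  obtains F where "\<And>a. a \<le> q \<Longrightarrow> is_poly a (F a)"
    "\<And>a \<xi>. a \<le> q + 1 \<Longrightarrow> \<xi> \<in> T \<Longrightarrow> \<bar>F a \<xi>\<bar> \<le> C * h ^ a"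
    "\<And>\<xi>. \<xi> \<in> T \<Longrightarrow> f \<xi> = (\<Sum>a\<le>q + 1. F a \<xi>)"
  using assms unfolding graded_def by blast

lemma graded_mono:
  assumes "graded q C h T f" "C \<le> C'" "0 \<le> h"
  shows "graded q C' h T f"
proof -
  obtain F where F: "\<And>a. a \<le> q \<Longrightarrow> is_poly a (F a)" "\<And>a \<xi>. a \<le> q + 1 \<Longrightarrow> \<xi> \<in> T \<Longrightarrow> \<bar>F a \<xi>\<bar> \<le> C * h ^ a"
      "\<And>\<xi>. \<xi> \<in> T \<Longrightarrow> f \<xi> = (\<Sum>a\<le>q + 1. F a \<xi>)"
    using gradedE[OF assms(1)] by blast
  have "\<bar>F a \<xi>\<bar> \<le> C' * h ^ a" if "a \<le> q + 1" "\<xi> \<in> T" for a \<xi>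
    using F(2)[OF that] mult_right_mono[OF assms(2), of "h ^ a"] assms(3) by simp
  with F(1,3) show ?thesis
    unfolding graded_def by (intro exI[of _ F]) blast
qed

lemma graded_single:
  assumes "a0 \<le> q + 1" "a0 \<le> q \<Longrightarrow> is_poly a0 f" "\<And>\<xi>. \<xi> \<in> T \<Longrightarrow> \<bar>f \<xi>\<bar> \<le> C * h ^ a0" "0 \<le> C" "0 \<le> h"
  shows "graded q C h T f"
  unfolding graded_def
proof (intro exI[of _ "\<lambda>a \<xi>. if a = a0 then f \<xi> else 0"] conjI allI impI ballI)
  fix a
  assume "a \<le> q"
  then show "is_poly a (\<lambda>\<xi>. if a = a0 then f \<xi> else 0)"
    using assms(2) by (cases "a = a0") (auto intro: is_poly_zero)
qed (use assms in auto)

lemma graded_error: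
  "(\<And>\<xi>. \<xi> \<in> T \<Longrightarrow> \<bar>f \<xi>\<bar> \<le> C * h ^ (q + 1)) \<Longrightarrow> 0 \<le> C \<Longrightarrow> 0 \<le> h \<Longrightarrow> graded q C h T f"
  by (rule graded_single[of "q + 1"]) auto

lemma graded_monomial:
  assumes h: "0 \<le> h" "h \<le> 1" and a: "\<bar>a\<bar> \<le> C * h ^ (i + j)" and "0 \<le> C"
    and T: "\<And>\<xi> c. \<xi> \<in> T \<Longrightarrow> \<bar>\<xi> $ c\<bar> \<le> 1"
  shows "graded q C h T (\<lambda>\<xi>. a * (\<xi> $ 1) ^ i * (\<xi> $ 2) ^ j)"
\<comment> \<open>Monomials of degree above q are moved into the remainder slot q + 1, which only
  weakens the bound because h <= 1.\<close>
proof (rule graded_single[of "min (i + j) (q + 1)"])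
  fix \<xi>
  assume "\<xi> \<in> T"
  then have "\<bar>\<xi> $ 1\<bar> ^ i \<le> 1" "\<bar>\<xi> $ 2\<bar> ^ j \<le> 1"
    using T by (auto intro: power_le_one)
  then have "\<bar>a * (\<xi> $ 1) ^ i * (\<xi> $ 2) ^ j\<bar> \<le> \<bar>a\<bar> * 1 * 1"
    by (simp only: abs_mult power_abs) (intro mult_mono; simp)
  also have "\<dots> \<le> C * h ^ (i + j)"
    using a by simp
  also have "\<dots> \<le> C * h ^ min (i + j) (q + 1)"
    using h \<open>0 \<le> C\<close> by (intro mult_left_mono power_decreasing) auto
  finally show "\<bar>a * (\<xi> $ 1) ^ i * (\<xi> $ 2) ^ j\<bar> \<le> C * h ^ min (i + j) (q + 1)" .
qed (use assms in \<open>auto intro!: is_poly_monomial\<close>)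

lemma graded_const:
  assumes "\<bar>c\<bar> \<le> C" "0 \<le> h"
  shows "graded q C h T (\<lambda>\<xi>. c)"
  by (rule graded_single[of 0]) (use assms is_poly_monomial[of 0 0 0 c] in auto)

lemma graded_add:
  assumes "graded q C h T f" "graded q C' h T g"
  shows "graded q (C + C') h T (\<lambda>\<xi>. f \<xi> + g \<xi>)"
proof -
  obtain F where F: "\<And>a. a \<le> q \<Longrightarrow> is_poly a (F a)" "\<And>a \<xi>. a \<le> q + 1 \<Longrightarrow> \<xi> \<in> T \<Longrightarrow> \<bar>F a \<xi>\<bar> \<le> C * h ^ a"
      "\<And>\<xi>. \<xi> \<in> T \<Longrightarrow> f \<xi> = (\<Sum>a\<le>q + 1. F a \<xi>)"
    using gradedE[OF assms(1)] by blast
  obtain G where G: "\<And>a. a \<le> q \<Longrightarrow> is_poly a (G a)" "\<And>a \<xi>. a \<le> q + 1 \<Longrightarrow> \<xi> \<in> T \<Longrightarrow> \<bar>G a \<xi>\<bar> \<le> C' * h ^ a"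
      "\<And>\<xi>. \<xi> \<in> T \<Longrightarrow> g \<xi> = (\<Sum>a\<le>q + 1. G a \<xi>)"
    using gradedE[OF assms(2)] by blast
  have "\<bar>F a \<xi> + G a \<xi>\<bar> \<le> (C + C') * h ^ a" if "a \<le> q + 1" "\<xi> \<in> T" for a \<xi>
    using F(2)[OF that] G(2)[OF that] by (simp add: algebra_simps)
  then show ?thesis
    unfolding graded_def
    by (intro exI[of _ "\<lambda>a \<xi>. F a \<xi> + G a \<xi>"] conjI allI impI ballI is_poly_add F(1) G(1))
      (auto simp: F(3) G(3) sum.distrib)
qed

lemma graded_sum:
  assumes "finite A" "0 \<le> h" "\<And>a. a \<in> A \<Longrightarrow> graded q (C a) h T (f a)"
  shows "graded q (\<Sum>a\<in>A. C a) h T (\<lambda>\<xi>. \<Sum>a\<in>A. f a \<xi>)"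
  using assms(1,3)
  by (induction A rule: finite_induct) (auto intro: graded_const graded_add assms(2))

text \<open>Cauchy product: terms with a + b = s <= q form a polynomial of degree s, and all other
  pairs go into the remainder. The constant counts all \<open>(q + 2)^2\<close> pairs of
  indices.\<close>

lemma graded_mult:
  assumes h: "0 \<le> h" "h \<le> 1" and C: "0 \<le> C" "0 \<le> C'"
    and f: "graded q C h T f" and g: "graded q C' h T g"
  shows "graded q ((real q + 2)\<^sup>2 * (C * C')) h T (\<lambda>\<xi>. f \<xi> * g \<xi>)"
proof -
  obtain F where F: "\<And>a. a \<le> q \<Longrightarrow> is_poly a (F a)" "\<And>a \<xi>. a \<le> q + 1 \<Longrightarrow> \<xi> \<in> T \<Longrightarrow> \<bar>F a \<xi>\<bar> \<le> C * h ^ a"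
      "\<And>\<xi>. \<xi> \<in> T \<Longrightarrow> f \<xi> = (\<Sum>a\<le>q + 1. F a \<xi>)"
    using gradedE[OF f] by blast
  obtain G where G: "\<And>a. a \<le> q \<Longrightarrow> is_poly a (G a)" "\<And>a \<xi>. a \<le> q + 1 \<Longrightarrow> \<xi> \<in> T \<Longrightarrow> \<bar>G a \<xi>\<bar> \<le> C' * h ^ a"
      "\<And>\<xi>. \<xi> \<in> T \<Longrightarrow> g \<xi> = (\<Sum>a\<le>q + 1. G a \<xi>)"
    using gradedE[OF g] by blast
  define low where "low s \<xi> = (\<Sum>a\<le>s. F a \<xi> * G (s - a) \<xi>)" for s \<xi>
  define P where "P s \<xi> = (if s \<le> q then low s \<xi> else f \<xi> * g \<xi> - (\<Sum>s\<le>q. low s \<xi>))" for s \<xi>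
  have FG: "\<bar>F a \<xi> * G b \<xi>\<bar> \<le> C * C' * h ^ (a + b)" if "a \<le> q + 1" "b \<le> q + 1" "\<xi> \<in> T" for a b \<xi>
  proof -
    have "\<bar>F a \<xi> * G b \<xi>\<bar> \<le> (C * h ^ a) * (C' * h ^ b)"
      unfolding abs_mult using that F(2) G(2) C h by (intro mult_mono) auto
    then show ?thesis
      by (simp add: power_add mult_ac)
  qed
  have poly: "is_poly s (P s)" if "s \<le> q" for s
  proof -
    have "is_poly (a + (s - a)) (\<lambda>\<xi>. F a \<xi> * G (s - a) \<xi>)" if "a \<le> s" for a
      using that \<open>s \<le> q\<close> by (intro is_poly_mult F(1) G(1)) auto
    then have "is_poly s (\<lambda>\<xi>. \<Sum>a\<le>s. F a \<xi> * G (s - a) \<xi>)"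
      by (intro is_poly_sum) auto
    with that show ?thesis
      by (simp add: P_def[abs_def] low_def)
  qed
  have bound: "\<bar>P s \<xi>\<bar> \<le> (real q + 2)\<^sup>2 * (C * C') * h ^ s" if s: "s \<le> q + 1" and \<xi>: "\<xi> \<in> T" for s \<xi>
  proof (cases "s \<le> q")
    case True
    have "\<bar>F a \<xi> * G (s - a) \<xi>\<bar> \<le> C * C' * h ^ s" if "a \<le> s" for a
      using FG[of a "s - a" \<xi>] True that \<xi> by simp
    then have "\<bar>low s \<xi>\<bar> \<le> (\<Sum>a\<le>s. C * C' * h ^ s)"
      unfolding low_def by (intro order_trans[OF sum_abs] sum_mono) simp
    also have "\<dots> = (real s + 1) * (C * C' * h ^ s)"
      by simp
    also have "\<dots> \<le> (real q + 2)\<^sup>2 * (C * C' * h ^ s)"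
    proof (intro mult_right_mono)
      have "real s + 1 \<le> (real q + 2) * 1"
        using True by simp
      also have "\<dots> \<le> (real q + 2) * (real q + 2)"
        by (intro mult_left_mono) auto
      finally show "real s + 1 \<le> (real q + 2)\<^sup>2"
        by (simp add: power2_eq_square)
    qed (use C h in auto)
    finally show ?thesis
      using True by (simp add: P_def mult_ac)
  next
    case False
    then have s: "s = q + 1"
      using s by simp
    define A where "A = {..q + 1} \<times> {..q + 1}"
    define B where "B = {(a, b). a + b \<le> q}"
    have BA: "B \<subseteq> A" "finite A"
      by (auto simp: A_def B_def)
    have "f \<xi> * g \<xi> = (\<Sum>(a, b)\<in>A. F a \<xi> * G b \<xi>)"
      unfolding F(3)[OF \<xi>] G(3)[OF \<xi>] A_def by (simp only: sum_product sum.cartesian_product)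
    moreover have "(\<Sum>s\<le>q. low s \<xi>) = (\<Sum>(a, b)\<in>B. F a \<xi> * G b \<xi>)"
      unfolding low_def B_def by (rule sum.triangle_reindex_eq[symmetric])
    ultimately have "P s \<xi> = (\<Sum>(a, b)\<in>A - B. F a \<xi> * G b \<xi>)"
      using BA by (simp add: P_def s sum_diff)
    \<comment> \<open>Outside the triangle a + b >= q + 1, and h <= 1 reduces each such power of h
      to the exponent q + 1.\<close>
    also have "\<bar>\<dots>\<bar> \<le> (\<Sum>x\<in>A - B. C * C' * h ^ (q + 1))"
    proof (rule order_trans[OF sum_abs], rule sum_mono)
      fix x
      assume x: "x \<in> A - B"
      obtain a b where [simp]: "x = (a, b)"
        by fastforce
      have "\<bar>F a \<xi> * G b \<xi>\<bar> \<le> C * C' * h ^ (a + b)"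
        using x \<xi> by (intro FG) (auto simp: A_def)
      also have "\<dots> \<le> C * C' * h ^ (q + 1)"
        using x C h by (intro mult_left_mono power_decreasing) (auto simp: A_def B_def)
      finally show "\<bar>case x of (a, b) \<Rightarrow> F a \<xi> * G b \<xi>\<bar> \<le> C * C' * h ^ (q + 1)"
        by simp
    qed
    also have "\<dots> = real (card (A - B)) * (C * C' * h ^ (q + 1))"
      by simp
    also have "\<dots> \<le> real (card A) * (C * C' * h ^ (q + 1))"
      using C h BA by (intro mult_right_mono) (auto intro: card_mono)
    also have "real (card A) = (real q + 2)\<^sup>2"
      by (simp add: A_def card_cartesian_product power2_eq_square algebra_simps)
    finally show ?thesis
      by (simp add: s mult_ac)
  qed
  have "f \<xi> * g \<xi> = (\<Sum>s\<le>q + 1. P s \<xi>)" if "\<xi> \<in> T" for \<xi>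
    by (simp add: P_def)
  then show ?thesis
    unfolding graded_def using poly bound by blast
qed

text \<open>The constant coefficient is the position of the element in the plane and does not shrink
  with h, so it is subtracted. There are at most \<open>(d + 1)^2\<close> further
  coefficients.\<close>

lemma graded_poly2:
  assumes h: "0 \<le> h" "h \<le> 1" and "0 \<le> C"
    and c: "\<And>i j. 1 \<le> i + j \<Longrightarrow> i + j \<le> d \<Longrightarrow> \<bar>c i j\<bar> \<le> C * h ^ (i + j)"
    and T: "\<And>\<xi> c. \<xi> \<in> T \<Longrightarrow> \<bar>\<xi> $ c\<bar> \<le> 1"
  shows "graded q ((real d + 1)\<^sup>2 * C) h T (\<lambda>\<xi>. poly2 d c \<xi> - c 0 0)"
proof -
  define c' where "c' i j = (if i = 0 \<and> j = 0 then 0 else c i j)" for i j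
  have "poly2 d c \<xi> = poly2 d c' \<xi> + poly2 d (\<lambda>i j. if i = 0 \<and> j = 0 then c 0 0 else 0) \<xi>" for \<xi>
    unfolding poly2_def sum.distrib[symmetric] by (intro sum.cong refl) (auto simp: c'_def)
  then have "poly2 d c \<xi> - c 0 0 = poly2 d c' \<xi>" for \<xi>
    by (simp add: poly2_single[of 0 0 d "c 0 0"])
  moreover have "graded q (\<Sum>i\<le>d. \<Sum>j\<le>d - i. C) h T (poly2 d c')"
    unfolding poly2_def[abs_def]
    by (intro graded_sum graded_monomial) (use assms in \<open>auto simp: c'_def\<close>)
  moreover have "(\<Sum>i\<le>d. \<Sum>j\<le>d - i. C) \<le> (real d + 1)\<^sup>2 * C"
  proof -
    have "(\<Sum>i\<le>d. \<Sum>j\<le>d - i. C) \<le> (\<Sum>i\<le>d. (real d + 1) * C)"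
      using \<open>0 \<le> C\<close> by (intro sum_mono) (auto intro!: mult_right_mono)
    then show ?thesis
      by (simp add: power2_eq_square algebra_simps)
  qed
  ultimately show ?thesis
    using graded_mono h by simp
qed

text \<open>Each order multiplies by one component of the displacement \<open>E \<xi> - x0\<close>,
  which is graded; the product rule for graded functions and the two directions give the base of the
  power.\<close>

lemma graded_dir_deriv:
  assumes h: "0 \<le> h" "h \<le> 1" and C: "0 \<le> C" and b: "0 \<le> b"
    and E: "\<And>c. graded q C h T (\<lambda>\<xi>. (E \<xi> - x0) $ c)"
  shows "Ck_bounded s {x0} b f \<Longrightarrow>
    graded q ((2 * ((real q + 2)\<^sup>2 * C)) ^ s * b) h T (\<lambda>\<xi>. dir_deriv s f x0 (E \<xi> - x0))"
proof (induction s arbitrary: f)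
  case 0
  then show ?case
    using h by (auto intro: graded_const)
next
  case (Suc s)
  have "graded q (\<Sum>i\<in>(UNIV::2 set). (real q + 2)\<^sup>2 * (C * ((2 * ((real q + 2)\<^sup>2 * C)) ^ s * b))) h T
      (\<lambda>\<xi>. \<Sum>i\<in>UNIV. (E \<xi> - x0) $ i * dir_deriv s (partial i f) x0 (E \<xi> - x0))"
    using h C b Suc by (intro graded_sum graded_mult E Suc.IH) auto
  then show ?case
    by (simp add: mult_ac)
qed

text \<open>The Taylor polynomial of f is composed with the graded map by sums and products. Its
  remainder is O(h^(q+1)) since \<open>E\<close> stays within h of \<open>x0\<close>, and it goes
  into the last slot. \<open>K\<close> depends only on q and C, so it serves all elements and
  functions.\<close>

lemma graded_compose:
  fixes q :: nat and C :: real
  assumes C: "0 \<le> C"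
  obtains K where "0 \<le> K"
    and "\<And>h T E x0 V S b f. \<lbrakk>0 \<le> h; h \<le> 1; \<And>c. graded q C h T (\<lambda>\<xi>. (E \<xi> - x0) $ c); open V; S \<subseteq> V;
      Ck_on_open (q + 1) V f; Ck_bounded (q + 1) S b f; 0 \<le> b; x0 \<in> S;
      \<And>\<xi>. \<xi> \<in> T \<Longrightarrow> closed_segment x0 (E \<xi>) \<subseteq> S \<and> norm (E \<xi> - x0) \<le> h\<rbrakk>
      \<Longrightarrow> graded q (K * b) h T (\<lambda>\<xi>. f (E \<xi>))"
proof
  let ?L = "2 * ((real q + 2)\<^sup>2 * C)"
  define K where "K = (\<Sum>s<q + 1. (real q + 2)\<^sup>2 * (1 * ?L ^ s)) + 2 ^ (q + 1)"
  show "0 \<le> K"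
    unfolding K_def using C by (intro add_nonneg_nonneg sum_nonneg) auto
  fix h T E x0 V S and b :: real and f
  assume h: "0 \<le> h" "h \<le> 1" and E: "\<And>c. graded q C h T (\<lambda>\<xi>. (E \<xi> - x0) $ c)"
    and V: "open V" "S \<subseteq> V" and f: "Ck_on_open (q + 1) V f" "Ck_bounded (q + 1) S b f"
    and b: "0 \<le> b" and x0: "x0 \<in> S"
    and seg: "\<And>\<xi>. \<xi> \<in> T \<Longrightarrow> closed_segment x0 (E \<xi>) \<subseteq> S \<and> norm (E \<xi> - x0) \<le> h"
  have bd: "Ck_bounded s {x0} b f" if "s < q + 1" for s
    using Ck_bounded_le[OF _ Ck_bounded_subset[OF f(2)], of s "{x0}"] x0 that by auto
  have "graded q (\<Sum>s<q + 1. (real q + 2)\<^sup>2 * (1 * (?L ^ s * b))) h T (\<lambda>\<xi>. taylor (q + 1) f x0 (E \<xi>))"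
    unfolding taylor_def using h C b bd
    by (intro graded_sum graded_mult graded_const graded_dir_deriv E)
      (auto simp: inverse_le_1_iff fact_ge_1)
  moreover have "graded q (2 ^ (q + 1) * b) h T (\<lambda>\<xi>. f (E \<xi>) - taylor (q + 1) f x0 (E \<xi>))"
  proof (rule graded_error)
    fix \<xi>
    assume "\<xi> \<in> T"
    note s = seg[OF this]
    have "\<bar>f (E \<xi>) - taylor (q + 1) f x0 (E \<xi>)\<bar> \<le> (2 * norm (E \<xi> - x0)) ^ (q + 1) * b"
      using s by (intro taylor_error[OF V f]) auto
    also have "\<dots> \<le> (2 * h) ^ (q + 1) * b"
      using s b by (intro mult_right_mono power_mono) auto
    finally show "\<bar>f (E \<xi>) - taylor (q + 1) f x0 (E \<xi>)\<bar> \<le> 2 ^ (q + 1) * b * h ^ (q + 1)"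
      by (simp add: power_mult_distrib mult_ac)
  qed (use b h in auto)
  ultimately have "graded q ((\<Sum>s<q + 1. (real q + 2)\<^sup>2 * (1 * (?L ^ s * b))) + 2 ^ (q + 1) * b) h T
      (\<lambda>\<xi>. taylor (q + 1) f x0 (E \<xi>) + (f (E \<xi>) - taylor (q + 1) f x0 (E \<xi>)))"
    by (rule graded_add)
  moreover have "(\<Sum>s<q + 1. (real q + 2)\<^sup>2 * (1 * (?L ^ s * b))) + 2 ^ (q + 1) * b = K * b"
    by (simp only: K_def sum_distrib_right distrib_right mult.assoc)
  ultimately show "graded q (K * b) h T (\<lambda>\<xi>. f (E \<xi>))"
    by simp
qed

lemma matrix_vector_entry_bound:
  fixes A :: "real^'n^'m" and a b :: real
  assumes "\<And>j. \<bar>A $ i $ j\<bar> \<le> a" "\<And>j. \<bar>x $ j\<bar> \<le> b" "0 \<le> a"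
  shows "\<bar>(A *v x) $ i\<bar> \<le> CARD('n) * (a * b)"
proof -
  have "\<bar>(A *v x) $ i\<bar> \<le> (\<Sum>j\<in>UNIV. \<bar>A $ i $ j * x $ j\<bar>)"
    by (simp add: matrix_vector_mult_def sum_abs)
  also have "\<dots> \<le> (\<Sum>j\<in>(UNIV::'n set). a * b)"
    using assms by (intro sum_mono) (auto simp: abs_mult intro!: mult_mono)
  finally show ?thesis
    by simp
qed

text \<open>The terms up to order q are polynomials of degree at most p and are reproduced exactly.
  What is left is the last term, once extrapolated through a row of \<open>R\<close> and once
  evaluated at the facet node.\<close>

lemma extrapolation_error:
  fixes R :: "real^'np^'nf" and CR C h :: real
  assumes f: "graded q C h T f" and "q \<le> p" and CR: "\<And>i j. \<bar>R $ i $ j\<bar> \<le> CR" "0 \<le> CR"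
    and exact: "\<And>c. R *v (\<chi> j. poly2 p c (x j)) = (\<chi> i. poly2 p c (y i))"
    and T: "\<And>j. x j \<in> T" "\<And>i. y i \<in> T"
  shows "\<bar>(R *v (\<chi> j. f (x j))) $ i - f (y i)\<bar> \<le> (CARD('np) * CR + 1) * C * h ^ (q + 1)"
proof -
  obtain F where F: "\<And>a. a \<le> q \<Longrightarrow> is_poly a (F a)" "\<And>a \<xi>. a \<le> q + 1 \<Longrightarrow> \<xi> \<in> T \<Longrightarrow> \<bar>F a \<xi>\<bar> \<le> C * h ^ a"
      "\<And>\<xi>. \<xi> \<in> T \<Longrightarrow> f \<xi> = (\<Sum>a\<le>q + 1. F a \<xi>)"
    using gradedE[OF f] by blast
  have ex: "(R *v (\<chi> j. F a (x j))) $ i = F a (y i)" if "a \<le> q" for a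
  proof -
    have "is_poly p (F a)"
      using F(1)[OF that] that \<open>q \<le> p\<close> by (auto intro: is_poly_mono)
    then obtain c where "F a = poly2 p c"
      by (auto simp: is_poly_def)
    then show ?thesis
      using arg_cong[OF exact[of c], of "\<lambda>v. v $ i"] by simp
  qed
  have "(\<chi> j. f (x j)) = (\<Sum>a\<le>q + 1. \<chi> j. F a (x j))"
    unfolding vec_eq_iff sum_component vec_lambda_beta using F(3) T(1) by blast
  then have "(R *v (\<chi> j. f (x j))) $ i = (\<Sum>a\<le>q + 1. (R *v (\<chi> j. F a (x j))) $ i)"
    by (simp only: linear_sum[OF matrix_vector_mul_linear] sum_component)
  also have "\<dots> = (\<Sum>a\<le>q. F a (y i)) + (R *v (\<chi> j. F (q + 1) (x j))) $ i"
    using ex by simp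
  finally have "(R *v (\<chi> j. f (x j))) $ i - f (y i) = (R *v (\<chi> j. F (q + 1) (x j))) $ i - F (q + 1) (y i)"
    using F(3)[OF T(2)] by simp
  moreover have "\<bar>(R *v (\<chi> j. F (q + 1) (x j))) $ i\<bar> \<le> CARD('np) * (CR * (C * h ^ (q + 1)))"
    using CR F(2)[of "q + 1"] T by (intro matrix_vector_entry_bound) auto
  moreover have "\<bar>F (q + 1) (y i)\<bar> \<le> C * h ^ (q + 1)"
    using F(2)[of "q + 1"] T by auto
  ultimately have "\<bar>(R *v (\<chi> j. f (x j))) $ i - f (y i)\<bar> \<le>
      CARD('np) * (CR * (C * h ^ (q + 1))) + C * h ^ (q + 1)"
    by linarith
  then show ?thesis
    by (simp add: algebra_simps)
qed

section \<open>Scaling in the mesh size\<close>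

text \<open>\<open>g = O(h\<^sup>e)\<close> with \<open>h = H n\<close>; the arguments of \<open>g\<close> are the mesh in the family, the element and the facet.\<close>

definition scaled_bound ::
  "(nat \<Rightarrow> real) \<Rightarrow> (nat \<Rightarrow> nat \<Rightarrow> nat \<Rightarrow> bool) \<Rightarrow> int \<Rightarrow> (nat \<Rightarrow> nat \<Rightarrow> nat \<Rightarrow> 'b::real_normed_vector) \<Rightarrow> bool"
  where "scaled_bound H P e g \<longleftrightarrow> (\<exists>K\<ge>0. \<forall>n k \<gamma>. 0 < H n \<longrightarrow> H n \<le> 1 \<longrightarrow> P n k \<gamma> \<longrightarrow>
    norm (g n k \<gamma>) \<le> K * (H n powi e))"

lemma scaled_boundI:
  assumes "0 \<le> K" "\<And>n k \<gamma>. 0 < H n \<Longrightarrow> H n \<le> 1 \<Longrightarrow> P n k \<gamma> \<Longrightarrow> norm (g n k \<gamma>) \<le> K * (H n powi e)"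
  shows "scaled_bound H P e g"
  using assms unfolding scaled_bound_def by blast

lemma scaled_boundE:
  assumes "scaled_bound H P e g"
  obtains K where "0 \<le> K"
    "\<And>n k \<gamma>. 0 < H n \<Longrightarrow> H n \<le> 1 \<Longrightarrow> P n k \<gamma> \<Longrightarrow> norm (g n k \<gamma>) \<le> K * (H n powi e)"
  using assms unfolding scaled_bound_def by blast

lemma scaled_bound_linear:
  assumes "bounded_linear F" "scaled_bound H P e g"
  shows "scaled_bound H P e (\<lambda>n k \<gamma>. F (g n k \<gamma>))"
proof -
  obtain L where L: "\<And>x. norm (F x) \<le> norm x * L" "0 \<le> L"
    using bounded_linear.nonneg_bounded[OF assms(1)] by blast
  obtain K where K: "0 \<le> K"
    "\<And>n k \<gamma>. 0 < H n \<Longrightarrow> H n \<le> 1 \<Longrightarrow> P n k \<gamma> \<Longrightarrow> norm (g n k \<gamma>) \<le> K * (H n powi e)"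
    by (rule scaled_boundE[OF assms(2)]) blast
  show ?thesis
  proof (rule scaled_boundI[of "K * L"])
    fix n k \<gamma>
    assume "0 < H n" "H n \<le> 1" "P n k \<gamma>"
    from mult_right_mono[OF K(2)[OF this] L(2)] L(1)[of "g n k \<gamma>"]
    show "norm (F (g n k \<gamma>)) \<le> K * L * (H n powi e)"
      by (simp add: mult_ac)
  qed (use K L in simp)
qed

text \<open>Exponents are integers because inverse norms and derivative matrices carry negative
  powers. Their sum is a separate premise, so that the rule matches any goal and leaves the
  exponents to arithmetic.\<close>

lemma scaled_bound_bilinear:
  assumes "bounded_bilinear B" "scaled_bound H P e1 f" "scaled_bound H P e2 g" "e = e1 + e2"
  shows "scaled_bound H P e (\<lambda>n k \<gamma>. B (f n k \<gamma>) (g n k \<gamma>))"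
proof -
  obtain L where L: "\<And>x y. norm (B x y) \<le> norm x * norm y * L" "0 \<le> L"
    using bounded_bilinear.nonneg_bounded[OF assms(1)] by blast
  obtain K1 where K1: "0 \<le> K1"
    "\<And>n k \<gamma>. 0 < H n \<Longrightarrow> H n \<le> 1 \<Longrightarrow> P n k \<gamma> \<Longrightarrow> norm (f n k \<gamma>) \<le> K1 * (H n powi e1)"
    by (rule scaled_boundE[OF assms(2)]) blast
  obtain K2 where K2: "0 \<le> K2"
    "\<And>n k \<gamma>. 0 < H n \<Longrightarrow> H n \<le> 1 \<Longrightarrow> P n k \<gamma> \<Longrightarrow> norm (g n k \<gamma>) \<le> K2 * (H n powi e2)"
    by (rule scaled_boundE[OF assms(3)]) blast
  show ?thesis
  proof (rule scaled_boundI[of "K1 * K2 * L"])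
    fix n k \<gamma>
    assume *: "0 < H n" "H n \<le> 1" "P n k \<gamma>"
    have "norm (B (f n k \<gamma>) (g n k \<gamma>)) \<le> norm (f n k \<gamma>) * norm (g n k \<gamma>) * L"
      by (rule L)
    also have "\<dots> \<le> (K1 * (H n powi e1)) * (K2 * (H n powi e2)) * L"
      using K1(1) K2(1) L(2) *(1) by (intro mult_right_mono mult_mono K1(2)[OF *] K2(2)[OF *]) auto
    also have "\<dots> = K1 * K2 * L * (H n powi e)"
      using *(1) by (simp add: assms(4) power_int_add mult_ac)
    finally show "norm (B (f n k \<gamma>) (g n k \<gamma>)) \<le> K1 * K2 * L * (H n powi e)" .
  qed (use K1 K2 L in simp)
qed

lemma scaled_bound_add:
  assumes "scaled_bound H P e f" "scaled_bound H P e g"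
  shows "scaled_bound H P e (\<lambda>n k \<gamma>. f n k \<gamma> + g n k \<gamma>)"
proof -
  obtain K1 where K1: "0 \<le> K1"
    "\<And>n k \<gamma>. 0 < H n \<Longrightarrow> H n \<le> 1 \<Longrightarrow> P n k \<gamma> \<Longrightarrow> norm (f n k \<gamma>) \<le> K1 * (H n powi e)"
    by (rule scaled_boundE[OF assms(1)]) blast
  obtain K2 where K2: "0 \<le> K2"
    "\<And>n k \<gamma>. 0 < H n \<Longrightarrow> H n \<le> 1 \<Longrightarrow> P n k \<gamma> \<Longrightarrow> norm (g n k \<gamma>) \<le> K2 * (H n powi e)"
    by (rule scaled_boundE[OF assms(2)]) blast
  show ?thesis
  proof (rule scaled_boundI[of "K1 + K2"])
    fix n k \<gamma>
    assume *: "0 < H n" "H n \<le> 1" "P n k \<gamma>"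
    show "norm (f n k \<gamma> + g n k \<gamma>) \<le> (K1 + K2) * (H n powi e)"
      unfolding distrib_right by (rule order_trans[OF norm_triangle_ineq add_mono[OF K1(2)[OF *] K2(2)[OF *]]])
  qed (use K1 K2 in simp)
qed

lemma scaled_bound_minus:
  "scaled_bound H P e g \<Longrightarrow> scaled_bound H P e (\<lambda>n k \<gamma>. - g n k \<gamma>)"
  by (simp add: scaled_bound_def)

lemma scaled_bound_diff:
  "scaled_bound H P e f \<Longrightarrow> scaled_bound H P e g \<Longrightarrow> scaled_bound H P e (\<lambda>n k \<gamma>. f n k \<gamma> - g n k \<gamma>)"
  using scaled_bound_add[OF _ scaled_bound_minus, of H P e f g] by simp

lemma scaled_bound_zero: "scaled_bound H P e (\<lambda>n k \<gamma>. 0)"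
  by (rule scaled_boundI[of 0]) auto

lemma scaled_bound_sum:
  assumes "finite A" "\<And>a. a \<in> A \<Longrightarrow> scaled_bound H P e (f a)"
  shows "scaled_bound H P e (\<lambda>n k \<gamma>. \<Sum>a\<in>A. f a n k \<gamma>)"
  using assms
  by (induction A rule: finite_induct) (auto intro: scaled_bound_zero scaled_bound_add)

lemma scaled_bound_cong:
  assumes "scaled_bound H P e f" "\<And>n k \<gamma>. P n k \<gamma> \<Longrightarrow> f n k \<gamma> = g n k \<gamma>"
  shows "scaled_bound H P e g"
  using assms unfolding scaled_bound_def by auto

lemma scaled_bound_subset:
  assumes "scaled_bound H P e f" "\<And>n k \<gamma>. Q n k \<gamma> \<Longrightarrow> P n k \<gamma>"
  shows "scaled_bound H Q e f"
  using assms unfolding scaled_bound_def by blast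

lemma scaled_bound_nbr:
  assumes "scaled_bound H P e f" "\<And>n k \<gamma>. Q n k \<gamma> \<Longrightarrow> P n (v n k \<gamma>) \<gamma>"
  shows "scaled_bound H Q e (\<lambda>n k \<gamma>. f n (v n k \<gamma>) \<gamma>)"
  using assms unfolding scaled_bound_def by blast

lemma scaled_bound_vec:
  fixes g :: "nat \<Rightarrow> nat \<Rightarrow> nat \<Rightarrow> real^'m"
  assumes "0 \<le> K" "\<And>n k \<gamma> i. 0 < H n \<Longrightarrow> H n \<le> 1 \<Longrightarrow> P n k \<gamma> \<Longrightarrow> \<bar>g n k \<gamma> $ i\<bar> \<le> K * (H n powi e)"
  shows "scaled_bound H P e g"
proof (rule scaled_boundI[of "CARD('m) * K"])
  fix n k \<gamma>
  assume *: "0 < H n" "H n \<le> 1" "P n k \<gamma>"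
  have "norm (g n k \<gamma>) \<le> (\<Sum>i\<in>UNIV. \<bar>g n k \<gamma> $ i\<bar>)"
    by (rule norm_le_l1_cart)
  also have "\<dots> \<le> (\<Sum>i\<in>(UNIV::'m set). K * (H n powi e))"
    by (intro sum_mono assms(2)[OF *])
  finally show "norm (g n k \<gamma>) \<le> CARD('m) * K * (H n powi e)"
    by simp
qed (use assms(1) in simp)

lemma norm_le_l1_matrix: "norm (A :: real^'n^'m) \<le> (\<Sum>i\<in>UNIV. \<Sum>j\<in>UNIV. \<bar>A $ i $ j\<bar>)"
proof -
  have "norm A \<le> (\<Sum>i\<in>UNIV. norm (A $ i))"
    unfolding norm_vec_def by (rule L2_set_le_sum) auto
  also have "\<dots> \<le> (\<Sum>i\<in>UNIV. \<Sum>j\<in>UNIV. \<bar>A $ i $ j\<bar>)"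
    by (intro sum_mono norm_le_l1_cart)
  finally show ?thesis .
qed

lemma scaled_bound_matrix:
  fixes g :: "nat \<Rightarrow> nat \<Rightarrow> nat \<Rightarrow> real^'n^'m"
  assumes "0 \<le> K"
    "\<And>n k \<gamma> i j. 0 < H n \<Longrightarrow> H n \<le> 1 \<Longrightarrow> P n k \<gamma> \<Longrightarrow> \<bar>g n k \<gamma> $ i $ j\<bar> \<le> K * (H n powi e)"
  shows "scaled_bound H P e g"
proof (rule scaled_boundI[of "CARD('m) * (CARD('n) * K)"])
  fix n k \<gamma>
  assume *: "0 < H n" "H n \<le> 1" "P n k \<gamma>"
  have "norm (g n k \<gamma>) \<le> (\<Sum>i\<in>UNIV. \<Sum>j\<in>UNIV. \<bar>g n k \<gamma> $ i $ j\<bar>)"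
    by (rule norm_le_l1_matrix)
  also have "\<dots> \<le> (\<Sum>i\<in>(UNIV::'m set). \<Sum>j\<in>(UNIV::'n set). K * (H n powi e))"
    by (intro sum_mono assms(2)[OF *])
  finally show "norm (g n k \<gamma>) \<le> CARD('m) * (CARD('n) * K) * (H n powi e)"
    by simp
qed (use assms(1) in simp)

lemma scaled_bound_diag_mat:
  assumes "0 \<le> K" "\<And>n k \<gamma> i. 0 < H n \<Longrightarrow> H n \<le> 1 \<Longrightarrow> P n k \<gamma> \<Longrightarrow> \<bar>d n k \<gamma> $ i\<bar> \<le> K * (H n powi e)"
  shows "scaled_bound H P e (\<lambda>n k \<gamma>. diag_mat (d n k \<gamma>))"
  by (rule scaled_bound_matrix[OF assms(1)]) (auto simp: diag_mat_def assms)

lemma bounded_bilinear_matrix_vector: "bounded_bilinear (\<lambda>(A::real^'n^'m) x. A *v x)"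
  unfolding bilinear_conv_bounded_bilinear[symmetric] bilinear_def
  by (auto intro!: linearI simp: matrix_vector_mult_add_rdistrib matrix_vector_right_distrib
      scaleR_matrix_vector_assoc[symmetric] matrix_vector_mult_scaleR)

lemma bounded_bilinear_matrix_matrix: "bounded_bilinear (\<lambda>(A::real^'n^'m) (B::real^'p^'n). A ** B)"
  unfolding bilinear_conv_bounded_bilinear[symmetric] bilinear_def
  by (auto intro!: linearI simp: vec_eq_iff matrix_matrix_mult_def sum.distrib algebra_simps sum_distrib_left)

lemma bounded_linear_transpose: "bounded_linear (transpose :: real^'n^'m \<Rightarrow> real^'m^'n)"
  unfolding linear_conv_bounded_linear[symmetric]
  by (auto intro!: linearI simp: vec_eq_iff transpose_def)

lemmas scaled_bound_mv = scaled_bound_bilinear[OF bounded_bilinear_matrix_vector]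
lemmas scaled_bound_mm = scaled_bound_bilinear[OF bounded_bilinear_matrix_matrix]
lemmas scaled_bound_scaleR = scaled_bound_bilinear[OF bounded_bilinear_scaleR]
lemmas scaled_bound_transpose = scaled_bound_linear[OF bounded_linear_transpose]

text \<open>The index set varies with the mesh and the element; the uniform bound on its cardinality
  keeps the constant uniform.\<close>

lemma scaled_bound_set_sum:
  assumes "scaled_bound H P e g"
    and card: "\<And>n k \<gamma>. Q n k \<gamma> \<Longrightarrow> card (S n k) \<le> m"
    and sub: "\<And>n k \<gamma> \<gamma>'. Q n k \<gamma> \<Longrightarrow> \<gamma>' \<in> S n k \<Longrightarrow> P n k \<gamma>'"
  shows "scaled_bound H Q e (\<lambda>n k \<gamma>. \<Sum>\<gamma>'\<in>S n k. g n k \<gamma>')"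
proof -
  obtain K where K: "0 \<le> K"
    "\<And>n k \<gamma>. 0 < H n \<Longrightarrow> H n \<le> 1 \<Longrightarrow> P n k \<gamma> \<Longrightarrow> norm (g n k \<gamma>) \<le> K * (H n powi e)"
    by (rule scaled_boundE[OF assms(1)]) blast
  show ?thesis
  proof (rule scaled_boundI[of "real m * K"])
    fix n k \<gamma>
    assume *: "0 < H n" "H n \<le> 1" "Q n k \<gamma>"
    have "norm (\<Sum>\<gamma>'\<in>S n k. g n k \<gamma>') \<le> (\<Sum>\<gamma>'\<in>S n k. K * (H n powi e))"
      by (intro order_trans[OF norm_sum] sum_mono K(2) sub[OF *(3)] *(1,2))
    also have "\<dots> = real (card (S n k)) * (K * (H n powi e))"
      by simp
    also have "\<dots> \<le> real m * (K * (H n powi e))"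
      using card[OF *(3)] K(1) *(1) by (intro mult_right_mono) auto
    finally show "norm (\<Sum>\<gamma>'\<in>S n k. g n k \<gamma>') \<le> real m * K * (H n powi e)"
      by simp
  qed (use K in simp)
qed

definition Lam_block ::
  "(real^2 \<Rightarrow> real^2^2) \<Rightarrow> ('np::finite, 'nf::finite) ref_elem \<Rightarrow> ('np, 'nf) sbp_mesh \<Rightarrow> nat \<Rightarrow>
   2 \<Rightarrow> 2 \<Rightarrow> real^'np^'np" where
  "Lam_block lam r M k c d = diag_mat (\<chi> j. lam (vnode r M k j) $ c $ d)"

lemma lam_nodal_eq: "lam_nodal lam r M k g c = (\<Sum>d\<in>UNIV. Lam_block lam r M k c d *v g d)"
  by (simp add: vec_eq_iff lam_nodal_def Lam_block_def diag_mat_mult)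

text \<open>The Dirichlet SAT contains the transpose of \<open>Dg\<close>, so the size of the matrix
  itself is needed and not only its effect on a vector.\<close>

lemma Dg_eq:
  "Dg lam r M k \<gamma> = (\<Sum>c\<in>UNIV. Nm M c k \<gamma> ** (Rm M k \<gamma> ** (\<Sum>d\<in>UNIV. Lam_block lam r M k c d ** Dm M d k)))"
  by (simp add: matrix_eq Dg_mult lam_nodal_eq matrix_vector_mult_sum_left matrix_vector_mul_assoc[symmetric])

lemma Ups_eq:
  assumes "\<And>j. 0 < Hw M k $ j"
  shows "Ups lam r M k \<gamma> = (\<Sum>c\<in>UNIV. Nm M c k \<gamma> ** (Rm M k \<gamma> ** (matrix_inv (Hm M k) **
    (\<Sum>d\<in>UNIV. Lam_block lam r M k c d ** (transpose (Rm M k \<gamma>) ** Nm M d k \<gamma>)))))"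
  by (simp add: matrix_eq Ups_mult[OF assms] lam_nodal_eq matrix_vector_mult_sum_left
      matrix_vector_mul_assoc[symmetric])

section \<open>Geometry of elements and facets\<close>

lemma ref_tri_coord:
  assumes "\<xi> \<in> ref_tri"
  shows "\<bar>\<xi> $ c\<bar> \<le> 1"
proof -
  have sub: "ref_tri \<subseteq> {x. 0 \<le> x $ c} \<inter> {x. x $ c \<le> 1}" for c
  proof -
    have "convex ({x::real^2. 0 \<le> x $ c} \<inter> {x. x $ c \<le> 1})"
      by (rule convex_Int) (auto simp: convex_def intro: convex_bound_le)
    moreover have "{vector [0, 0], vector [1, 0], vector [0, 1]} \<subseteq> {x::real^2. 0 \<le> x $ c} \<inter> {x. x $ c \<le> 1}"
      using exhaust_2[of c] by (auto simp: vector_2)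
    ultimately show ?thesis
      unfolding ref_tri_def by (rule hull_minimal[rotated])
  qed
  show ?thesis
    using subsetD[OF sub[of c] assms] by simp
qed

lemma zero_in_ref_tri: "0 \<in> ref_tri"
proof -
  have "(0 :: real^2) = vector [0, 0]"
    by (simp add: vec_eq_iff forall_2 vector_2)
  moreover have "vector [0, 0] \<in> ref_tri"
    unfolding ref_tri_def by (rule hull_inc) simp
  ultimately show ?thesis
    by simp
qed

lemma compact_ref_tri: "compact ref_tri"
  unfolding ref_tri_def by (rule finite_imp_compact_convex_hull) simp

lemma ref_edge_pt_in_ref_tri:
  assumes mesh: "geometric_mesh \<Omega> \<Gamma>D \<Gamma>N r M" and k: "k \<in> elems M" and \<gamma>: "\<gamma> \<in> facets M k"
    and t: "-1 \<le> t" "t \<le> 1"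
  shows "fst (fends M k \<gamma>) \<in> ref_tri" "snd (fends M k \<gamma>) \<in> ref_tri" "ref_edge_pt M k \<gamma> t \<in> ref_tri"
proof -
  have "bij_betw (\<lambda>\<gamma>. {fst (fends M k \<gamma>), snd (fends M k \<gamma>)}) (facets M k) ref_edges"
    using mesh k by (simp add: geometric_mesh_def)
  then have "{fst (fends M k \<gamma>), snd (fends M k \<gamma>)} \<in> ref_edges"
    using \<gamma> by (auto simp: bij_betw_def)
  moreover have "e \<subseteq> ref_tri" if "e \<in> ref_edges" for e
    using that hull_subset[of "{vector [0, 0], vector [1, 0], vector [0, 1] :: real^2}" convex]
    by (auto simp: ref_edges_def ref_tri_def)
  ultimately show v: "fst (fends M k \<gamma>) \<in> ref_tri" "snd (fends M k \<gamma>) \<in> ref_tri"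
    by blast+
  have "convex ref_tri"
    by (simp add: ref_tri_def)
  from convexD[OF this v, of "(1 - t) / 2" "(1 + t) / 2"] t
  show "ref_edge_pt M k \<gamma> t \<in> ref_tri"
    by (simp add: ref_edge_pt_def field_simps)
qed

lemma card_facets:
  assumes "geometric_mesh \<Omega> \<Gamma>D \<Gamma>N r M" "k \<in> elems M"
  shows "card (facets M k) \<le> 3" "facets M k \<noteq> {}"
proof -
  have b: "bij_betw (\<lambda>\<gamma>. {fst (fends M k \<gamma>), snd (fends M k \<gamma>)}) (facets M k) ref_edges"
    using assms by (simp add: geometric_mesh_def)
  have "card ref_edges \<le> 3"
    unfolding ref_edges_def by (intro order_trans[OF card_insert_le_m1]) auto
  then show "card (facets M k) \<le> 3"
    using bij_betw_same_card[OF b] by simp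
  show "facets M k \<noteq> {}"
    using b by (auto simp: bij_betw_def ref_edges_def)
qed

lemma fnode_eq_emap:
  assumes mesh: "geometric_mesh \<Omega> \<Gamma>D \<Gamma>N r M" and k: "k \<in> elems M" and \<gamma>: "\<gamma> \<in> facets M k"
    and t: "-1 \<le> gnode r i" "gnode r i \<le> 1"
  shows "fnode r M \<gamma> i = emap r M k (ref_edge_pt M k \<gamma> (gnode r i))"
proof -
  have "\<forall>k\<in>elems M. \<forall>\<gamma>\<in>facets M k. \<forall>t\<in>{-1..1}. fcurve M \<gamma> t = emap r M k (ref_edge_pt M k \<gamma> t)"
    using mesh unfolding geometric_mesh_def by (elim conjE) assumption
  with k \<gamma> t show ?thesis
    by (simp add: fnode_def)
qed

lemma continuous_on_emap: "continuous_on S (emap r M k)"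
proof -
  have "continuous_on S (\<lambda>x. emap r M k x $ c)" for c
    unfolding emap_def poly2_def by (simp, intro continuous_intros)
  then show ?thesis
    by (simp add: continuous_on_vec_lambda[of S "\<lambda>c x. emap r M k x $ c", unfolded vec_nth_inverse])
qed

lemma bounded_cell: "bounded (cell r M k)"
  unfolding cell_def by (intro compact_imp_bounded compact_continuous_image continuous_on_emap compact_ref_tri)

lemma diameter_le_mesh_size:
  assumes "geometric_mesh \<Omega> \<Gamma>D \<Gamma>N r M" "k \<in> elems M"
  shows "diameter (cell r M k) \<le> mesh_size r M"
proof -
  have "finite (elems M)"
    using assms(1) unfolding geometric_mesh_def by (elim conjE) assumption
  then show ?thesis
    unfolding mesh_size_def using assms(2) by (intro Max_ge) auto
qed

lemma dist_emap_le:
  assumes "geometric_mesh \<Omega> \<Gamma>D \<Gamma>N r M" "k \<in> elems M" "\<xi> \<in> ref_tri" "\<eta> \<in> ref_tri"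
  shows "norm (emap r M k \<xi> - emap r M k \<eta>) \<le> mesh_size r M"
proof -
  have "dist (emap r M k \<xi>) (emap r M k \<eta>) \<le> diameter (cell r M k)"
    using assms(3,4) by (intro diameter_bounded_bound bounded_cell) (auto simp: cell_def)
  then show ?thesis
    using diameter_le_mesh_size[OF assms(1,2)] by (simp add: dist_norm)
qed

text \<open>The element map is injective and so separates two vertices of the reference triangle,
  which forces a positive diameter.\<close>

lemma mesh_size_pos:
  assumes mesh: "geometric_mesh \<Omega> \<Gamma>D \<Gamma>N r M" and k: "k \<in> elems M"
  shows "0 < mesh_size r M"
proof -
  have ne: "(vector [0, 0] :: real^2) \<noteq> vector [1, 0]"
    by (simp add: vec_eq_iff forall_2 vector_2)
  have v: "vector [0, 0] \<in> ref_tri" "vector [1, 0] \<in> ref_tri"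
    unfolding ref_tri_def by (rule hull_inc, simp)+
  have inj: "\<forall>k\<in>elems M. inj_on (emap r M k) ref_tri"
    using mesh unfolding geometric_mesh_def by (elim conjE) assumption
  have "emap r M k (vector [0, 0]) \<noteq> emap r M k (vector [1, 0])"
    using inj_on_eq_iff[of "emap r M k" ref_tri] inj k v ne by blast
  then show ?thesis
    using dist_emap_le[OF mesh k v] by (smt (verit) norm_le_zero_iff right_minus_eq)
qed

text \<open>Differentiation kills the constant coefficient, hence bounds are asked only from order 1
  on. Each of the at most \<open>(d + 1)^2\<close> monomials contributes at most i + j <= d times
  its coefficient.\<close>

lemma poly2_curve_derivative:
  fixes \<xi> :: "real \<Rightarrow> real^2" and a :: real
  assumes x: "((\<lambda>t. \<xi> t $ 1) has_real_derivative x') (at t)" "\<bar>\<xi> t $ 1\<bar> \<le> 1" "\<bar>x'\<bar> \<le> 1"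
    and y: "((\<lambda>t. \<xi> t $ 2) has_real_derivative y') (at t)" "\<bar>\<xi> t $ 2\<bar> \<le> 1" "\<bar>y'\<bar> \<le> 1"
    and c: "\<And>i j. 1 \<le> i + j \<Longrightarrow> i + j \<le> d \<Longrightarrow> \<bar>c i j\<bar> \<le> a" and a: "0 \<le> a"
  shows "\<exists>D. ((\<lambda>t. poly2 d c (\<xi> t)) has_real_derivative D) (at t) \<and>
    \<bar>D\<bar> \<le> (real d + 1) * ((real d + 1) * (real d * a))"
proof -
  define T where "T i j = c i j * ((real i * (\<xi> t $ 1) ^ (i - 1) * x') * (\<xi> t $ 2) ^ j +
    (\<xi> t $ 1) ^ i * (real j * (\<xi> t $ 2) ^ (j - 1) * y'))" for i j
  have "((\<lambda>t. c i j * (\<xi> t $ 1) ^ i * (\<xi> t $ 2) ^ j) has_real_derivative T i j) (at t)" for i j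
    unfolding T_def by (auto intro!: derivative_eq_intros x(1) y(1) simp: algebra_simps)
  then have "((\<lambda>t. poly2 d c (\<xi> t)) has_real_derivative (\<Sum>i\<le>d. \<Sum>j\<le>d - i. T i j)) (at t)"
    unfolding poly2_def by (intro DERIV_sum)
  moreover have "\<bar>T i j\<bar> \<le> real d * a" if "i \<le> d" "j \<le> d - i" for i j
  proof (cases "i + j = 0")
    case True
    with a show ?thesis
      by (simp add: T_def)
  next
    case False
    have pow: "\<bar>(\<xi> t $ 1) ^ m\<bar> \<le> 1" "\<bar>(\<xi> t $ 2) ^ m\<bar> \<le> 1" for m
      using x(2) y(2) by (auto simp: power_abs intro: power_le_one)
    have "\<bar>(real i * (\<xi> t $ 1) ^ (i - 1) * x') * (\<xi> t $ 2) ^ j\<bar> \<le> (real i * 1 * 1) * 1"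
      unfolding abs_mult using pow x(3) by (intro mult_mono) auto
    moreover have "\<bar>(\<xi> t $ 1) ^ i * (real j * (\<xi> t $ 2) ^ (j - 1) * y')\<bar> \<le> 1 * (real j * 1 * 1)"
      unfolding abs_mult using pow y(3) by (intro mult_mono) auto
    ultimately have "\<bar>(real i * (\<xi> t $ 1) ^ (i - 1) * x') * (\<xi> t $ 2) ^ j +
        (\<xi> t $ 1) ^ i * (real j * (\<xi> t $ 2) ^ (j - 1) * y')\<bar> \<le> real i + real j"
      by linarith
    then have "\<bar>T i j\<bar> \<le> \<bar>c i j\<bar> * (real i + real j)"
      unfolding T_def abs_mult by (intro mult_left_mono) auto
    also have "\<dots> \<le> a * real d"
      using that False a by (intro mult_mono c) auto
    finally show ?thesis
      by (simp add: mult.commute)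
  qed
  then have "\<bar>\<Sum>i\<le>d. \<Sum>j\<le>d - i. T i j\<bar> \<le> (\<Sum>i\<le>d. \<Sum>j\<le>d - i. real d * a)"
    by (intro order_trans[OF sum_abs] sum_mono) auto
  moreover have "(\<Sum>i\<le>d. \<Sum>j\<le>d - i. real d * a) \<le> (\<Sum>i\<le>d. (real d + 1) * (real d * a))"
    using a by (intro sum_mono) (auto intro!: mult_right_mono)
  ultimately show ?thesis
    by (intro exI[of _ "\<Sum>i\<le>d. \<Sum>j\<le>d - i. T i j"]) (simp add: algebra_simps)
qed

text \<open>The facet curve is the element map along an edge of the reference triangle, whose points
  and velocity have components of size at most 1. The leading factor 2 counts the two components of
  the tangent.\<close>

lemma ftangent_bound:
  assumes mesh: "geometric_mesh \<Omega> \<Gamma>D \<Gamma>N r M" and k: "k \<in> elems M" and \<gamma>: "\<gamma> \<in> facets M k"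
    and t: "-1 < gnode r i" "gnode r i < 1"
    and e: "\<And>i j. 1 \<le> i + j \<Longrightarrow> i + j \<le> deg r + 1 \<Longrightarrow> norm (ecoef M k i j) \<le> a" and a: "0 \<le> a"
  shows "norm (ftangent r M \<gamma> i) \<le> 2 * ((real (deg r) + 2) * ((real (deg r) + 2) * ((real (deg r) + 1) * a)))"
proof -
  let ?t = "gnode r i"
  let ?\<xi> = "ref_edge_pt M k \<gamma>"
  define A where "A = (real (deg r) + 2) * ((real (deg r) + 2) * ((real (deg r) + 1) * a))"
  have coord: "((\<lambda>t. ?\<xi> t $ c) has_real_derivative (snd (fends M k \<gamma>) $ c - fst (fends M k \<gamma>) $ c) / 2) (at ?t)" for c
    unfolding ref_edge_pt_def by (auto intro!: derivative_eq_intros simp: field_simps)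
  have vert: "\<bar>(snd (fends M k \<gamma>) $ c - fst (fends M k \<gamma>) $ c) / 2\<bar> \<le> 1" for c
    using ref_tri_coord[OF ref_edge_pt_in_ref_tri(1)[OF mesh k \<gamma>, of 0], of c]
      ref_tri_coord[OF ref_edge_pt_in_ref_tri(2)[OF mesh k \<gamma>, of 0], of c] by simp
  have pt: "\<bar>?\<xi> ?t $ c\<bar> \<le> 1" for c
    using t by (intro ref_tri_coord ref_edge_pt_in_ref_tri(3)[OF mesh k \<gamma>]) auto
  have "\<exists>D. ((\<lambda>t. poly2 (deg r + 1) (\<lambda>i j. ecoef M k i j $ c) (?\<xi> t)) has_real_derivative D) (at ?t) \<and>
      \<bar>D\<bar> \<le> (real (deg r + 1) + 1) * ((real (deg r + 1) + 1) * (real (deg r + 1) * a))" for c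
    using e order_trans[OF component_le_norm_cart]
    by (intro poly2_curve_derivative[OF coord pt vert coord pt vert _ a]) blast
  then have "\<forall>c. \<exists>D. ((\<lambda>t. emap r M k (?\<xi> t) $ c) has_real_derivative D) (at ?t) \<and> \<bar>D\<bar> \<le> A"
    by (simp add: emap_def A_def algebra_simps)
  from choice[OF this] obtain D where
    D: "\<And>c. ((\<lambda>t. emap r M k (?\<xi> t) $ c) has_real_derivative D c) (at ?t)" "\<And>c. \<bar>D c\<bar> \<le> A"
    by blast
  have "((\<lambda>t. \<Sum>c\<in>UNIV. (emap r M k (?\<xi> t) $ c) *\<^sub>R (axis c 1 :: real^2)) has_vector_derivative
      (\<Sum>c\<in>UNIV. D c *\<^sub>R axis c 1)) (at ?t)"
  proof (intro has_vector_derivative_sum)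
    fix c
    from has_vector_derivative_scaleR[OF D(1)[of c] has_vector_derivative_const[of "axis c 1 :: real^2"]]
    show "((\<lambda>t. (emap r M k (?\<xi> t) $ c) *\<^sub>R (axis c 1 :: real^2)) has_vector_derivative
        D c *\<^sub>R axis c 1) (at ?t)"
      by simp
  qed
  moreover have "(\<Sum>c\<in>UNIV. (v $ c) *\<^sub>R axis c 1) = (v :: real^2)" for v
    by (simp add: vec_eq_iff axis_def if_distrib[of "\<lambda>a. _ * a"] cong: if_cong)
  ultimately have "((\<lambda>t. emap r M k (?\<xi> t)) has_vector_derivative (\<Sum>c\<in>UNIV. D c *\<^sub>R axis c 1)) (at ?t)"
    by simp
  then have "(fcurve M \<gamma> has_vector_derivative (\<Sum>c\<in>UNIV. D c *\<^sub>R axis c 1)) (at ?t)"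
  \<comment> \<open>Gauss nodes are interior to the parameter interval, so agreement of the two
    curves there determines the derivative.\<close>
  proof (rule has_vector_derivative_transform_within_open[where S = "{-1<..<1}"])
    have "\<forall>k\<in>elems M. \<forall>\<gamma>\<in>facets M k. \<forall>t\<in>{-1..1}. fcurve M \<gamma> t = emap r M k (ref_edge_pt M k \<gamma> t)"
      using mesh unfolding geometric_mesh_def by (elim conjE) assumption
    with k \<gamma> show "emap r M k (?\<xi> s) = fcurve M \<gamma> s" if "s \<in> {-1<..<1}" for s
      using that by simp
  qed (use t in auto)
  then have "ftangent r M \<gamma> i = (\<Sum>c\<in>UNIV. D c *\<^sub>R axis c 1)"
    unfolding ftangent_def by (rule vector_derivative_at)
  also have "norm \<dots> \<le> (\<Sum>c\<in>UNIV. norm (D c *\<^sub>R (axis c 1 :: real^2)))"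
    by (rule norm_sum)
  also have "\<dots> \<le> (\<Sum>c\<in>(UNIV::2 set). A)"
    using D(2) by (intro sum_mono) simp
  finally show ?thesis
    by (simp add: A_def)
qed

section \<open>Operator bounds along a mesh family\<close>

locale mesh_family =
  fixes \<Omega> \<Gamma>D \<Gamma>N :: "(real^2) set"
    and lam :: "real^2 \<Rightarrow> real^2^2"
    and r :: "('np::finite, 'nf::finite) ref_elem"
    and M :: "nat \<Rightarrow> ('np, 'nf) sbp_mesh"
  assumes domain: "diffusion_domain \<Omega> \<Gamma>D \<Gamma>N"
    and ref: "valid_ref_elem r"
    and discretized: "\<And>n. discretized_mesh \<Omega> \<Gamma>D \<Gamma>N r (M n)"
    and regular: "regular_family r M"
    and accurate: "order_accurate \<Omega> r M"
    and lam_cont: "\<And>c d. continuous_on \<Omega> (\<lambda>x. lam x $ c $ d)"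
begin

abbreviation H :: "nat \<Rightarrow> real" where "H n \<equiv> mesh_size r (M n)"

abbreviation fac :: "nat \<Rightarrow> nat \<Rightarrow> nat \<Rightarrow> bool" where
  "fac n k \<gamma> \<equiv> k \<in> elems (M n) \<and> \<gamma> \<in> facets (M n) k"

lemma geom: "geometric_mesh \<Omega> \<Gamma>D \<Gamma>N r (M n)"
  using discretized by (simp add: discretized_mesh_def)

lemma sbp: "sbp_operators r (M n)"
  using discretized by (simp add: discretized_mesh_def)

lemma compact_domain: "compact \<Omega>"
  using domain by (simp add: diffusion_domain_def)

lemma gnode: "-1 < gnode r i" "gnode r i < 1" "0 < gwt r i"
  using ref by (auto simp: valid_ref_elem_def legendre_gauss_def)

lemma rnode: "rnode r j \<in> ref_tri"
  using ref by (auto simp: valid_ref_elem_def)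

lemma vnode_in: "k \<in> elems (M n) \<Longrightarrow> vnode r (M n) k j \<in> \<Omega>"
  by (rule vnode_in_domain[OF geom ref])

lemma regular_constants:
  obtains c C where "0 < c" "0 < C"
    "\<And>n k. k \<in> elems (M n) \<Longrightarrow> \<exists>x. ball x (c * H n) \<subseteq> cell r (M n) k"
    "\<And>n k i j. k \<in> elems (M n) \<Longrightarrow> 1 \<le> i + j \<Longrightarrow> i + j \<le> deg r + 1 \<Longrightarrow>
       norm (ecoef (M n) k i j) \<le> C * H n ^ (i + j)"
    "\<And>n k j. k \<in> elems (M n) \<Longrightarrow> c * (H n)\<^sup>2 \<le> Hw (M n) k $ j"
    "\<And>n k j. k \<in> elems (M n) \<Longrightarrow> Hw (M n) k $ j \<le> C * (H n)\<^sup>2"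
    "\<And>n k d i j. k \<in> elems (M n) \<Longrightarrow> \<bar>Dm (M n) d k $ i $ j\<bar> \<le> C / H n"
    "\<And>n k \<gamma>. fac n k \<gamma> \<Longrightarrow> c \<le> fwt (M n) k \<gamma>"
    "\<And>n k \<gamma> i j. fac n k \<gamma> \<Longrightarrow> \<bar>Rm (M n) k \<gamma> $ i $ j\<bar> \<le> C"
proof -
  obtain c C where c: "0 < c" and R0: "\<forall>n. \<forall>k\<in>elems (M n).
        (\<exists>x. ball x (c * H n) \<subseteq> cell r (M n) k) \<and>
        (\<forall>i j. 1 \<le> i + j \<and> i + j \<le> deg r + 1 \<longrightarrow> norm (ecoef (M n) k i j) \<le> C * H n ^ (i + j)) \<and>
        (\<forall>j. c * (H n)\<^sup>2 \<le> Hw (M n) k $ j \<and> Hw (M n) k $ j \<le> C * (H n)\<^sup>2) \<and>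
        (\<forall>i j. \<bar>Dx (M n) k $ i $ j\<bar> \<le> C / H n \<and> \<bar>Dy (M n) k $ i $ j\<bar> \<le> C / H n) \<and>
        (\<forall>\<gamma>\<in>facets (M n) k. c \<le> fwt (M n) k \<gamma> \<and> (\<forall>i j. \<bar>Rm (M n) k \<gamma> $ i $ j\<bar> \<le> C))"
    using regular unfolding regular_family_def Let_def by blast
  note R = R0[THEN spec, THEN bspec]
  \<comment> \<open>\<open>regular_family\<close> does not fix the sign of its upper constant;
    enlarging it to at least 1 makes it positive.\<close>
  define C' where "C' = max C 1"
  have pow: "C * H n ^ m \<le> C' * H n ^ m" if "k \<in> elems (M n)" for n k m
    using mesh_size_pos[OF geom that] by (intro mult_right_mono) (auto simp: C'_def)
  have div: "C / H n \<le> C' / H n" if "k \<in> elems (M n)" for n k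
    using mesh_size_pos[OF geom that] by (intro divide_right_mono) (auto simp: C'_def)
  show thesis
  proof (rule that[of c C'])
    show "0 < C'"
      by (simp add: C'_def)
    show "norm (ecoef (M n) k i j) \<le> C' * H n ^ (i + j)"
      if "k \<in> elems (M n)" "1 \<le> i + j" "i + j \<le> deg r + 1" for n k i j
      using R[OF that(1)] that(2,3) pow[OF that(1), of "i + j"] by (meson order_trans)
    show "Hw (M n) k $ j \<le> C' * (H n)\<^sup>2" if "k \<in> elems (M n)" for n k j
      using R[OF that] pow[OF that, of 2] by (meson order_trans)
    show "\<bar>Dm (M n) d k $ i $ j\<bar> \<le> C' / H n" if "k \<in> elems (M n)" for n k d i j
    proof -
      have "\<bar>Dm (M n) d k $ i $ j\<bar> \<le> C / H n"
        using R[OF that] by (auto simp: Dm_def)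
      with div[OF that] show ?thesis
        by linarith
    qed
    show "\<bar>Rm (M n) k \<gamma> $ i $ j\<bar> \<le> C'" if "fac n k \<gamma>" for n k \<gamma> i j
    proof -
      have "\<bar>Rm (M n) k \<gamma> $ i $ j\<bar> \<le> C"
        using R[of k n] that by blast
      then show ?thesis
        by (simp add: C'_def)
    qed
  qed (use c R in auto)
qed

lemma Nm_bound: "scaled_bound H fac 0 (\<lambda>n k \<gamma>. Nm (M n) c k \<gamma>)"
  unfolding Nm_def
proof (rule scaled_bound_diag_mat[of 1])
  fix n k \<gamma> i
  assume "fac n k \<gamma>"
  moreover have "\<forall>k\<in>elems (M n). \<forall>\<gamma>\<in>facets (M n) k. \<forall>i.
        ftangent r (M n) \<gamma> i \<noteq> 0 \<and> norm (fnormal (M n) k \<gamma> i) = 1 \<and>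
        fnormal (M n) k \<gamma> i \<bullet> ftangent r (M n) \<gamma> i = 0 \<and>
        (\<forall>\<^sub>F \<epsilon> in at_right 0. fnode r (M n) \<gamma> i + \<epsilon> *\<^sub>R fnormal (M n) k \<gamma> i \<notin> cell r (M n) k)"
    using geom[of n] unfolding geometric_mesh_def by (elim conjE) assumption
  ultimately have "norm (fnormal (M n) k \<gamma> i) = 1"
    by blast
  then show "\<bar>(\<chi> i. fnormal (M n) k \<gamma> i $ c) $ i\<bar> \<le> 1 * (H n powi 0)"
    using component_le_norm_cart[of "fnormal (M n) k \<gamma> i" c] by simp
qed simp

lemma Rm_bound: "scaled_bound H fac 0 (\<lambda>n k \<gamma>. Rm (M n) k \<gamma>)"
proof -
  obtain C where "0 < C" "\<And>n k \<gamma> i j. fac n k \<gamma> \<Longrightarrow> \<bar>Rm (M n) k \<gamma> $ i $ j\<bar> \<le> C"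
    by (rule regular_constants) blast
  then show ?thesis
    by (intro scaled_bound_matrix[of C]) auto
qed

lemma Dm_bound: "scaled_bound H fac (-1) (\<lambda>n k \<gamma>. Dm (M n) d k)"
proof -
  obtain C where "0 < C" "\<And>n k d i j. k \<in> elems (M n) \<Longrightarrow> \<bar>Dm (M n) d k $ i $ j\<bar> \<le> C / H n"
    by (rule regular_constants) blast
  then show ?thesis
    by (intro scaled_bound_matrix[of C]) (auto simp: power_int_minus divide_inverse)
qed

lemma Hinv_bound: "scaled_bound H fac (-2) (\<lambda>n k \<gamma>. matrix_inv (Hm (M n) k))"
proof -
  obtain c where c: "0 < c" "\<And>n k j. k \<in> elems (M n) \<Longrightarrow> c * (H n)\<^sup>2 \<le> Hw (M n) k $ j"
    by (rule regular_constants) blast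
  have "scaled_bound H fac (-2) (\<lambda>n k \<gamma>. diag_mat (\<chi> j. inverse (Hw (M n) k $ j)))"
  proof (rule scaled_bound_diag_mat[of "1 / c"])
    fix n k \<gamma> j
    assume h: "0 < H n" and k: "fac n k \<gamma>"
    have "inverse (Hw (M n) k $ j) \<le> inverse (c * (H n)\<^sup>2)"
      using h k c by (intro le_imp_inverse_le) auto
    then show "\<bar>(\<chi> j. inverse (Hw (M n) k $ j)) $ j\<bar> \<le> 1 / c * (H n powi - 2)"
      using sbp_Hw_pos[OF sbp, of k n j] k
      by (simp add: power_int_minus divide_inverse)
  qed (use c in simp)
  then show ?thesis
    by (rule scaled_bound_cong) (simp add: matrix_inv_Hm sbp_Hw_pos[OF sbp])
qed

lemma Lam_block_bound: "scaled_bound H fac 0 (\<lambda>n k \<gamma>. Lam_block lam r (M n) k c d)"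
proof -
  have "bounded ((\<lambda>x. lam x $ c $ d) ` \<Omega>)"
    by (intro compact_imp_bounded compact_continuous_image lam_cont compact_domain)
  then obtain b where "0 < b" "\<And>x. x \<in> \<Omega> \<Longrightarrow> \<bar>lam x $ c $ d\<bar> \<le> b"
    by (auto simp: bounded_pos)
  then show ?thesis
    unfolding Lam_block_def by (intro scaled_bound_diag_mat[of b]) (auto simp: vnode_in)
qed

lemma inverse_fwt_bound: "scaled_bound H fac 0 (\<lambda>n k \<gamma>. 1 / fwt (M n) k \<gamma>)"
proof -
  obtain c where c: "0 < c" "\<And>n k \<gamma>. fac n k \<gamma> \<Longrightarrow> c \<le> fwt (M n) k \<gamma>"
    by (rule regular_constants) blast
  show ?thesis
  proof (rule scaled_boundI[of "1 / c"])
    fix n k \<gamma>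
    assume "fac n k \<gamma>"
    with c have "c \<le> fwt (M n) k \<gamma>" "0 < fwt (M n) k \<gamma>"
      by (auto intro: less_le_trans)
    then show "norm (1 / fwt (M n) k \<gamma>) \<le> 1 / c * (H n powi 0)"
      using c(1) by (simp add: divide_left_mono frac_le)
  qed (use c in simp)
qed

text \<open>The facet weights are Gauss weights times the length of the tangent. The tangent is
  O(h), since only map coefficients of order s >= 1 enter and h^s <= h.\<close>

lemma Bm_bound: "scaled_bound H fac 1 (\<lambda>n k \<gamma>. Bm r (M n) \<gamma>)"
proof -
  obtain C where C: "0 < C" "\<And>n k i j. k \<in> elems (M n) \<Longrightarrow> 1 \<le> i + j \<Longrightarrow> i + j \<le> deg r + 1 \<Longrightarrow>
       norm (ecoef (M n) k i j) \<le> C * H n ^ (i + j)"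
    by (rule regular_constants) blast
  define A where "A = 2 * ((real (deg r) + 2) * ((real (deg r) + 2) * ((real (deg r) + 1) * C)))"
  have A: "0 \<le> A"
    using C by (simp add: A_def)
  show ?thesis
    unfolding Bm_def
  proof (rule scaled_bound_diag_mat[of "(\<Sum>i\<in>UNIV. gwt r i) * A"])
    show "0 \<le> (\<Sum>i\<in>UNIV. gwt r i) * A"
      using gnode(3) A by (intro mult_nonneg_nonneg sum_nonneg) (auto intro: less_imp_le)
    fix n k \<gamma> i
    assume h: "0 < H n" "H n \<le> 1" and f: "fac n k \<gamma>"
    have "norm (ecoef (M n) k i j) \<le> C * H n" if "1 \<le> i + j" "i + j \<le> deg r + 1" for i j
    proof -
      have "norm (ecoef (M n) k i j) \<le> C * H n ^ (i + j)"
        using f that C(2) by blast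
      also have "\<dots> \<le> C * H n ^ 1"
        using h C(1) that by (intro mult_left_mono power_decreasing) auto
      finally show ?thesis
        by simp
    qed
    then have "norm (ftangent r (M n) \<gamma> i) \<le>
        2 * ((real (deg r) + 2) * ((real (deg r) + 2) * ((real (deg r) + 1) * (C * H n))))"
      using f h C(1) by (intro ftangent_bound[OF geom _ _ gnode(1,2)]) auto
    then have "norm (ftangent r (M n) \<gamma> i) \<le> A * H n"
      by (simp add: A_def mult_ac)
    moreover have "gwt r i \<le> (\<Sum>i\<in>UNIV. gwt r i)"
      using gnode(3) by (intro member_le_sum) (auto intro: less_imp_le)
    ultimately have "gwt r i * norm (ftangent r (M n) \<gamma> i) \<le> (\<Sum>i\<in>UNIV. gwt r i) * (A * H n)"
      using gnode(3)[of i] by (intro mult_mono) (auto intro: order_trans less_imp_le)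
    then show "\<bar>(\<chi> i. gwt r i * norm (ftangent r (M n) \<gamma> i)) $ i\<bar> \<le> (\<Sum>i\<in>UNIV. gwt r i) * A * (H n powi 1)"
      using gnode(3)[of i] by (simp add: abs_mult mult.assoc)
  qed
qed

lemma Dg_bound: "scaled_bound H fac (-1) (\<lambda>n k \<gamma>. Dg lam r (M n) k \<gamma>)"
  unfolding Dg_eq
  by (intro scaled_bound_sum scaled_bound_mm[OF Nm_bound] scaled_bound_mm[OF Rm_bound]
      scaled_bound_mm[OF Lam_block_bound Dm_bound]) auto

lemma Ups_bound: "scaled_bound H fac (-2) (\<lambda>n k \<gamma>. Ups lam r (M n) k \<gamma>)"
proof (rule scaled_bound_cong)
  show "scaled_bound H fac (-2) (\<lambda>n k \<gamma>. \<Sum>c\<in>UNIV. Nm (M n) c k \<gamma> ** (Rm (M n) k \<gamma> ** (matrix_inv (Hm (M n) k) **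
    (\<Sum>d\<in>UNIV. Lam_block lam r (M n) k c d ** (transpose (Rm (M n) k \<gamma>) ** Nm (M n) d k \<gamma>)))))"
    by (intro scaled_bound_sum scaled_bound_mm[OF Nm_bound] scaled_bound_mm[OF Rm_bound]
        scaled_bound_mm[OF Hinv_bound] scaled_bound_mm[OF Lam_block_bound]
        scaled_bound_mm[OF scaled_bound_transpose[OF Rm_bound] Nm_bound]) auto
qed (simp add: Ups_eq sbp_Hw_pos[OF sbp])

lemma accurate_Dm:
  obtains C where "0 \<le> C" "\<And>n \<phi> b k j c. \<lbrakk>Ck_on (deg r + 1) \<Omega> \<phi>; Ck_bounded (deg r + 1) \<Omega> b \<phi>; 0 \<le> b;
    k \<in> elems (M n)\<rbrakk> \<Longrightarrow> \<bar>(Dm (M n) c k *v (\<chi> l. \<phi> (vnode r (M n) k l))) $ j - partial c \<phi> (vnode r (M n) k j)\<bar>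
      \<le> C * b * H n ^ deg r"
proof -
  obtain C where C: "\<And>n \<phi> b k j. \<lbrakk>Ck_on (deg r + 1) \<Omega> \<phi>; Ck_bounded (deg r + 1) \<Omega> b \<phi>; k \<in> elems (M n)\<rbrakk> \<Longrightarrow>
           \<bar>(Dx (M n) k *v (\<chi> l. \<phi> (vnode r (M n) k l))) $ j - partial 1 \<phi> (vnode r (M n) k j)\<bar>
             \<le> C * b * H n ^ deg r \<and>
           \<bar>(Dy (M n) k *v (\<chi> l. \<phi> (vnode r (M n) k l))) $ j - partial 2 \<phi> (vnode r (M n) k j)\<bar>
             \<le> C * b * H n ^ deg r"
    using accurate unfolding order_accurate_def by blast
  show thesis
  proof (rule that[of "\<bar>C\<bar>"])
    fix n \<phi> k j and c :: 2 and b :: real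
    assume *: "Ck_on (deg r + 1) \<Omega> \<phi>" "Ck_bounded (deg r + 1) \<Omega> b \<phi>" "0 \<le> b" "k \<in> elems (M n)"
    have "C * b * H n ^ deg r \<le> \<bar>C\<bar> * b * H n ^ deg r"
      using *(3) mesh_size_pos[OF geom *(4)] by (intro mult_right_mono) auto
    moreover have "c = 1 \<or> c = 2"
      by (rule exhaust_2)
    ultimately show "\<bar>(Dm (M n) c k *v (\<chi> l. \<phi> (vnode r (M n) k l))) $ j - partial c \<phi> (vnode r (M n) k j)\<bar>
      \<le> \<bar>C\<bar> * b * H n ^ deg r"
      using C[OF *(1,2,4), of j] by (auto simp: Dm_def)
  qed simp
qed

lemma grad_bound:
  assumes "Ck_on (deg r + 1) \<Omega> \<phi>" "Ck_bounded (deg r + 1) \<Omega> b \<phi>" "0 \<le> b"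
  shows "scaled_bound H fac (int (deg r))
    (\<lambda>n k \<gamma>. Dm (M n) c k *v (\<chi> l. \<phi> (vnode r (M n) k l)) - (\<chi> j. partial c \<phi> (vnode r (M n) k j)))"
proof -
  obtain C where C: "0 \<le> C" "\<And>n k j. k \<in> elems (M n) \<Longrightarrow>
      \<bar>(Dm (M n) c k *v (\<chi> l. \<phi> (vnode r (M n) k l))) $ j - partial c \<phi> (vnode r (M n) k j)\<bar> \<le> C * b * H n ^ deg r"
    by (rule accurate_Dm) (use assms in blast)
  show ?thesis
    by (rule scaled_bound_vec[of "C * b"]) (use C assms(3) in auto)
qed

text \<open>A curved element need not be convex, but a segment between two of its points has length
  at most h and so stays in the ball of radius \<delta> around a point of the domain.\<close>

lemma cell_segment:
  assumes k: "k \<in> elems (M n)" and \<xi>: "\<xi> \<in> ref_tri" and \<eta>: "\<eta> \<in> ref_tri"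
    and \<delta>: "\<And>x. x \<in> \<Omega> \<Longrightarrow> cball x \<delta> \<subseteq> S" "H n \<le> \<delta>"
  shows "closed_segment (emap r (M n) k \<xi>) (emap r (M n) k \<eta>) \<subseteq> S"
proof -
  have "emap r (M n) k \<xi> \<in> \<Omega>"
    using mesh_cover[OF geom[of n]] k \<xi> unfolding cell_def by blast
  moreover have "closed_segment (emap r (M n) k \<xi>) (emap r (M n) k \<eta>) \<subseteq> cball (emap r (M n) k \<xi>) \<delta>"
    using dist_emap_le[OF geom k \<xi> \<eta>] \<delta>(2) mesh_size_pos[OF geom k]
    by (intro closed_segment_subset) (auto simp: dist_norm)
  ultimately show ?thesis
    using \<delta>(1) by blast
qed

text \<open>The order q is separate from the degree of the scheme because it is limited by the
  smoothness of f: it will be p for the solution and p - 1 for its flux.\<close>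

lemma extrapolation_bound:
  assumes V: "open V" "S \<subseteq> V" and \<delta>: "0 < \<delta>" "\<And>x. x \<in> \<Omega> \<Longrightarrow> cball x \<delta> \<subseteq> S"
    and f: "Ck_on_open (q + 1) V f" "Ck_bounded (q + 1) S b f" "0 \<le> b" and q: "q \<le> deg r"
  shows "scaled_bound H (\<lambda>n k \<gamma>. fac n k \<gamma> \<and> H n \<le> \<delta>) (int q + 1)
    (\<lambda>n k \<gamma>. Rm (M n) k \<gamma> *v (\<chi> j. f (vnode r (M n) k j)) - (\<chi> i. f (fnode r (M n) \<gamma> i)))"
proof -
  obtain C where C: "0 < C" "\<And>n k i j. k \<in> elems (M n) \<Longrightarrow> 1 \<le> i + j \<Longrightarrow> i + j \<le> deg r + 1 \<Longrightarrow>
       norm (ecoef (M n) k i j) \<le> C * H n ^ (i + j)" and CR: "\<And>n k \<gamma> i j. fac n k \<gamma> \<Longrightarrow> \<bar>Rm (M n) k \<gamma> $ i $ j\<bar> \<le> C"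
    by (rule regular_constants) blast
  define Ce where "Ce = (real (deg r + 1) + 1)\<^sup>2 * C"
  have "0 \<le> Ce"
    using C(1) by (simp add: Ce_def)
  then obtain K where K: "0 \<le> K" "\<And>h T E x0 V S b f. \<lbrakk>0 \<le> h; h \<le> 1; \<And>c. graded q Ce h T (\<lambda>\<xi>. (E \<xi> - x0) $ c); open V; S \<subseteq> V;
      Ck_on_open (q + 1) V f; Ck_bounded (q + 1) S b f; 0 \<le> b; x0 \<in> S;
      \<And>\<xi>. \<xi> \<in> T \<Longrightarrow> closed_segment x0 (E \<xi>) \<subseteq> S \<and> norm (E \<xi> - x0) \<le> h\<rbrakk>
      \<Longrightarrow> graded q (K * b) h T (\<lambda>\<xi>. f (E \<xi>))"
    by (rule graded_compose[where q = q and C = Ce]) blast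
  show ?thesis
  proof (rule scaled_bound_vec[of "(CARD('np) * C + 1) * (K * b)"])
    show "0 \<le> (CARD('np) * C + 1) * (K * b)"
      using C(1) K(1) f(3) by simp
    fix n k \<gamma> i
    assume h: "0 < H n" "H n \<le> 1" and "fac n k \<gamma> \<and> H n \<le> \<delta>"
    then have k: "k \<in> elems (M n)" and \<gamma>: "\<gamma> \<in> facets (M n) k" and h\<delta>: "H n \<le> \<delta>"
      by auto
    let ?E = "emap r (M n) k"
    \<comment> \<open>The base point is the image of the reference vertex 0, which is the constant
      coefficient of the map; the displacement from it is therefore graded.\<close>
    have E0: "?E 0 $ c = ecoef (M n) k 0 0 $ c" for c
    proof -
      have "poly2 d a 0 = a 0 0" for d and a :: "nat \<Rightarrow> nat \<Rightarrow> real"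
      proof -
        have "(\<Sum>j\<le>d - i. a i j * 0 ^ i * 0 ^ j) = (\<Sum>j\<le>d - i. if j = 0 then if i = 0 then a 0 0 else 0 else 0)" for i
          by (intro sum.cong) (auto simp: power_0_left)
        then have "poly2 d a 0 = (\<Sum>i\<le>d. if i = 0 then a 0 0 else 0)"
          by (simp add: poly2_def)
        then show ?thesis
          by simp
      qed
      then show ?thesis
        by (simp add: emap_def)
    qed
    have graded: "graded q Ce (H n) ref_tri (\<lambda>\<xi>. (?E \<xi> - ?E 0) $ c)" for c
    proof -
      have "\<bar>ecoef (M n) k i j $ c\<bar> \<le> C * H n ^ (i + j)" if "1 \<le> i + j" "i + j \<le> deg r + 1" for i j
        using component_le_norm_cart C(2)[OF k that] by (rule order_trans)
      then have "graded q Ce (H n) ref_tri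
          (\<lambda>\<xi>. poly2 (deg r + 1) (\<lambda>i j. ecoef (M n) k i j $ c) \<xi> - ecoef (M n) k 0 0 $ c)"
        unfolding Ce_def using h C(1) by (intro graded_poly2 ref_tri_coord) auto
      moreover have "(?E \<xi> - ?E 0) $ c = poly2 (deg r + 1) (\<lambda>i j. ecoef (M n) k i j $ c) \<xi> - ecoef (M n) k 0 0 $ c" for \<xi>
        by (simp add: E0) (simp add: emap_def)
      ultimately show ?thesis
        by simp
    qed
    have seg: "closed_segment (?E 0) (?E \<xi>) \<subseteq> S \<and> norm (?E \<xi> - ?E 0) \<le> H n" if "\<xi> \<in> ref_tri" for \<xi>
      using cell_segment[OF k zero_in_ref_tri that \<delta>(2) h\<delta>] dist_emap_le[OF geom k that zero_in_ref_tri] by simp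
    have "?E 0 \<in> S"
      using seg[OF zero_in_ref_tri] by simp
    then have g: "graded q (K * b) (H n) ref_tri (\<lambda>\<xi>. f (?E \<xi>))"
      using h by (intro K(2)[OF _ _ graded V f _ seg]) auto
    have exact: "Rm (M n) k \<gamma> *v (\<chi> j. poly2 (deg r) c (rnode r j)) =
        (\<chi> i. poly2 (deg r) c (ref_edge_pt (M n) k \<gamma> (gnode r i)))" for c
      using sbp[of n] k \<gamma> unfolding sbp_operators_def by blast
    have "\<bar>(Rm (M n) k \<gamma> *v (\<chi> j. f (?E (rnode r j)))) $ i - f (?E (ref_edge_pt (M n) k \<gamma> (gnode r i)))\<bar>
        \<le> (CARD('np) * C + 1) * (K * b) * H n ^ (q + 1)"
      using gnode(1,2) C(1) k \<gamma>
      by (intro extrapolation_error[OF g q _ _ exact rnode ref_edge_pt_in_ref_tri(3)[OF geom k \<gamma>]] CR)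
        (auto intro: less_imp_le)
    moreover have "fnode r (M n) \<gamma> i = ?E (ref_edge_pt (M n) k \<gamma> (gnode r i))"
      using gnode(1,2)[of i] by (intro fnode_eq_emap[OF geom k \<gamma>]) auto
    moreover have "H n powi (int q + 1) = H n ^ (q + 1)"
      using power_int_of_nat[of "H n" "q + 1"] by (simp add: add.commute)
    ultimately show "\<bar>(Rm (M n) k \<gamma> *v (\<chi> j. f (vnode r (M n) k j)) - (\<chi> i. f (fnode r (M n) \<gamma> i))) $ i\<bar>
        \<le> (CARD('np) * C + 1) * (K * b) * (H n powi (int q + 1))"
      by (simp add: vnode_def)
  qed
qed

text \<open>A function with only \<open>p\<close> derivatives is differentiated through its Taylor polynomial.\<close>

lemma derivative_bound:
  assumes V: "open V" "S \<subseteq> V" and \<delta>: "0 < \<delta>" "\<And>x. x \<in> \<Omega> \<Longrightarrow> cball x \<delta> \<subseteq> S"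
    and w: "Ck_on_open (deg r) V w" "Ck_bounded (deg r) S b w" "0 \<le> b" and p: "2 \<le> deg r"
  shows "scaled_bound H (\<lambda>n k \<gamma>. fac n k \<gamma> \<and> H n \<le> \<delta>) (int (deg r) - 1)
    (\<lambda>n k \<gamma>. Dm (M n) c k *v (\<chi> j. w (vnode r (M n) k j)) - (\<chi> j. partial c w (vnode r (M n) k j)))"
proof -
  let ?p = "deg r"
  obtain CD where CD: "0 < CD" "\<And>n k d i j. k \<in> elems (M n) \<Longrightarrow> \<bar>Dm (M n) d k $ i $ j\<bar> \<le> CD / H n"
    by (rule regular_constants) blast
  obtain C where C: "0 \<le> C" "\<And>n \<phi> b k j c. \<lbrakk>Ck_on (deg r + 1) \<Omega> \<phi>; Ck_bounded (deg r + 1) \<Omega> b \<phi>; 0 \<le> b;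
    k \<in> elems (M n)\<rbrakk> \<Longrightarrow> \<bar>(Dm (M n) c k *v (\<chi> l. \<phi> (vnode r (M n) k l))) $ j - partial c \<phi> (vnode r (M n) k j)\<bar>
      \<le> C * b * H n ^ deg r"
    by (rule accurate_Dm) blast
  \<comment> \<open>Accuracy asks for derivative bounds on the whole domain, although the Taylor
    polynomial is centred at one node. Its arguments are thus bounded by the diameter, raised to at
    least 1 as \<open>smooth_bounded_taylor\<close> demands.\<close>
  define R where "R = max 1 (diameter \<Omega>)"
  have R: "norm (x - y) \<le> R" if "x \<in> \<Omega>" "y \<in> \<Omega>" for x y
    using diameter_bounded_bound[OF compact_imp_bounded[OF compact_domain] that]
    by (simp add: R_def dist_norm)
  obtain K where K: "0 \<le> K" "\<And>f x0 b. \<lbrakk>0 \<le> b; Ck_bounded ?p {x0} b f; \<forall>x\<in>\<Omega>. norm (x - x0) \<le> R\<rbrakk> \<Longrightarrow>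
      smooth_bounded (?p + 1) \<Omega> (K * b) (taylor ?p f x0)"
    using smooth_bounded_taylor[of R ?p \<Omega> "?p + 1"] by (auto simp: R_def)
  show ?thesis
  proof (rule scaled_bound_vec[of "C * (K * b) + CARD('np) * (CD * (2 ^ ?p * b))"])
    show "0 \<le> C * (K * b) + CARD('np) * (CD * (2 ^ ?p * b))"
      using C(1) K(1) CD(1) w(3) by simp
    fix n k \<gamma> i
    assume h: "0 < H n" "H n \<le> 1" and "fac n k \<gamma> \<and> H n \<le> \<delta>"
    then have k: "k \<in> elems (M n)" and h\<delta>: "H n \<le> \<delta>"
      by auto
    let ?x = "vnode r (M n) k"
    define P where "P = taylor ?p w (?x i)"
    have xS: "?x i \<in> S"
      using \<delta>(2)[OF vnode_in[OF k]] \<delta>(1) by (meson centre_in_cball less_imp_le subsetD)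
    have "smooth_bounded (?p + 1) \<Omega> (K * b) P"
      unfolding P_def using w(3) Ck_bounded_subset[OF w(2)] xS R vnode_in[OF k] by (intro K(2)) auto
    then have "Ck_on (?p + 1) \<Omega> P" "Ck_bounded (?p + 1) \<Omega> (K * b) P"
      by (auto simp: smooth_bounded_def Ck_on_def simp del: Ck_on_open.simps Ck_bounded.simps)
    then have 1: "\<bar>(Dm (M n) c k *v (\<chi> l. P (?x l))) $ i - partial c P (?x i)\<bar> \<le> C * (K * b) * H n ^ ?p"
      using K(1) w(3) k by (intro C(2)) auto
    have err: "\<bar>w (?x l) - P (?x l)\<bar> \<le> (2 * H n) ^ ?p * b" for l
    proof -
      have "\<bar>w (?x l) - P (?x l)\<bar> \<le> (2 * norm (?x l - ?x i)) ^ ?p * b"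
        unfolding P_def
        by (rule taylor_error[OF V w(1,2)]) (use cell_segment[OF k rnode rnode \<delta>(2) h\<delta>] in \<open>auto simp: vnode_def\<close>)
      also have "\<dots> \<le> (2 * H n) ^ ?p * b"
        using dist_emap_le[OF geom k rnode rnode] w(3)
        by (intro mult_right_mono power_mono) (auto simp: vnode_def)
      finally show ?thesis .
    qed
    \<comment> \<open>The Taylor remainder is O(h^p) on the element, and the entries of the
      derivative matrix cost a factor 1/h.\<close>
    have "\<bar>(Dm (M n) c k *v (\<chi> l. w (?x l) - P (?x l))) $ i\<bar> \<le> CARD('np) * ((CD / H n) * ((2 * H n) ^ ?p * b))"
      using CD(1) h by (intro matrix_vector_entry_bound CD(2)[OF k]) (simp_all only: vec_lambda_beta err, simp)
    moreover have "(\<chi> l. w (?x l) - P (?x l)) = (\<chi> l. w (?x l)) - (\<chi> l. P (?x l))"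
      by (simp add: vec_eq_iff)
    ultimately have 2: "\<bar>(Dm (M n) c k *v (\<chi> l. w (?x l))) $ i - (Dm (M n) c k *v (\<chi> l. P (?x l))) $ i\<bar>
        \<le> CARD('np) * ((CD / H n) * ((2 * H n) ^ ?p * b))"
      by (simp add: matrix_vector_mult_diff_distrib)
    have "partial c P (?x i) = partial c w (?x i)"
      unfolding P_def using p by (rule partial_taylor)
    with 1 2 have "\<bar>(Dm (M n) c k *v (\<chi> l. w (?x l))) $ i - partial c w (?x i)\<bar> \<le>
        C * (K * b) * H n ^ ?p + CARD('np) * ((CD / H n) * ((2 * H n) ^ ?p * b))"
      by linarith
    also have "\<dots> \<le> C * (K * b) * H n ^ (?p - 1) + CARD('np) * (CD * (2 ^ ?p * b)) * H n ^ (?p - 1)"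
    proof (rule add_mono)
      show "C * (K * b) * H n ^ ?p \<le> C * (K * b) * H n ^ (?p - 1)"
        using h C(1) K(1) w(3) by (intro mult_left_mono power_decreasing) auto
      have "H n ^ ?p = H n * H n ^ (?p - 1)"
        using p by (metis One_nat_def Suc_1 Suc_le_D diff_Suc_1 power_Suc)
      then show "CARD('np) * ((CD / H n) * ((2 * H n) ^ ?p * b)) \<le> CARD('np) * (CD * (2 ^ ?p * b)) * H n ^ (?p - 1)"
        using h by (simp add: power_mult_distrib)
    qed
    also have "\<dots> = (C * (K * b) + CARD('np) * (CD * (2 ^ ?p * b))) * (H n powi (int ?p - 1))"
      using power_int_of_nat[of "H n" "?p - 1"] p by (simp add: of_nat_diff distrib_right)
    finally show "\<bar>(Dm (M n) c k *v (\<chi> j. w (?x j)) - (\<chi> j. partial c w (?x j))) $ i\<bar> \<le>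
        (C * (K * b) + CARD('np) * (CD * (2 ^ ?p * b))) * (H n powi (int ?p - 1))"
      by simp
  qed
qed

section \<open>Truncation error\<close>

abbreviation int_fac :: "nat \<Rightarrow> nat \<Rightarrow> nat \<Rightarrow> bool" where
  "int_fac n k \<gamma> \<equiv> k \<in> elems (M n) \<and> \<gamma> \<in> int_facets (M n) k"

lemma int_fac_fac: "int_fac n k \<gamma> \<Longrightarrow> fac n k \<gamma>"
  by (simp add: int_facets_def)

lemma int_fac_nbr_fac: "int_fac n k \<gamma> \<Longrightarrow> fac n (nbr (M n) k \<gamma>) \<gamma>"
  using mesh_nbr[OF geom, of k n \<gamma>] by (simp add: int_facets_def)

lemma Nm_nbr:
  assumes "int_fac n k \<gamma>"
  shows "Nm (M n) c (nbr (M n) k \<gamma>) \<gamma> = - Nm (M n) c k \<gamma>"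
proof -
  have "\<forall>k\<in>elems (M n). \<forall>\<gamma>\<in>int_facets (M n) k. \<forall>i. fnormal (M n) (nbr (M n) k \<gamma>) \<gamma> i = - fnormal (M n) k \<gamma> i"
    using geom[of n] unfolding geometric_mesh_def by (elim conjE) assumption
  with assms show ?thesis
    by (simp add: Nm_def diag_mat_def vec_eq_iff)
qed

text \<open>The exponents of \<open>Bm\<close>, \<open>Ups\<close> and \<open>Bm\<close> are 1, -2
  and 1, so the penalty has size O(1).\<close>

lemma T1_bound: "scaled_bound H int_fac 0 (\<lambda>n k \<gamma>. T1 (cng_sat lam r (M n)) k \<gamma>)"
proof -
  note own = scaled_bound_subset[OF _ int_fac_fac] 
    and other = scaled_bound_nbr[where P = fac and Q = int_fac and v = "\<lambda>n k \<gamma>. nbr (M n) k \<gamma>", OF _ int_fac_nbr_fac]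
  have "scaled_bound H int_fac (-2) (\<lambda>n k \<gamma>. (1 / fwt (M n) k \<gamma>) *\<^sub>R Ups lam r (M n) k \<gamma> +
      (1 / fwt (M n) (nbr (M n) k \<gamma>) \<gamma>) *\<^sub>R Ups lam r (M n) (nbr (M n) k \<gamma>) \<gamma>)"
    by (intro scaled_bound_add scaled_bound_scaleR[OF own[OF inverse_fwt_bound] own[OF Ups_bound]]
        scaled_bound_scaleR[OF other[OF inverse_fwt_bound] other[OF Ups_bound]]) auto
  from scaled_bound_mm[OF scaled_bound_mm[OF own[OF Bm_bound] this refl] own[OF Bm_bound], of 0]
  show ?thesis
    unfolding cng_sat_def by (simp, intro scaled_bound_linear[OF bounded_linear_scaleR_right]) simp
qed

lemma TD_bound: "scaled_bound H fac 0 (\<lambda>n k \<gamma>. TD (cng_sat lam r (M n)) k \<gamma>)"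
proof -
  from scaled_bound_mm[OF scaled_bound_mm[OF Bm_bound Ups_bound refl] Bm_bound, of 0]
  have "scaled_bound H fac 0 (\<lambda>n k \<gamma>. Bm r (M n) \<gamma> ** Ups lam r (M n) k \<gamma> ** Bm r (M n) \<gamma>)"
    by simp
  from scaled_bound_scaleR[OF inverse_fwt_bound this, of 0] show ?thesis
    by (simp add: cng_sat_def)
qed

text \<open>The exact traces and fluxes at the facet nodes are inserted everywhere, so that each SAT
  argument becomes a difference of one-sided defects.\<close>

lemma truncation_bound:
  assumes p: "2 \<le> deg r" and lam_smooth: "\<And>i j. Ck_on (deg r) \<Omega> (\<lambda>x. lam x $ i $ j)"
    and U_smooth: "Ck_on (deg r + 1) \<Omega> U" and source: "steady_source \<Omega> lam F U"
  obtains \<delta> where "0 < \<delta>" "scaled_bound H (\<lambda>n k \<gamma>. fac n k \<gamma> \<and> H n \<le> \<delta>) (int (deg r) - 1)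
    (\<lambda>n k \<gamma>. trunc_error lam r (M n) (cng_sat lam r (M n)) F U k)"
proof -
  let ?p = "deg r"
  obtain V0 where V0: "open V0" "\<Omega> \<subseteq> V0" "Ck_on_open (?p + 1) V0 U"
    using U_smooth by (auto simp: Ck_on_def simp del: Ck_on_open.simps)
  have "\<forall>i. \<exists>W. \<forall>j. open (W j) \<and> \<Omega> \<subseteq> W j \<and> Ck_on_open ?p (W j) (\<lambda>x. lam x $ i $ j)"
    using lam_smooth unfolding Ck_on_def by (intro allI choice) blast
  from choice[OF this] obtain W where
    W: "\<And>i j. open (W i j)" "\<And>i j. \<Omega> \<subseteq> W i j" "\<And>i j. Ck_on_open ?p (W i j) (\<lambda>x. lam x $ i $ j)"
    by blast
  \<comment> \<open>\<open>Ck_on\<close> gives every entry of \<lambda> its own neighbourhood. These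
    are finitely many, so their intersection is still open.\<close>
  define V where "V = V0 \<inter> (\<Inter>i. \<Inter>j. W i j)"
  have V: "open V" "\<Omega> \<subseteq> V"
    unfolding V_def by (intro open_Int V0(1) open_INT ballI W(1) finite)
      (intro Int_greatest INT_greatest V0(2) W(2))
  have UV: "Ck_on_open (?p + 1) V U"
    using V0(3) by (rule Ck_on_open_subset[rotated]) (auto simp: V_def)
  have lamV: "Ck_on_open ?p V (\<lambda>x. lam x $ i $ j)" for i j
    using W(3)[of i j] by (rule Ck_on_open_subset[rotated]) (auto simp: V_def)
  define w where "w c x = (\<Sum>d\<in>UNIV. lam x $ c $ d * partial d U x)" for c x
  have flux_w: "flux lam U x $ c = w c x" for c x
    by (simp add: flux_def w_def matrix_vector_mult_def grad_def)
  have wV: "Ck_on_open ?p V (w c)" for c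
    unfolding w_def using UV by (intro Ck_on_open_sum Ck_on_open_mult V(1) lamV) auto
  obtain e where e: "0 < e" "(\<Union>x\<in>\<Omega>. ball x e) \<subseteq> V"
    using compact_subset_open_imp_ball_epsilon_subset[OF compact_domain V] by blast
  define \<delta> where "\<delta> = e / 2"
  \<comment> \<open>The closed \<delta>-neighbourhood as a sum of two compact sets, hence compact;
    halving e keeps it inside \<open>V\<close>.\<close>
  define S where "S = {x + y | x y. x \<in> \<Omega> \<and> y \<in> cball 0 \<delta>}"
  have \<delta>: "0 < \<delta>"
    using e(1) by (simp add: \<delta>_def)
  have "compact S"
    unfolding S_def by (intro compact_sums compact_domain compact_cball)
  have SV: "S \<subseteq> V"
  proof
    fix z
    assume "z \<in> S"
    then obtain x y where "x \<in> \<Omega>" "norm y \<le> \<delta>" "z = x + y"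
      by (auto simp: S_def)
    then have "z \<in> ball x e"
      using e(1) by (simp add: dist_norm \<delta>_def)
    with \<open>x \<in> \<Omega>\<close> e(2) show "z \<in> V"
      by blast
  qed
  have cS: "cball x \<delta> \<subseteq> S" if "x \<in> \<Omega>" for x
  proof
    fix z
    assume "z \<in> cball x \<delta>"
    then have "z = x + (z - x)" "z - x \<in> cball 0 \<delta>"
      by (auto simp: dist_norm norm_minus_commute)
    with that show "z \<in> S"
      unfolding S_def by blast
  qed
  have \<Omega>S: "\<Omega> \<subseteq> S"
    using cS \<delta> by fastforce
  obtain bU where bU: "0 \<le> bU" "Ck_bounded (?p + 1) S bU U"
    using Ck_bounded_compact[OF \<open>compact S\<close> SV UV] by blast
  have "\<exists>b\<ge>0. Ck_bounded ?p S b (w c)" for c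
    by (rule Ck_bounded_compact[OF \<open>compact S\<close> SV wV])
  then obtain bw where bw: "\<And>c. 0 \<le> bw c" "\<And>c. Ck_bounded ?p S (bw c) (w c)"
    by metis

  let ?P = "\<lambda>n k \<gamma>. fac n k \<gamma> \<and> H n \<le> \<delta>"
  let ?I = "\<lambda>n k \<gamma>. int_fac n k \<gamma> \<and> H n \<le> \<delta>"
  have PI: "?I n k \<gamma> \<Longrightarrow> ?P n k \<gamma>" and PN: "?I n k \<gamma> \<Longrightarrow> ?P n (nbr (M n) k \<gamma>) \<gamma>" for n k \<gamma>
    using int_fac_fac int_fac_nbr_fac by blast+
  note facP = scaled_bound_subset[where P = fac and Q = ?P]
    and facI = scaled_bound_subset[where P = fac and Q = ?I]
  define u where "u n k = (\<chi> j. U (vnode r (M n) k j))" for n k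
  define uf where "uf n \<gamma> = (\<chi> i. U (fnode r (M n) \<gamma> i))" for n \<gamma>
  define wv where "wv c n k = (\<chi> j. w c (vnode r (M n) k j))" for c n k
  define wf where "wf c n \<gamma> = (\<chi> i. w c (fnode r (M n) \<gamma> i))" for c n \<gamma>
  define fl where "fl n k \<gamma> = (\<Sum>c\<in>UNIV. Nm (M n) c k \<gamma> *v wf c n \<gamma>)" for n k \<gamma>
  define ln where "ln c n k = lam_nodal lam r (M n) k (\<lambda>d. Dm (M n) d k *v u n k) c" for c n k

  have trace: "scaled_bound H ?P (int ?p + 1) (\<lambda>n k \<gamma>. Rm (M n) k \<gamma> *v u n k - uf n \<gamma>)"
    unfolding u_def uf_def
    by (rule extrapolation_bound[OF V(1) SV \<delta> cS UV bU(2,1) order_refl])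
  have wtrace: "scaled_bound H ?P (int ?p) (\<lambda>n k \<gamma>. Rm (M n) k \<gamma> *v wv c n k - wf c n \<gamma>)" for c
  proof -
    \<comment> \<open>The flux has only p derivatives, so the expansion stops at order p - 1 and one
      power of h is lost against the trace of the solution.\<close>
    have "scaled_bound H ?P (int (?p - 1) + 1) (\<lambda>n k \<gamma>. Rm (M n) k \<gamma> *v wv c n k - wf c n \<gamma>)"
      unfolding wv_def wf_def using wV bw(2) p
      by (intro extrapolation_bound[OF V(1) SV \<delta> cS _ _ bw(1)]) auto
    then show ?thesis
      using p by (simp add: of_nat_diff)
  qed
  have lnerr: "scaled_bound H fac (int ?p) (\<lambda>n k \<gamma>. ln c n k - wv c n k)" for c
  proof -
    \<comment> \<open>Here \<open>order_accurate\<close> applies directly, since the solution has p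
      + 1 derivatives.\<close>
    have g: "scaled_bound H fac (int ?p)
        (\<lambda>n k \<gamma>. Dm (M n) d k *v u n k - (\<chi> j. partial d U (vnode r (M n) k j)))" for d
      unfolding u_def
      by (rule grad_bound[OF U_smooth Ck_bounded_subset[OF bU(2) \<Omega>S] bU(1)])
    have "scaled_bound H fac (int ?p) (\<lambda>n k \<gamma>. \<Sum>d\<in>UNIV. Lam_block lam r (M n) k c d *v
        (Dm (M n) d k *v u n k - (\<chi> j. partial d U (vnode r (M n) k j))))"
      by (intro scaled_bound_sum scaled_bound_mv[OF Lam_block_bound g]) auto
    moreover have "wv c n k = (\<Sum>d\<in>UNIV. Lam_block lam r (M n) k c d *v (\<chi> j. partial d U (vnode r (M n) k j)))" for n k
      by (simp add: vec_eq_iff wv_def w_def Lam_block_def diag_mat_mult)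
    ultimately show ?thesis
      by (simp add: ln_def lam_nodal_eq matrix_vector_mult_diff_distrib sum_subtractf)
  qed
  have nflux: "scaled_bound H ?P (int ?p) (\<lambda>n k \<gamma>. Dg lam r (M n) k \<gamma> *v u n k - fl n k \<gamma>)"
  proof -
    \<comment> \<open>The defect splits into the extrapolated error of the numerical gradient and
      the extrapolation error of the exact flux; both are O(h^p).\<close>
    have inner: "scaled_bound H ?P (int ?p) (\<lambda>n k \<gamma>.
        Rm (M n) k \<gamma> *v (ln c n k - wv c n k) + (Rm (M n) k \<gamma> *v wv c n k - wf c n \<gamma>))" for c
      by (rule scaled_bound_add[OF facP[OF scaled_bound_mv[OF Rm_bound lnerr]] wtrace]) auto
    have "scaled_bound H ?P (int ?p) (\<lambda>n k \<gamma>. \<Sum>c\<in>UNIV. Nm (M n) c k \<gamma> *v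
        (Rm (M n) k \<gamma> *v (ln c n k - wv c n k) + (Rm (M n) k \<gamma> *v wv c n k - wf c n \<gamma>)))"
      by (intro scaled_bound_sum scaled_bound_mv[OF facP[OF Nm_bound] inner]) auto
    then show ?thesis
      by (simp add: Dg_mult fl_def ln_def[symmetric] matrix_vector_mult_diff_distrib sum_subtractf)
  qed
  have ownI: "scaled_bound H ?I e g" if "scaled_bound H ?P e g" for e and g :: "nat \<Rightarrow> nat \<Rightarrow> nat \<Rightarrow> real^'nf"
    by (rule scaled_bound_subset[OF that PI])
  have nbrI: "scaled_bound H ?I e (\<lambda>n k \<gamma>. g n (nbr (M n) k \<gamma>) \<gamma>)"
    if "scaled_bound H ?P e g" for e and g :: "nat \<Rightarrow> nat \<Rightarrow> nat \<Rightarrow> real^'nf"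
    by (rule scaled_bound_nbr[OF that PN])
  have jump: "scaled_bound H ?I (int ?p + 1)
      (\<lambda>n k \<gamma>. Rm (M n) k \<gamma> *v u n k - Rm (M n) (nbr (M n) k \<gamma>) \<gamma> *v u n (nbr (M n) k \<gamma>))"
    using scaled_bound_diff[OF ownI[OF trace] nbrI[OF trace]] by simp
  have dsum: "scaled_bound H ?I (int ?p)
      (\<lambda>n k \<gamma>. Dg lam r (M n) k \<gamma> *v u n k + Dg lam r (M n) (nbr (M n) k \<gamma>) \<gamma> *v u n (nbr (M n) k \<gamma>))"
  proof (rule scaled_bound_cong)
    show "scaled_bound H ?I (int ?p) (\<lambda>n k \<gamma>. (Dg lam r (M n) k \<gamma> *v u n k - fl n k \<gamma>) +
        (Dg lam r (M n) (nbr (M n) k \<gamma>) \<gamma> *v u n (nbr (M n) k \<gamma>) - fl n (nbr (M n) k \<gamma>) \<gamma>))"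
      by (rule scaled_bound_add[OF ownI[OF nflux] nbrI[OF nflux]])
    fix n k \<gamma>
    assume "?I n k \<gamma>"
    \<comment> \<open>The exact flux is evaluated at facet nodes common to both sides and the
      normals are opposite, so the exact normal fluxes cancel in the sum.\<close>
    then have "fl n (nbr (M n) k \<gamma>) \<gamma> = - fl n k \<gamma>"
      by (simp add: fl_def Nm_nbr sum_negf[symmetric] vec_eq_iff matrix_vector_mult_def)
    then show "(Dg lam r (M n) k \<gamma> *v u n k - fl n k \<gamma>) +
        (Dg lam r (M n) (nbr (M n) k \<gamma>) \<gamma> *v u n (nbr (M n) k \<gamma>) - fl n (nbr (M n) k \<gamma>) \<gamma>) =
        Dg lam r (M n) k \<gamma> *v u n k + Dg lam r (M n) (nbr (M n) k \<gamma>) \<gamma> *v u n (nbr (M n) k \<gamma>)"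
      by simp
  qed

  have card: "card (facets (M n) k \<inter> X) \<le> 3" "card (int_facets (M n) k) \<le> 3" if "k \<in> elems (M n)" for n k X
    using card_facets(1)[OF geom that] mesh_finite_facets[OF geom that]
    by (auto simp: int_facets_def intro: order_trans[OF card_mono])
  have sI: "scaled_bound H ?P (int ?p + 1) (\<lambda>n k \<gamma>. sI lam r (M n) (cng_sat lam r (M n)) (u n) k)"
  proof -
    have "scaled_bound H ?I (int ?p + 1) (\<lambda>n k \<gamma>. transpose (Rm (M n) k \<gamma>) *v
        (T1 (cng_sat lam r (M n)) k \<gamma> *v
          (Rm (M n) k \<gamma> *v u n k - Rm (M n) (nbr (M n) k \<gamma>) \<gamma> *v u n (nbr (M n) k \<gamma>)) +
        (1 / 2) *\<^sub>R (Bm r (M n) \<gamma> *v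
          (Dg lam r (M n) k \<gamma> *v u n k + Dg lam r (M n) (nbr (M n) k \<gamma>) \<gamma> *v u n (nbr (M n) k \<gamma>)))))"
      by (intro scaled_bound_mv[OF facI[OF scaled_bound_transpose[OF Rm_bound]]] scaled_bound_add
          scaled_bound_mv[OF scaled_bound_subset[OF T1_bound] jump]
          scaled_bound_linear[OF bounded_linear_scaleR_right] scaled_bound_mv[OF facI[OF Bm_bound] dsum])
        (auto simp: int_facets_def)
    then have "scaled_bound H ?P (int ?p + 1) (\<lambda>n k \<gamma>. \<Sum>\<gamma>\<in>int_facets (M n) k. transpose (Rm (M n) k \<gamma>) *v
        (T1 (cng_sat lam r (M n)) k \<gamma> *v
          (Rm (M n) k \<gamma> *v u n k - Rm (M n) (nbr (M n) k \<gamma>) \<gamma> *v u n (nbr (M n) k \<gamma>)) +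
        (1 / 2) *\<^sub>R (Bm r (M n) \<gamma> *v
          (Dg lam r (M n) k \<gamma> *v u n k + Dg lam r (M n) (nbr (M n) k \<gamma>) \<gamma> *v u n (nbr (M n) k \<gamma>)))))"
      by (rule scaled_bound_set_sum[where m = 3]) (auto simp: card)
    then show ?thesis
      by (simp add: sI_def Let_def cng_sat_def scaleR_matrix_vector_assoc[symmetric])
  qed
  have sB: "scaled_bound H ?P (int ?p + 1) (\<lambda>n k \<gamma>. sB lam r (M n) (cng_sat lam r (M n))
       (\<lambda>k \<gamma>. uf n \<gamma>) (\<lambda>k \<gamma>. fl n k \<gamma>) (u n) k)"
  proof -
    have "scaled_bound H ?P (int ?p + 1) (\<lambda>n k \<gamma>.
        transpose (Rm (M n) k \<gamma>) *v (TD (cng_sat lam r (M n)) k \<gamma> *v (Rm (M n) k \<gamma> *v u n k - uf n \<gamma>)) -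
        transpose (Dg lam r (M n) k \<gamma>) *v (Bm r (M n) \<gamma> *v (Rm (M n) k \<gamma> *v u n k - uf n \<gamma>)))"
      by (intro scaled_bound_diff scaled_bound_mv[OF facP[OF scaled_bound_transpose[OF Rm_bound]]]
          scaled_bound_mv[OF facP[OF TD_bound] trace]
          scaled_bound_mv[OF facP[OF scaled_bound_transpose[OF Dg_bound]]
            scaled_bound_mv[OF facP[OF Bm_bound] trace refl]]) auto
    then have 1: "scaled_bound H ?P (int ?p + 1) (\<lambda>n k \<gamma>. \<Sum>\<gamma>\<in>facets (M n) k \<inter> dir_facets (M n).
        transpose (Rm (M n) k \<gamma>) *v (TD (cng_sat lam r (M n)) k \<gamma> *v (Rm (M n) k \<gamma> *v u n k - uf n \<gamma>)) -
        transpose (Dg lam r (M n) k \<gamma>) *v (Bm r (M n) \<gamma> *v (Rm (M n) k \<gamma> *v u n k - uf n \<gamma>)))"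
      by (rule scaled_bound_set_sum[where m = 3]) (auto simp: card)
    have "scaled_bound H ?P (int ?p + 1) (\<lambda>n k \<gamma>.
        transpose (Rm (M n) k \<gamma>) *v (Bm r (M n) \<gamma> *v (Dg lam r (M n) k \<gamma> *v u n k - fl n k \<gamma>)))"
      by (intro scaled_bound_mv[OF facP[OF scaled_bound_transpose[OF Rm_bound]]]
          scaled_bound_mv[OF facP[OF Bm_bound] nflux]) auto
    then have "scaled_bound H ?P (int ?p + 1) (\<lambda>n k \<gamma>. \<Sum>\<gamma>\<in>facets (M n) k \<inter> neu_facets (M n).
        transpose (Rm (M n) k \<gamma>) *v (Bm r (M n) \<gamma> *v (Dg lam r (M n) k \<gamma> *v u n k - fl n k \<gamma>)))"
      by (rule scaled_bound_set_sum[where m = 3]) (auto simp: card)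
    with 1 show ?thesis
      unfolding sB_def by (rule scaled_bound_add)
  qed
  \<comment> \<open>The O(h^p) error of the numerical gradient is amplified by 1/h, and
    differentiating the exact flux also costs O(h^(p-1)); the exact divergence cancels against the
    source.\<close>
  have vol: "scaled_bound H ?P (int ?p - 1) (\<lambda>n k \<gamma>. D2 lam r (M n) k *v u n k + (\<chi> j. F (vnode r (M n) k j)))"
  proof (rule scaled_bound_cong)
    have "scaled_bound H ?P (int ?p - 1)
        (\<lambda>n k \<gamma>. Dm (M n) c k *v wv c n k - (\<chi> j. partial c (w c) (vnode r (M n) k j)))" for c
      unfolding wv_def by (rule derivative_bound[OF V(1) SV \<delta> cS wV bw(2,1) p])
    then show "scaled_bound H ?P (int ?p - 1) (\<lambda>n k \<gamma>. \<Sum>c\<in>UNIV. Dm (M n) c k *v (ln c n k - wv c n k) +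
        (Dm (M n) c k *v wv c n k - (\<chi> j. partial c (w c) (vnode r (M n) k j))))"
      by (intro scaled_bound_sum scaled_bound_add facP[OF scaled_bound_mv[OF Dm_bound lnerr]]) auto
    fix n k \<gamma>
    assume *: "?P n k \<gamma>"
    have "(\<Sum>c\<in>UNIV. partial c (w c) x) = - F x" if "x \<in> \<Omega>" for x
    proof -
      have "divergence (flux lam U) x = (\<Sum>c\<in>UNIV. partial c (w c) x)"
        by (simp add: divergence_def flux_w)
      moreover have "- divergence (flux lam U) x = F x"
        using source that by (simp add: steady_source_def)
      ultimately show ?thesis
        by simp
    qed
    then have "(\<Sum>c\<in>UNIV. (\<chi> j. partial c (w c) (vnode r (M n) k j))) = - (\<chi> j. F (vnode r (M n) k j))"
      using vnode_in * by (simp add: vec_eq_iff)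
    then show "(\<Sum>c\<in>UNIV. Dm (M n) c k *v (ln c n k - wv c n k) +
        (Dm (M n) c k *v wv c n k - (\<chi> j. partial c (w c) (vnode r (M n) k j)))) =
        D2 lam r (M n) k *v u n k + (\<chi> j. F (vnode r (M n) k j))"
      by (simp add: D2_mult ln_def[symmetric] matrix_vector_mult_diff_distrib sum_subtractf)
  qed
  have "scaled_bound H ?P (int ?p - 1) (\<lambda>n k \<gamma>. - (D2 lam r (M n) k *v u n k + (\<chi> j. F (vnode r (M n) k j))) +
      (matrix_inv (Hm (M n) k) *v sI lam r (M n) (cng_sat lam r (M n)) (u n) k +
       matrix_inv (Hm (M n) k) *v sB lam r (M n) (cng_sat lam r (M n)) (\<lambda>k \<gamma>. uf n \<gamma>) (\<lambda>k \<gamma>. fl n k \<gamma>) (u n) k))"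
    by (intro scaled_bound_add scaled_bound_minus vol scaled_bound_mv[OF facP[OF Hinv_bound] sI]
        scaled_bound_mv[OF facP[OF Hinv_bound] sB]) auto
  moreover have "fl n k \<gamma> = (\<chi> i. fnormal (M n) k \<gamma> i \<bullet> flux lam U (fnode r (M n) \<gamma> i))" for n k \<gamma>
    by (simp add: vec_eq_iff fl_def Nm_def diag_mat_mult wf_def inner_vec_def flux_w)
  ultimately have "scaled_bound H ?P (int ?p - 1) (\<lambda>n k \<gamma>. trunc_error lam r (M n) (cng_sat lam r (M n)) F U k)"
    by (simp add: trunc_error_def Lh_def u_def[symmetric] uf_def[symmetric] algebra_simps)
  with \<delta> show thesis
    by (rule that)
qed

section \<open>Counting elements and passing to the limit\<close>

lemma elems_nonempty: "elems (M n) \<noteq> {}"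
proof
  assume "elems (M n) = {}"
  then have "\<Omega> = {}"
    using mesh_cover[OF geom[of n]] by simp
  \<comment> \<open>The Dirichlet boundary is a nonempty part of the frontier, while the empty set
    has empty frontier.\<close>
  then show False
    using domain by (auto simp: diffusion_domain_def)
qed

lemma finite_elems: "finite (elems (M n))"
  using geom[of n] unfolding geometric_mesh_def by (elim conjE) assumption

lemma H_pos: "0 < H n"
  using elems_nonempty mesh_size_pos[OF geom] by blast

text \<open>The elements contain disjoint balls of radius \<open>c h\<close>.\<close>

lemma card_elems_bound:
  obtains K where "0 < K" "\<And>n. real (card (elems (M n))) * (H n)\<^sup>2 \<le> K"
proof -
  obtain c where c: "0 < c" "\<And>n k. k \<in> elems (M n) \<Longrightarrow> \<exists>x. ball x (c * H n) \<subseteq> cell r (M n) k"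
    by (rule regular_constants) blast
  define v where "v = measure lborel (ball (0 :: real^2) 1)"
  have v: "0 < v"
    unfolding v_def by (rule content_ball_pos) simp
  have "real (card (elems (M n))) * (H n)\<^sup>2 \<le> measure lborel \<Omega> / (c\<^sup>2 * v)" for n
  proof -
    have "\<forall>k\<in>elems (M n). \<exists>x. ball x (c * H n) \<subseteq> cell r (M n) k"
      using c(2) by blast
    from bchoice[OF this] obtain x where x: "\<And>k. k \<in> elems (M n) \<Longrightarrow> ball (x k) (c * H n) \<subseteq> cell r (M n) k"
      by blast
    have int: "\<forall>k\<in>elems (M n). \<forall>v\<in>elems (M n). k \<noteq> v \<longrightarrow> interior (cell r (M n) k) \<inter> interior (cell r (M n) v) = {}"
      using geom[of n] unfolding geometric_mesh_def by (elim conjE) assumption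
    have "disjoint_family_on (\<lambda>k. ball (x k) (c * H n)) (elems (M n))"
      unfolding disjoint_family_on_def
    proof (intro ballI impI)
      fix k l
      assume kl: "k \<in> elems (M n)" "l \<in> elems (M n)" "k \<noteq> l"
      then have "ball (x k) (c * H n) \<subseteq> interior (cell r (M n) k)" "ball (x l) (c * H n) \<subseteq> interior (cell r (M n) l)"
        by (simp_all add: interior_maximal x)
      with int kl show "ball (x k) (c * H n) \<inter> ball (x l) (c * H n) = {}"
        by blast
    qed
    moreover have ball_fin: "emeasure lborel (ball a s) \<noteq> top" for a :: "real^2" and s
      using emeasure_lborel_ball_finite[of a s] by simp
    ultimately have "measure lborel (\<Union>k\<in>elems (M n). ball (x k) (c * H n)) =
        (\<Sum>k\<in>elems (M n). measure lborel (ball (x k) (c * H n)))"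
      by (intro measure_finite_Union finite_elems) (auto simp: ball_fin)
    also have "\<dots> = (\<Sum>k\<in>elems (M n). (c * H n)\<^sup>2 * v)"
      using c(1) H_pos[of n] unfolding v_def
      by (intro sum.cong refl) (subst content_ball_conv_unit_ball, auto)
    also have "\<dots> = real (card (elems (M n))) * (H n)\<^sup>2 * (c\<^sup>2 * v)"
      by (simp add: power_mult_distrib mult_ac)
    finally have eq: "measure lborel (\<Union>k\<in>elems (M n). ball (x k) (c * H n)) =
        real (card (elems (M n))) * (H n)\<^sup>2 * (c\<^sup>2 * v)" .
    have "measure lborel (\<Union>k\<in>elems (M n). ball (x k) (c * H n)) \<le> measure lborel \<Omega>"
    proof (rule measure_mono_fmeasurable)
      show "(\<Union>k\<in>elems (M n). ball (x k) (c * H n)) \<subseteq> \<Omega>"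
        using x mesh_cover[OF geom[of n]] by blast
      show "(\<Union>k\<in>elems (M n). ball (x k) (c * H n)) \<in> sets lborel"
        by (intro sets.finite_UN finite_elems) simp
      show "\<Omega> \<in> fmeasurable lborel"
        using compact_domain by (intro fmeasurableI emeasure_bounded_finite compact_imp_bounded)
          (simp add: borel_compact)
    qed
    then show ?thesis
      using eq c(1) v by (simp add: pos_le_divide_eq)
  qed
  \<comment> \<open>The added 1 makes the constant positive whatever the measure of the
    domain.\<close>
  then have "real (card (elems (M n))) * (H n)\<^sup>2 \<le> measure lborel \<Omega> / (c\<^sup>2 * v) + 1" for n
    by (rule order_trans) simp
  moreover have "0 < measure lborel \<Omega> / (c\<^sup>2 * v) + 1"
    using v by (intro add_nonneg_pos divide_nonneg_nonneg) auto
  ultimately show thesis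
    using that by blast
qed

text \<open>The weights of the norm are O(h^2), and under the root they supply one further power of
  h.\<close>

lemma Hnorm_truncation_bound:
  assumes p: "2 \<le> deg r" and lam_smooth: "\<And>i j. Ck_on (deg r) \<Omega> (\<lambda>x. lam x $ i $ j)"
    and U_smooth: "Ck_on (deg r + 1) \<Omega> U" and source: "steady_source \<Omega> lam F U"
  obtains \<delta> K where "0 < \<delta>" "0 \<le> K" "\<And>n k. H n \<le> \<delta> \<Longrightarrow> k \<in> elems (M n) \<Longrightarrow>
    0 \<le> Hnorm (M n) k (trunc_error lam r (M n) (cng_sat lam r (M n)) F U k) \<and>
    Hnorm (M n) k (trunc_error lam r (M n) (cng_sat lam r (M n)) F U k) \<le> K * H n ^ deg r"
proof -
  obtain \<delta> where \<delta>: "0 < \<delta>" and tb: "scaled_bound H (\<lambda>n k \<gamma>. fac n k \<gamma> \<and> H n \<le> \<delta>) (int (deg r) - 1)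
    (\<lambda>n k \<gamma>. trunc_error lam r (M n) (cng_sat lam r (M n)) F U k)"
    by (rule truncation_bound[OF assms])
  obtain K where K: "0 \<le> K" "\<And>n k \<gamma>. 0 < H n \<Longrightarrow> H n \<le> 1 \<Longrightarrow> fac n k \<gamma> \<and> H n \<le> \<delta> \<Longrightarrow>
      norm (trunc_error lam r (M n) (cng_sat lam r (M n)) F U k) \<le> K * (H n powi (int (deg r) - 1))"
    by (rule scaled_boundE[OF tb]) blast
  obtain C where C: "0 < C" "\<And>n k j. k \<in> elems (M n) \<Longrightarrow> Hw (M n) k $ j \<le> C * (H n)\<^sup>2"
    by (rule regular_constants) (rule that)
  show thesis
  \<comment> \<open>The minimum with 1 is there because \<open>scaled_bound\<close> only speaks
    about h <= 1.\<close>
  proof (rule that[of "min \<delta> 1" "sqrt C * K"])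
    show "0 < min \<delta> 1" "0 \<le> sqrt C * K"
      using \<delta> C(1) K(1) by auto
    fix n k
    assume h: "H n \<le> min \<delta> 1" and k: "k \<in> elems (M n)"
    let ?t = "trunc_error lam r (M n) (cng_sat lam r (M n)) F U k"
    \<comment> \<open>\<open>scaled_bound\<close> is indexed by facets even where the quantity
      depends on the element alone, so some facet has to be exhibited.\<close>
    obtain \<gamma> where "\<gamma> \<in> facets (M n) k"
      using card_facets(2)[OF geom k] by blast
    then have nt: "norm ?t \<le> K * (H n powi (int (deg r) - 1))"
      using h k H_pos by (intro K(2)) auto
    have "0 \<le> ?t \<bullet> (Hm (M n) k *v ?t)"
      unfolding dot_Hm by (intro sum_nonneg mult_nonneg_nonneg[OF less_imp_le[OF sbp_Hw_pos[OF sbp k]] zero_le_square])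
    moreover have "?t \<bullet> (Hm (M n) k *v ?t) \<le> C * (H n)\<^sup>2 * (norm ?t)\<^sup>2"
    proof -
      have "?t \<bullet> (Hm (M n) k *v ?t) \<le> (\<Sum>j\<in>UNIV. C * (H n)\<^sup>2 * (?t $ j * ?t $ j))"
        unfolding dot_Hm using C(2)[OF k] by (intro sum_mono mult_right_mono) auto
      also have "\<dots> = C * (H n)\<^sup>2 * (norm ?t)\<^sup>2"
        by (simp add: power2_norm_eq_inner inner_vec_def sum_distrib_left)
      finally show ?thesis .
    qed
    ultimately have "0 \<le> Hnorm (M n) k ?t" "Hnorm (M n) k ?t \<le> sqrt (C * (H n)\<^sup>2 * (norm ?t)\<^sup>2)"
      by (auto simp: Hnorm_def)
    moreover have "sqrt (C * (H n)\<^sup>2 * (norm ?t)\<^sup>2) = sqrt C * H n * norm ?t"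
      using H_pos[of n] by (simp add: real_sqrt_mult)
    moreover have "sqrt C * H n * norm ?t \<le> sqrt C * H n * (K * (H n powi (int (deg r) - 1)))"
      using nt C(1) H_pos[of n] by (intro mult_left_mono) auto
    moreover have "H n * (H n powi (int (deg r) - 1)) = H n ^ deg r"
      using H_pos[of n] by (simp add: power_int_diff)
    ultimately show "0 \<le> Hnorm (M n) k ?t \<and> Hnorm (M n) k ?t \<le> sqrt C * K * H n ^ deg r"
      by (simp add: mult_ac)
  qed
qed

lemma tendsto_zero_if_le_mesh_size:
  assumes lim: "H \<longlonglongrightarrow> 0" and "0 < \<delta>" and le: "\<And>n. H n \<le> \<delta> \<Longrightarrow> 0 \<le> f n \<and> f n \<le> K * H n"
  shows "f \<longlonglongrightarrow> 0"
proof (rule Lim_null_comparison)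
  have "\<forall>\<^sub>F n in sequentially. H n < \<delta>"
    using lim \<open>0 < \<delta>\<close> by (rule order_tendstoD(2))
  then show "\<forall>\<^sub>F n in sequentially. norm (f n) \<le> K * H n"
    by eventually_elim (use le in force)
  show "(\<lambda>n. K * H n) \<longlonglongrightarrow> 0"
    using tendsto_mult_left[OF lim, of K] by simp
qed

lemma cng_consistent:
  assumes lim: "H \<longlonglongrightarrow> 0" and p: "3 \<le> deg r"
    and lam_smooth: "\<And>i j. Ck_on (deg r) \<Omega> (\<lambda>x. lam x $ i $ j)"
  shows "consistent \<Omega> lam r M (\<lambda>n. cng_sat lam r (M n))"
  unfolding consistent_def
proof (intro allI impI, elim conjE)
  fix F U
  assume U: "Ck_on (deg r + 1) \<Omega> U" "steady_source \<Omega> lam F U"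
  let ?t = "\<lambda>n k. Hnorm (M n) k (trunc_error lam r (M n) (cng_sat lam r (M n)) F U k)"
  have "2 \<le> deg r"
    using p by simp
  then obtain \<delta> K where \<delta>: "0 < \<delta>" and K: "0 \<le> K" and t: "\<And>n k. H n \<le> \<delta> \<Longrightarrow> k \<in> elems (M n) \<Longrightarrow>
      0 \<le> ?t n k \<and> ?t n k \<le> K * H n ^ deg r"
    by (rule Hnorm_truncation_bound[OF _ lam_smooth U]) blast
  obtain N where N: "0 < N" "\<And>n. real (card (elems (M n))) * (H n)\<^sup>2 \<le> N"
    by (rule card_elems_bound) blast
  show "(\<lambda>n. \<Sum>k\<in>elems (M n). ?t n k) \<longlonglongrightarrow> 0"
  proof (rule tendsto_zero_if_le_mesh_size[OF lim, of "min \<delta> 1" _ "K * N"])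
    fix n
    assume h: "H n \<le> min \<delta> 1"
    have "(\<Sum>k\<in>elems (M n). ?t n k) \<le> (\<Sum>k\<in>elems (M n). K * H n ^ deg r)"
      using h by (intro sum_mono) (simp add: t)
    \<comment> \<open>Two of the three powers of h pay for the number of elements; the third gives
      the decay.\<close>
    also have "\<dots> \<le> real (card (elems (M n))) * (K * H n ^ 3)"
      using h H_pos[of n] K p by (simp, intro mult_left_mono power_decreasing) auto
    also have "\<dots> = K * H n * (real (card (elems (M n))) * (H n)\<^sup>2)"
      by (simp add: power2_eq_square power3_eq_cube)
    also have "\<dots> \<le> K * H n * N"
      using N(2) K H_pos[of n] by (intro mult_left_mono) auto
    finally have "(\<Sum>k\<in>elems (M n). ?t n k) \<le> K * N * H n"
      by (simp add: mult_ac)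
    moreover have "0 \<le> (\<Sum>k\<in>elems (M n). ?t n k)"
      using h by (intro sum_nonneg) (simp add: t)
    ultimately show "0 \<le> (\<Sum>k\<in>elems (M n). ?t n k) \<and> (\<Sum>k\<in>elems (M n). ?t n k) \<le> K * N * H n"
      by simp
  qed (use \<delta> in simp)
qed

lemma cng_consistent_global:
  assumes lim: "H \<longlonglongrightarrow> 0" and p: "2 \<le> deg r"
    and lam_smooth: "\<And>i j. Ck_on (deg r) \<Omega> (\<lambda>x. lam x $ i $ j)"
  shows "consistent_global \<Omega> lam r M (\<lambda>n. cng_sat lam r (M n))"
  unfolding consistent_global_def
proof (intro allI impI, elim conjE)
  fix F U
  assume U: "Ck_on (deg r + 1) \<Omega> U" "steady_source \<Omega> lam F U"
  let ?t = "\<lambda>n k. Hnorm (M n) k (trunc_error lam r (M n) (cng_sat lam r (M n)) F U k)"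
  obtain \<delta> K where \<delta>: "0 < \<delta>" and K: "0 \<le> K" and t: "\<And>n k. H n \<le> \<delta> \<Longrightarrow> k \<in> elems (M n) \<Longrightarrow>
      0 \<le> ?t n k \<and> ?t n k \<le> K * H n ^ deg r"
    by (rule Hnorm_truncation_bound[OF p lam_smooth U]) blast
  obtain N where N: "0 < N" "\<And>n. real (card (elems (M n))) * (H n)\<^sup>2 \<le> N"
    by (rule card_elems_bound) blast
  show "(\<lambda>n. sqrt (\<Sum>k\<in>elems (M n). (?t n k)\<^sup>2)) \<longlonglongrightarrow> 0"
  proof (rule tendsto_zero_if_le_mesh_size[OF lim, of "min \<delta> 1" _ "K * sqrt N"])
    fix n
    assume h: "H n \<le> min \<delta> 1"
    \<comment> \<open>After squaring, h^2 becomes h^4; the number of elements takes h^2 of it, and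
      the root of the rest is of order h.\<close>
    have "(\<Sum>k\<in>elems (M n). (?t n k)\<^sup>2) \<le> (\<Sum>k\<in>elems (M n). (K * H n ^ 2)\<^sup>2)"
    proof (intro sum_mono power_mono)
      fix k
      assume k: "k \<in> elems (M n)"
      have "K * H n ^ deg r \<le> K * H n ^ 2"
        using h H_pos[of n] K p by (intro mult_left_mono power_decreasing) auto
      with t[OF _ k] h show "?t n k \<le> K * H n ^ 2" "0 \<le> ?t n k"
        by fastforce+
    qed
    also have "\<dots> = (K * H n)\<^sup>2 * (real (card (elems (M n))) * (H n)\<^sup>2)"
      by (simp add: power_mult_distrib power2_eq_square)
    also have "\<dots> \<le> (K * H n)\<^sup>2 * N"
      using N(2) by (intro mult_left_mono) auto
    finally have "sqrt (\<Sum>k\<in>elems (M n). (?t n k)\<^sup>2) \<le> sqrt ((K * H n)\<^sup>2 * N)"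
      by (rule real_sqrt_le_mono)
    also have "\<dots> = K * sqrt N * H n"
      using K H_pos[of n] by (simp add: real_sqrt_mult)
    finally show "0 \<le> sqrt (\<Sum>k\<in>elems (M n). (?t n k)\<^sup>2) \<and> sqrt (\<Sum>k\<in>elems (M n). (?t n k)\<^sup>2) \<le> K * sqrt N * H n"
      by (simp add: sum_nonneg)
  qed (use \<delta> in simp)
qed

end

theorem proposition6:
  fixes \<Omega> \<Gamma>D \<Gamma>N :: "(real^2) set"
    and lam :: "real^2 \<Rightarrow> real^2^2"
    and r :: "('np::finite, 'nf::finite) ref_elem"
  assumes domain: "diffusion_domain \<Omega> \<Gamma>D \<Gamma>N"
    and lam_spd: "\<forall>x\<in>\<Omega>. spd (lam x)"
    and ref: "valid_ref_elem r"
  shows "(\<forall>M. discretized_mesh \<Omega> \<Gamma>D \<Gamma>N r M \<longrightarrow>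
            conservative lam r M (cng_sat lam r M) \<and>
            energy_stable lam r M (cng_sat lam r M)) \<and>
         (\<forall>M. (\<forall>n. discretized_mesh \<Omega> \<Gamma>D \<Gamma>N r (M n)) \<and>
              (\<lambda>n. mesh_size r (M n)) \<longlonglongrightarrow> 0 \<and>
              regular_family r M \<and> order_accurate \<Omega> r M \<and>
              (\<forall>i j. Ck_on (deg r) \<Omega> (\<lambda>x. lam x $ i $ j)) \<longrightarrow>
            (3 \<le> deg r \<longrightarrow> consistent \<Omega> lam r M (\<lambda>n. cng_sat lam r (M n))) \<and>
            (2 \<le> deg r \<longrightarrow> consistent_global \<Omega> lam r M (\<lambda>n. cng_sat lam r (M n))))"
proof (intro conjI allI impI; (elim conjE)?)
  fix M :: "('np, 'nf) sbp_mesh"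
  assume "discretized_mesh \<Omega> \<Gamma>D \<Gamma>N r M"
  then have mesh: "geometric_mesh \<Omega> \<Gamma>D \<Gamma>N r M" and sbp: "sbp_operators r M"
    by (simp_all add: discretized_mesh_def)
  show "conservative lam r M (cng_sat lam r M)"
    by (rule cng_conservative[OF mesh sbp])
  show "energy_stable lam r M (cng_sat lam r M)"
    using lam_spd vnode_in_domain[OF mesh ref] by (intro cng_energy_stable[OF mesh sbp]) blast
next
  fix M :: "nat \<Rightarrow> ('np, 'nf) sbp_mesh"
  assume M: "\<forall>n. discretized_mesh \<Omega> \<Gamma>D \<Gamma>N r (M n)" "regular_family r M" "order_accurate \<Omega> r M"
    and lim: "(\<lambda>n. mesh_size r (M n)) \<longlonglongrightarrow> 0" and lam: "\<forall>i j. Ck_on (deg r) \<Omega> (\<lambda>x. lam x $ i $ j)"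
  interpret mesh_family \<Omega> \<Gamma>D \<Gamma>N lam r M
  proof
    show "continuous_on \<Omega> (\<lambda>x. lam x $ c $ d)" for c d
      using lam by (intro Ck_on_continuous) blast
  qed (use domain ref M in auto)
  show "consistent \<Omega> lam r M (\<lambda>n. cng_sat lam r (M n))" if "3 \<le> deg r"
    by (rule cng_consistent[OF lim that]) (use lam in blast)
  show "consistent_global \<Omega> lam r M (\<lambda>n. cng_sat lam r (M n))" if "2 \<le> deg r"
    by (rule cng_consistent_global[OF lim that]) (use lam in blast)
qed

end
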